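(* For every $k\in\mathbb{N}$, the $k$-th exact eigenvalue $\lambda=\lambda_k$ of the Schrödinger eigenvalue problem and the $k$-th Crouzeix–Raviart eigenvalue $\lambda_{\mathrm{CR}}=\lambda_{\mathrm{CR}(k)}$ satisfy $$\mathrm{GLB}_{\mathrm{CR}}:=\frac{\lambda_{\mathrm{CR}}}{1+\big(\sqrt{\varepsilon}+\sqrt{\delta/\lambda_{\mathrm{CR}}}\big)^2\lambda_{\mathrm{CR}}}\le\lambda .$$
   Context: Let $\Omega\subset\mathbb{R}^n$, $n\ge2$, be a polyhedral bounded Lipschitz domain and $V\in L^\infty(\Omega)$ with $\operatorname{ess\,inf}_\Omega V=0$. Write $(v,w)_V:=\int_\Omega V v w\,dx$. The exact eigenvalues $0<\lambda_1\le\lambda_2\le\dots$ (counted with multiplicity) are those of: find $(\lambda,u)\in\mathbb{R}_+\times H_0^1(\Omega)$, $u\ne0$, with $\int_\Omega\nabla u\cdot\nabla v\,dx+(u,v)_V=\lambda\int_\Omega uv\,dx$ for all $v\in H^1_0(\Omega)$. $\mathcal{T}$ is a regular (face-to-face) triangulation of $\Omega$ into non-degenerate compact $n$-simplices, $h_T:=\operatorname{diam}(T)$, $h_{\mathcal T}|_T:=h_T$, $\mathcal F$ is the set of all faces, $\mathcal F(\Omega)$ the set of interior faces, $\operatorname{mid}(F)$ the barycenter of $F$. The jump $[v]_F$ of a piecewise continuous function is the difference of the traces from the two adjacent simplices if $F$ is interior and the trace $v|_F$ if $F\subset\partial\Omega$. $P_1(\mathcal T)$ is the space of piecewise affine functions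 and $\mathrm{CR}_0^1(\mathcal T):=\{v\in P_1(\mathcal T): [v]_F(\operatorname{mid}(F))=0\ \forall F\in\mathcal F\}$. Let $a_{\mathrm{pw}}(v,w):=\sum_{T\in\mathcal T}\int_T\nabla v\cdot\nabla w\,dx$. The Crouzeix–Raviart eigenvalues $0<\lambda_{\mathrm{CR}(1)}\le\dots\le\lambda_{\mathrm{CR}(N)}$, $N=\dim\mathrm{CR}_0^1(\mathcal T)$, are those of: find $(\lambda_h,u_h)\in\mathbb{R}_+\times\mathrm{CR}_0^1(\mathcal T)$, $u_h\neq 0$, with $a_{\mathrm{pw}}(u_h,v_h)+(u_h,v_h)_V=\lambda_h\int_\Omega u_hv_h\,dx$ for all $v_h\in\mathrm{CR}_0^1(\mathcal T)$. Convention: $\lambda_{\mathrm{CR}(k)}=+\infty$ for $k>N$, and the bound is then read as its limit for $\lambda_{\mathrm{CR}}\to\infty$. Interpolation: for $F\in\mathcal F(\Omega)$ let $\psi_F\in\mathrm{CR}^1_0(\mathcal T)$ be the function equal to $1$ at $\operatorname{mid}(F)$ and $0$ at the midpoints of all other faces, and $I_{\mathrm{CR}}v:=\sum_{F\in\mathcal F(\Omega)}\big(|F|^{-1}\int_Fv\,ds\big)\psi_F$. The constant $\kappa_{\mathrm{CR}}>0$ is such that $\|v-I_{\mathrm{CR}}v\|_{L^2(T)}\le\kappa_{\mathrm{CR}}h_T\|\nabla(v-I_{\mathrm{CR}}v)\|_{L^2(T)}$ for all $v\in H^1_0(\Omega)$, $T\in\mathcal T$ (admissible choices are $\kappa_{\mathrm{CR}}=0.1893$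 for $n=2$ and $\kappa_{\mathrm{CR}}^2=\pi^{-2}+\frac1{2n(n+1)(n+2)}$ for all $n\ge2$). Set $\varepsilon:=\|\kappa_{\mathrm{CR}}^2h_{\mathcal T}^2\|_{L^\infty(\Omega)}$ and $\delta:=\|\kappa_{\mathrm{CR}}^2h_{\mathcal T}^2V\|_{L^\infty(\Omega)}$. *)

theory Defs
  imports "HOL-Analysis.Analysis" "HOL-Probability.Essential_Supremum"
begin

section \<open>Lebesgue spaces\<close>

text \<open>Functions are representatives; two functions are identified when they agree almost everywhere
  with respect to the measure at hand.\<close>

definition L2 :: "'a measure \<Rightarrow> ('a \<Rightarrow> 'b::{real_normed_vector, second_countable_topology}) set" where
  "L2 M = {f. f \<in> borel_measurable M \<and> integrable M (\<lambda>x. (norm (f x))\<^sup>2)}"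

definition L2_norm :: "'a measure \<Rightarrow> ('a \<Rightarrow> 'b::real_normed_vector) \<Rightarrow> real" where
  "L2_norm M f = sqrt (\<integral>x. (norm (f x))\<^sup>2 \<partial>M)"

definition Linf :: "'a measure \<Rightarrow> ('a \<Rightarrow> real) set" where
  "Linf M = {f. f \<in> borel_measurable M \<and> esssup M (\<lambda>x. ereal \<bar>f x\<bar>) < \<infinity>}"

definition Linf_norm :: "'a measure \<Rightarrow> ('a \<Rightarrow> real) \<Rightarrow> real" where
  "Linf_norm M f = real_of_ereal (esssup M (\<lambda>x. ereal \<bar>f x\<bar>))"

definition essinf :: "'a measure \<Rightarrow> ('a \<Rightarrow> real) \<Rightarrow> ereal" where
  "essinf M f = - esssup M (\<lambda>x. - ereal (f x))"

section \<open>Sobolev spaces\<close>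

definition grad :: "(real^'n \<Rightarrow> real) \<Rightarrow> real^'n \<Rightarrow> real^'n" where
  "grad f x = (\<chi> i. frechet_derivative f (at x) (axis i 1))"

primrec Ck :: "nat \<Rightarrow> (real^'n \<Rightarrow> real) \<Rightarrow> bool" where
  "Ck 0 f \<longleftrightarrow> continuous_on UNIV f"
| "Ck (Suc k) f \<longleftrightarrow> (\<forall>x. f differentiable (at x)) \<and> (\<forall>i. Ck k (\<lambda>x. grad f x $ i))"

definition test_functions :: "(real^'n) set \<Rightarrow> (real^'n \<Rightarrow> real) set" where
  "test_functions \<Omega> = {\<phi>. (\<forall>k. Ck k \<phi>) \<and> compact (closure {x. \<phi> x \<noteq> 0}) \<and> closure {x. \<phi> x \<noteq> 0} \<subseteq> \<Omega>}"

definition is_weak_grad :: "(real^'n) set \<Rightarrow> (real^'n \<Rightarrow> real) \<Rightarrow> (real^'n \<Rightarrow> real^'n) \<Rightarrow> bool" where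
  "is_weak_grad \<Omega> v g \<longleftrightarrow> g \<in> L2 (lebesgue_on \<Omega>) \<and>
     (\<forall>\<phi>\<in>test_functions \<Omega>.
        (\<integral>x. v x *\<^sub>R grad \<phi> x \<partial>lebesgue_on \<Omega>) = - (\<integral>x. \<phi> x *\<^sub>R g x \<partial>lebesgue_on \<Omega>))"

definition H1 :: "(real^'n) set \<Rightarrow> (real^'n \<Rightarrow> real) set" where
  "H1 \<Omega> = {v \<in> L2 (lebesgue_on \<Omega>). \<exists>g. is_weak_grad \<Omega> v g}"

definition weak_grad :: "(real^'n) set \<Rightarrow> (real^'n \<Rightarrow> real) \<Rightarrow> real^'n \<Rightarrow> real^'n" where
  "weak_grad \<Omega> v = (SOME g. is_weak_grad \<Omega> v g)"

definition test_approx :: "(real^'n) set \<Rightarrow> (nat \<Rightarrow> real^'n \<Rightarrow> real) \<Rightarrow> (real^'n \<Rightarrow> real) \<Rightarrow> bool" where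
  "test_approx \<Omega> \<phi> v \<longleftrightarrow> (\<forall>m. \<phi> m \<in> test_functions \<Omega>) \<and>
     (\<lambda>m. L2_norm (lebesgue_on \<Omega>) (\<lambda>x. \<phi> m x - v x)) \<longlonglongrightarrow> 0 \<and>
     (\<lambda>m. L2_norm (lebesgue_on \<Omega>) (\<lambda>x. grad (\<phi> m) x - weak_grad \<Omega> v x)) \<longlonglongrightarrow> 0"

definition H10 :: "(real^'n) set \<Rightarrow> (real^'n \<Rightarrow> real) set" where
  "H10 \<Omega> = {v \<in> H1 \<Omega>. \<exists>\<phi>. test_approx \<Omega> \<phi> v}"

section \<open>Polyhedral Lipschitz domains and triangulations\<close>

text \<open>Near each boundary point, \<open>\<Omega>\<close> is the strict epigraph, in the direction of a unit vector \<open>e\<close>,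
  of a Lipschitz function on the hyperplane orthogonal to \<open>e\<close>.\<close>

definition lipschitz_boundary :: "(real^'n) set \<Rightarrow> bool" where
  "lipschitz_boundary \<Omega> \<longleftrightarrow> (\<forall>x\<in>frontier \<Omega>. \<exists>U e \<gamma> L. open U \<and> x \<in> U \<and> norm e = 1 \<and>
     L-lipschitz_on {z. e \<bullet> z = 0} \<gamma> \<and>
     \<Omega> \<inter> U = {y \<in> U. \<gamma> (y - (e \<bullet> y) *\<^sub>R e) < e \<bullet> y})"

definition polyhedral_lipschitz_domain :: "(real^'n) set \<Rightarrow> bool" where
  "polyhedral_lipschitz_domain \<Omega> \<longleftrightarrow>
     open \<Omega> \<and> connected \<Omega> \<and> \<Omega> \<noteq> {} \<and> bounded \<Omega> \<and> lipschitz_boundary \<Omega> \<and>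
     (\<exists>P. finite P \<and> (\<forall>p\<in>P. polytope p) \<and> closure \<Omega> = \<Union>P)"

definition regular_triangulation :: "(real^'n) set \<Rightarrow> (real^'n) set set \<Rightarrow> bool" where
  "regular_triangulation \<Omega> \<T> \<longleftrightarrow>
     triangulation \<T> \<and> (\<forall>T\<in>\<T>. int CARD('n) simplex T) \<and> closure \<Omega> = \<Union>\<T>"

definition faces :: "(real^'n) set set \<Rightarrow> (real^'n) set set" where
  "faces \<T> = {F. \<exists>T\<in>\<T>. F facet_of T}"

definition interior_faces :: "(real^'n) set \<Rightarrow> (real^'n) set set \<Rightarrow> (real^'n) set set" where
  "interior_faces \<Omega> \<T> = {F \<in> faces \<T>. \<not> F \<subseteq> frontier \<Omega>}"

definition mid :: "(real^'n) set \<Rightarrow> real^'n" where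
  "mid F = (\<Sum>x | x extreme_point_of F. x) /\<^sub>R real (card {x. x extreme_point_of F})"

definition mesh_size :: "(real^'n) set set \<Rightarrow> real^'n \<Rightarrow> real" where
  "mesh_size \<T> x = diameter (THE T. T \<in> \<T> \<and> x \<in> interior T)"

section \<open>The Crouzeix--Raviart space\<close>

text \<open>A piecewise affine function is multivalued on the skeleton of the triangulation. Its
  representatives are constrained in the open simplices only, and its values on the boundary of
  \<open>T\<close> are the traces from the inside of \<open>T\<close>.\<close>

definition P1 :: "(real^'n) set set \<Rightarrow> (real^'n \<Rightarrow> real) set" where
  "P1 \<T> = {v. \<forall>T\<in>\<T>. \<exists>a b. \<forall>x\<in>interior T. v x = a \<bullet> x + b}"

definition trace_from :: "(real^'n) set \<Rightarrow> (real^'n \<Rightarrow> real) \<Rightarrow> real^'n \<Rightarrow> real" where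
  "trace_from T v x = Lim (at x within interior T) v"

definition jump :: "(real^'n) set \<Rightarrow> (real^'n) set \<Rightarrow> (real^'n \<Rightarrow> real) \<Rightarrow> real^'n \<Rightarrow> real" where
  "jump T T' v x = trace_from T v x - trace_from T' v x"

definition CR10 :: "(real^'n) set \<Rightarrow> (real^'n) set set \<Rightarrow> (real^'n \<Rightarrow> real) set" where
  "CR10 \<Omega> \<T> = {v \<in> P1 \<T>.
     (\<forall>F\<in>interior_faces \<Omega> \<T>. \<forall>T\<in>\<T>. \<forall>T'\<in>\<T>.
        T \<noteq> T' \<and> F facet_of T \<and> F facet_of T' \<longrightarrow> jump T T' v (mid F) = 0) \<and>
     (\<forall>F\<in>faces \<T>. F \<subseteq> frontier \<Omega> \<longrightarrow> (\<forall>T\<in>\<T>. F facet_of T \<longrightarrow> trace_from T v (mid F) = 0))}"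

definition CR_basis :: "(real^'n) set \<Rightarrow> (real^'n) set set \<Rightarrow> (real^'n) set \<Rightarrow> real^'n \<Rightarrow> real" where
  "CR_basis \<Omega> \<T> F = (SOME \<psi>. \<psi> \<in> CR10 \<Omega> \<T> \<and>
     (\<forall>T\<in>\<T>. \<forall>G. G facet_of T \<longrightarrow> trace_from T \<psi> (mid G) = (if G = F then 1 else 0)))"

section \<open>Face integrals and the Crouzeix--Raviart interpolation\<close>

text \<open>The \<open>(n-1)\<close>-dimensional surface measure on the hyperplane \<open>affine hull F\<close> is the image, under
  orthogonal projection onto that hyperplane, of Lebesgue measure on the slab of thickness one
  centred at it.\<close>

definition face_measure :: "(real^'n) set \<Rightarrow> (real^'n) measure" where
  "face_measure F = restrict_space
     (distr (restrict_space lborel {y. infdist y (affine hull F) \<le> 1/2}) borel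
            (closest_point (affine hull F))) F"

text \<open>The trace on a face of a function in \<open>H\<^sup>1\<^sub>0(\<Omega>)\<close> is the \<open>L\<^sup>2\<close> limit of the restrictions of
  approximating test functions.\<close>

definition is_face_trace :: "(real^'n) set \<Rightarrow> (real^'n) set \<Rightarrow> (real^'n \<Rightarrow> real) \<Rightarrow> (real^'n \<Rightarrow> real) \<Rightarrow> bool" where
  "is_face_trace \<Omega> F v w \<longleftrightarrow> w \<in> L2 (face_measure F) \<and>
     (\<exists>\<phi>. test_approx \<Omega> \<phi> v \<and> (\<lambda>m. L2_norm (face_measure F) (\<lambda>x. \<phi> m x - w x)) \<longlonglongrightarrow> 0)"

definition face_trace :: "(real^'n) set \<Rightarrow> (real^'n) set \<Rightarrow> (real^'n \<Rightarrow> real) \<Rightarrow> real^'n \<Rightarrow> real" where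
  "face_trace \<Omega> F v = (SOME w. is_face_trace \<Omega> F v w)"

definition I_CR :: "(real^'n) set \<Rightarrow> (real^'n) set set \<Rightarrow> (real^'n \<Rightarrow> real) \<Rightarrow> real^'n \<Rightarrow> real" where
  "I_CR \<Omega> \<T> v x = (\<Sum>F\<in>interior_faces \<Omega> \<T>.
     (\<integral>y. face_trace \<Omega> F v y \<partial>face_measure F) / measure (face_measure F) F * CR_basis \<Omega> \<T> F x)"

definition CR_interpolation_constant :: "(real^'n) set \<Rightarrow> (real^'n) set set \<Rightarrow> real \<Rightarrow> bool" where
  "CR_interpolation_constant \<Omega> \<T> \<kappa> \<longleftrightarrow> 0 < \<kappa> \<and>
     (\<forall>v\<in>H10 \<Omega>. \<forall>T\<in>\<T>.
        L2_norm (lebesgue_on T) (\<lambda>x. v x - I_CR \<Omega> \<T> v x)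
        \<le> \<kappa> * diameter T * L2_norm (lebesgue_on T) (\<lambda>x. weak_grad \<Omega> v x - grad (I_CR \<Omega> \<T> v) x))"

section \<open>Eigenvalues\<close>

text \<open>Dimension of a space of functions modulo equality almost everywhere.\<close>

definition has_dim_ae :: "'a measure \<Rightarrow> ('a \<Rightarrow> real) set \<Rightarrow> nat \<Rightarrow> bool" where
  "has_dim_ae M E d \<longleftrightarrow> (\<exists>b :: nat \<Rightarrow> 'a \<Rightarrow> real.
     (\<forall>i<d. b i \<in> E) \<and>
     (\<forall>c. (AE x in M. (\<Sum>i<d. c i * b i x) = 0) \<longrightarrow> (\<forall>i<d. c i = 0)) \<and>
     (\<forall>u\<in>E. \<exists>c. AE x in M. u x = (\<Sum>i<d. c i * b i x)))"

text \<open>The nondecreasing family \<open>lam\<close> on the index set \<open>J\<close> lists the positive eigenvalues with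
  multiplicity, where \<open>E \<mu>\<close> is the eigenspace of \<open>\<mu>\<close> (trivial if \<open>\<mu>\<close> is not an eigenvalue).\<close>

definition lists_eigenvalues :: "'a measure \<Rightarrow> (real \<Rightarrow> ('a \<Rightarrow> real) set) \<Rightarrow> nat set \<Rightarrow> (nat \<Rightarrow> real) \<Rightarrow> bool" where
  "lists_eigenvalues M E J lam \<longleftrightarrow>
     (\<forall>j\<in>J. 0 < lam j) \<and> mono_on J lam \<and>
     (\<forall>\<mu>>0. finite {j\<in>J. lam j = \<mu>} \<and> has_dim_ae M (E \<mu>) (card {j\<in>J. lam j = \<mu>}))"

definition eigenspace :: "(real^'n) set \<Rightarrow> (real^'n \<Rightarrow> real) \<Rightarrow> real \<Rightarrow> (real^'n \<Rightarrow> real) set" where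
  "eigenspace \<Omega> V \<mu> = {u \<in> H10 \<Omega>. \<forall>v\<in>H10 \<Omega>.
     (\<integral>x. weak_grad \<Omega> u x \<bullet> weak_grad \<Omega> v x \<partial>lebesgue_on \<Omega>) + (\<integral>x. V x * u x * v x \<partial>lebesgue_on \<Omega>)
     = \<mu> * (\<integral>x. u x * v x \<partial>lebesgue_on \<Omega>)}"

definition exact_eigenvalues :: "(real^'n) set \<Rightarrow> (real^'n \<Rightarrow> real) \<Rightarrow> (nat \<Rightarrow> real) \<Rightarrow> bool" where
  "exact_eigenvalues \<Omega> V lam \<longleftrightarrow> lists_eigenvalues (lebesgue_on \<Omega>) (eigenspace \<Omega> V) {1..} lam"

definition a_pw :: "(real^'n) set set \<Rightarrow> (real^'n \<Rightarrow> real) \<Rightarrow> (real^'n \<Rightarrow> real) \<Rightarrow> real" where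
  "a_pw \<T> v w = (\<Sum>T\<in>\<T>. \<integral>x. grad v x \<bullet> grad w x \<partial>lebesgue_on T)"

definition CR_eigenspace :: "(real^'n) set \<Rightarrow> (real^'n) set set \<Rightarrow> (real^'n \<Rightarrow> real) \<Rightarrow> real \<Rightarrow> (real^'n \<Rightarrow> real) set" where
  "CR_eigenspace \<Omega> \<T> V \<mu> = {u \<in> CR10 \<Omega> \<T>. \<forall>v\<in>CR10 \<Omega> \<T>.
     a_pw \<T> u v + (\<integral>x. V x * u x * v x \<partial>lebesgue_on \<Omega>) = \<mu> * (\<integral>x. u x * v x \<partial>lebesgue_on \<Omega>)}"

definition CR_eigenvalues :: "(real^'n) set \<Rightarrow> (real^'n) set set \<Rightarrow> (real^'n \<Rightarrow> real) \<Rightarrow> (nat \<Rightarrow> ereal) \<Rightarrow> bool" where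
  "CR_eigenvalues \<Omega> \<T> V lamCR \<longleftrightarrow> (\<exists>N \<mu>. has_dim_ae (lebesgue_on \<Omega>) (CR10 \<Omega> \<T>) N \<and>
     lists_eigenvalues (lebesgue_on \<Omega>) (CR_eigenspace \<Omega> \<T> V) {1..N} \<mu> \<and>
     (\<forall>k\<ge>1. lamCR k = (if k \<le> N then ereal (\<mu> k) else \<infinity>)))"

section \<open>The lower bound\<close>

definition mesh_epsilon :: "(real^'n) set \<Rightarrow> (real^'n) set set \<Rightarrow> real \<Rightarrow> real" where
  "mesh_epsilon \<Omega> \<T> \<kappa> = Linf_norm (lebesgue_on \<Omega>) (\<lambda>x. \<kappa>\<^sup>2 * (mesh_size \<T> x)\<^sup>2)"

definition mesh_delta :: "(real^'n) set \<Rightarrow> (real^'n) set set \<Rightarrow> (real^'n \<Rightarrow> real) \<Rightarrow> real \<Rightarrow> real" where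
  "mesh_delta \<Omega> \<T> V \<kappa> = Linf_norm (lebesgue_on \<Omega>) (\<lambda>x. \<kappa>\<^sup>2 * (mesh_size \<T> x)\<^sup>2 * V x)"

definition glb :: "real \<Rightarrow> real \<Rightarrow> real \<Rightarrow> real" where
  "glb \<epsilon> \<delta> \<mu> = \<mu> / (1 + (sqrt \<epsilon> + sqrt (\<delta> / \<mu>))\<^sup>2 * \<mu>)"

definition GLB_CR :: "real \<Rightarrow> real \<Rightarrow> ereal \<Rightarrow> real" where
  "GLB_CR \<epsilon> \<delta> \<mu> = (if \<mu> = \<infinity> then Lim at_top (glb \<epsilon> \<delta>) else glb \<epsilon> \<delta> (real_of_ereal \<mu>))"

lemma GLB_CR_infinity:
  assumes "0 < \<epsilon>"
  shows "GLB_CR \<epsilon> \<delta> \<infinity> = 1 / \<epsilon>"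
proof -
  have *: "1 / (1 / \<mu> + s) = \<mu> / (1 + s * \<mu>)" if "0 < \<mu>" for \<mu> s :: real
  proof -
    have "1 / \<mu> + s = (1 + s * \<mu>) / \<mu>"
      using that by (simp add: add_divide_distrib)
    then show ?thesis by simp
  qed
  have d: "((\<lambda>\<mu>::real. \<delta> / \<mu>) \<longlongrightarrow> 0) at_top" and i: "((\<lambda>\<mu>::real. 1 / \<mu>) \<longlongrightarrow> 0) at_top"
    by (auto intro!: tendsto_divide_0[OF tendsto_const] filterlim_at_top_imp_at_infinity filterlim_ident)
  have "((\<lambda>\<mu>. 1 / (1 / \<mu> + (sqrt \<epsilon> + sqrt (\<delta> / \<mu>))\<^sup>2)) \<longlongrightarrow> 1 / (0 + (sqrt \<epsilon> + sqrt 0)\<^sup>2)) at_top"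
    using assms by (intro tendsto_intros d i) auto
  moreover have "\<forall>\<^sub>F \<mu> in at_top. 1 / (1 / \<mu> + (sqrt \<epsilon> + sqrt (\<delta> / \<mu>))\<^sup>2) = glb \<epsilon> \<delta> \<mu>"
    using eventually_gt_at_top[of 0]
    by eventually_elim (simp add: glb_def *)
  ultimately have "(glb \<epsilon> \<delta> \<longlongrightarrow> 1 / \<epsilon>) at_top"
    using assms by (simp add: tendsto_cong)
  then show ?thesis
    by (simp add: GLB_CR_def tendsto_Lim)
qed

end

(* Let v range over the span of the first k exact eigenfunctions. By counting dimensions some v \<noteq> 0 has an
   interpolant w = I_CR v that is L2-orthogonal to the first k - 1 discrete eigenfunctions (or w = 0 if k > N),
   so that lambda_CR |w|^2 <= |grad_pw w|^2 + |w|_V^2. On every simplex the gradient of w is the mean of the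
   gradient of v, whence |grad_pw w|^2 = |grad v|^2 - e^2 with e = |grad_pw (v - w)|, while
   |v - w| <= sqrt(epsilon) e and |v - w|_V <= sqrt(delta) e by the choice of kappa. Together with
   |grad v|^2 + |v|_V^2 <= lambda |v|^2 and the triangle inequality this gives
   sqrt(lambda_CR) |v| <= (sqrt(epsilon lambda_CR) + sqrt(delta)) e + sqrt(lambda |v|^2 - e^2),
   and the Cauchy-Schwarz inequality in the plane yields the bound.

   The mean value property of the gradient rests on the identity
   d int_F phi ds = int_T (n phi + grad phi . (x - p)) dx for the facet F of T opposite to the vertex p at
   distance d. It also bounds traces in terms of the H1 norm and extends by density to all of H10. The uniqueness
   of weak gradients makes H10 a linear space on which they depend linearly. *)

theory Submission
  imports Defs
begin

section \<open>Linear algebra and eigenvalue lists\<close>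

text \<open>\<open>weak_grad\<close>, \<open>face_trace\<close> and \<open>CR_basis\<close> are
  known only through choices. Each is therefore first tied to something that determines it:
  uniqueness almost everywhere, a volume integral equal to the face integral, and values at
  barycentres. This is why even the linearity of \<open>I_CR\<close> has to wait for the face
  identity. The face identity plays the part of the divergence theorem on a simplex. It is assembled
  from one-dimensional integrations parallel to the edges at \<open>p\<close>; these fit the slab
  definition of surface measure because an oblique step differs from a normal one by a translation
  of the slab into itself. A list of eigenvalues provides no more than dimensions of eigenspaces. In
  place of a min-max principle, exact eigenfunctions enter through finite sums, on which the form is
  diagonal after grouping, and on the discrete side the count \<open>N\<close> makes the
  eigenfunctions span. The defect \<open>e\<close> is never estimated. It lowers the discrete energy
  while it enlarges the gap between \<open>v\<close> and \<open>w\<close>, and the final inequality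
  holds for every balance between the two effects.\<close>

lemma homogeneous_system_nontrivial_solution:
  fixes A :: "nat \<Rightarrow> nat \<Rightarrow> real"
  assumes "m < n"
  shows "\<exists>x. (\<exists>i<n. x i \<noteq> 0) \<and> (\<forall>j<m. (\<Sum>i<n. A j i * x i) = 0)"
  using assms
proof (induction m arbitrary: n A)
  case 0
  then show ?case by (intro exI[of _ "\<lambda>_. 1"]) auto
next
  case (Suc m)
  show ?case
  \<comment> \<open>Gaussian elimination: an equation with zero coefficients is dropped; any other
    is solved for an unknown \<open>p\<close> and substituted into the rest, which costs one
    equation and one unknown.\<close>
  proof (cases "\<forall>i<n. A m i = 0")
    case True
    obtain x where "\<exists>i<n. x i \<noteq> 0" "\<forall>j<m. (\<Sum>i<n. A j i * x i) = 0"
      using Suc.IH[of n A] Suc.prems by auto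
    with True show ?thesis
      by (intro exI[of _ x]) (auto simp: less_Suc_eq)
  next
    case False
    then obtain p where p: "p < n" "A m p \<noteq> 0" by auto
    \<comment> \<open>Renumbers the unknowns other than \<open>p\<close>, as the induction
      hypothesis speaks of initial segments.\<close>
    define s where "s i = (if i < p then i else Suc i)" for i
    have s: "bij_betw s {..<n-1} ({..<n} - {p})"
    proof (rule bij_betw_byWitness[where f' = "\<lambda>i. if i < p then i else i - 1"])
      show "s ` {..<n - 1} \<subseteq> {..<n} - {p}" using p by (auto simp: s_def)
      show "(\<lambda>i. if i < p then i else i - 1) ` ({..<n} - {p}) \<subseteq> {..<n - 1}" using p by auto
    qed (auto simp: s_def)
    define B where "B j i = A j (s i) - A j p / A m p * A m (s i)" for j i
    have "m < n - 1" using Suc.prems by simp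
    obtain y where y: "\<exists>i<n-1. y i \<noteq> 0" "\<forall>j<m. (\<Sum>i<n-1. B j i * y i) = 0"
      using Suc.IH[of "n-1" B] \<open>m < n - 1\<close> by metis
    \<comment> \<open>The value of the unknown \<open>p\<close> that the last equation
      forces.\<close>
    define t where "t = - (\<Sum>i<n-1. A m (s i) * y i) / A m p"
    define x where "x i = (if i = p then t else y (inv_into {..<n-1} s i))" for i
    have xs: "x (s i) = y i" if "i < n-1" for i
    proof -
      have "s i \<noteq> p" by (auto simp: s_def)
      moreover have "inv_into {..<n-1} s (s i) = i"
        using that s by (intro inv_into_f_f) (auto simp: bij_betw_def)
      ultimately show ?thesis by (simp add: x_def)
    qed
    have sum: "(\<Sum>i<n. A j i * x i) = A j p * t + (\<Sum>i<n-1. A j (s i) * y i)" for j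
    proof -
      have "(\<Sum>i<n. A j i * x i) = A j p * x p + (\<Sum>i\<in>{..<n} - {p}. A j i * x i)"
        using p by (intro sum.remove) auto
      also have "(\<Sum>i\<in>{..<n} - {p}. A j i * x i) = (\<Sum>i<n-1. A j (s i) * x (s i))"
        by (rule sum.reindex_bij_betw[OF s, symmetric])
      also have "\<dots> = (\<Sum>i<n-1. A j (s i) * y i)"
        by (intro sum.cong) (simp_all add: xs)
      finally show ?thesis by (simp add: x_def)
    qed
    have "\<exists>i<n. x i \<noteq> 0"
    proof -
      obtain i where i: "i < n - 1" "y i \<noteq> 0" using y(1) by blast
      then have "s i < n" using s by (auto simp: bij_betw_def)
      with i xs[of i] show ?thesis by metis
    qed
    moreover have "(\<Sum>i<n. A j i * x i) = 0" if "j < Suc m" for j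
    proof (cases "j = m")
      case True
      then show ?thesis using p by (simp add: sum t_def)
    next
      case False
      then have "0 = (\<Sum>i<n-1. B j i * y i)" using y(2) that by auto
      also have "\<dots> = (\<Sum>i<n-1. A j (s i) * y i) - A j p / A m p * (\<Sum>i<n-1. A m (s i) * y i)"
        by (simp add: B_def algebra_simps sum_subtractf sum_distrib_left)
      finally show ?thesis by (simp add: sum t_def)
    qed
    ultimately show ?thesis by blast
  qed
qed

text \<open>Only the algebra of a symmetric form enters the eigenvalue arguments, so the exact
  problem on \<open>H10\<close> and the discrete one on \<open>CR10\<close> share them. Elements are
  representatives, hence \<open>W\<close> is a set of functions closed under combinations rather
  than a quotient.\<close>

locale symmetric_form =
  fixes M :: "'a measure" and W :: "('a \<Rightarrow> real) set" and a :: "('a \<Rightarrow> real) \<Rightarrow> ('a \<Rightarrow> real) \<Rightarrow> real"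
  assumes zero_mem: "(\<lambda>x. 0) \<in> W"
    and lin_mem: "u \<in> W \<Longrightarrow> v \<in> W \<Longrightarrow> (\<lambda>x. \<alpha> * u x + \<beta> * v x) \<in> W"
    and integrable_prod: "u \<in> W \<Longrightarrow> v \<in> W \<Longrightarrow> integrable M (\<lambda>x. u x * v x)"
    and a_lin: "u \<in> W \<Longrightarrow> v \<in> W \<Longrightarrow> w \<in> W \<Longrightarrow> a (\<lambda>x. \<alpha> * u x + \<beta> * v x) w = \<alpha> * a u w + \<beta> * a v w"
    and a_sym: "u \<in> W \<Longrightarrow> v \<in> W \<Longrightarrow> a u v = a v u"
begin

definition eigs :: "real \<Rightarrow> ('a \<Rightarrow> real) set" where
  "eigs \<mu> = {u \<in> W. \<forall>v\<in>W. a u v = \<mu> * (\<integral>x. u x * v x \<partial>M)}"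

abbreviation ip :: "('a \<Rightarrow> real) \<Rightarrow> ('a \<Rightarrow> real) \<Rightarrow> real" where
  "ip u v \<equiv> \<integral>x. u x * v x \<partial>M"

lemma sum_mem:
  assumes "finite K" "\<And>j. j \<in> K \<Longrightarrow> e j \<in> W"
  shows "(\<lambda>x. \<Sum>j\<in>K. c j * e j x) \<in> W"
  using assms
proof (induction K rule: finite_induct)
  case (insert i K)
  then show ?case
    using lin_mem[of "e i" "\<lambda>x. \<Sum>j\<in>K. c j * e j x" "c i" 1] by simp
qed (simp add: zero_mem)

lemma a_zero: "w \<in> W \<Longrightarrow> a (\<lambda>x. 0) w = 0"
  using a_lin[OF zero_mem zero_mem, of w 0 0] by simp

lemma a_sum:
  assumes "finite K" "\<And>j. j \<in> K \<Longrightarrow> e j \<in> W" "w \<in> W"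
  shows "a (\<lambda>x. \<Sum>j\<in>K. c j * e j x) w = (\<Sum>j\<in>K. c j * a (e j) w)"
  using assms
proof (induction K rule: finite_induct)
  case (insert i K)
  then show ?case
    using a_lin[of "e i" "\<lambda>x. \<Sum>j\<in>K. c j * e j x" w "c i" 1] sum_mem[of K e c] by simp
qed (simp add: a_zero)

lemma ip_sum:
  assumes "finite K" "\<And>j. j \<in> K \<Longrightarrow> e j \<in> W" "w \<in> W"
  shows "ip (\<lambda>x. \<Sum>j\<in>K. c j * e j x) w = (\<Sum>j\<in>K. c j * ip (e j) w)"
proof -
  have "ip (\<lambda>x. \<Sum>j\<in>K. c j * e j x) w = (\<integral>x. (\<Sum>j\<in>K. c j * (e j x * w x)) \<partial>M)"
    by (simp add: sum_distrib_right mult.assoc)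
  also have "\<dots> = (\<Sum>j\<in>K. c j * ip (e j) w)"
    using assms by (subst Bochner_Integration.integral_sum) (auto intro!: integrable_mult_right integrable_prod)
  finally show ?thesis .
qed

lemma ip_sym: "ip u v = ip v u"
  by (simp add: mult.commute)

lemma ip_self_0:
  assumes "u \<in> W" "ip u u = 0"
  shows "AE x in M. u x = 0"
  using integral_nonneg_eq_0_iff_AE[OF integrable_prod[OF assms(1) assms(1)]] assms(2) by auto

lemma eigs_mem: "u \<in> eigs \<mu> \<Longrightarrow> u \<in> W"
  by (simp add: eigs_def)

lemma eigs_orthogonal:
  assumes "u \<in> eigs \<mu>" "v \<in> eigs \<nu>" "\<mu> \<noteq> \<nu>"
  shows "ip u v = 0"
proof -
  have "\<mu> * ip u v = \<nu> * ip v u"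
    using assms a_sym[of u v] by (auto simp: eigs_def)
  with \<open>\<mu> \<noteq> \<nu>\<close> show ?thesis by (simp add: ip_sym[of u v])
qed

lemma eigs_sum:
  assumes "finite K" "\<And>j. j \<in> K \<Longrightarrow> e j \<in> eigs \<mu>"
  shows "(\<lambda>x. \<Sum>j\<in>K. c j * e j x) \<in> eigs \<mu>"
  unfolding eigs_def
proof (intro CollectI conjI ballI)
  show "(\<lambda>x. \<Sum>j\<in>K. c j * e j x) \<in> W"
    using assms by (intro sum_mem) (auto simp: eigs_def)
  fix v assume v: "v \<in> W"
  have "a (\<lambda>x. \<Sum>j\<in>K. c j * e j x) v = (\<Sum>j\<in>K. c j * a (e j) v)"
    using assms v by (intro a_sum) (auto simp: eigs_def)
  also have "\<dots> = (\<Sum>j\<in>K. \<mu> * (c j * ip (e j) v))"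
    using assms v by (intro sum.cong) (auto simp: eigs_def)
  also have "\<dots> = \<mu> * ip (\<lambda>x. \<Sum>j\<in>K. c j * e j x) v"
    using assms v by (subst ip_sum) (auto simp: eigs_def sum_distrib_left)
  finally show "a (\<lambda>x. \<Sum>j\<in>K. c j * e j x) v = \<mu> * ip (\<lambda>x. \<Sum>j\<in>K. c j * e j x) v" .
qed

section \<open>Grouping eigenfunctions by eigenvalue\<close>

context
  fixes K :: "nat set" and e :: "nat \<Rightarrow> 'a \<Rightarrow> real" and lam c :: "nat \<Rightarrow> real"
  assumes K: "finite K" and e: "\<And>j. j \<in> K \<Longrightarrow> e j \<in> eigs (lam j)"
begin

text \<open>Eigenfunctions of one eigenvalue need not be orthogonal to each other, but the partial
  sums belonging to different eigenvalues are. Grouping diagonalises both forms on a finite span and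
  replaces Gram-Schmidt.\<close>

private definition "grp \<mu> = (\<lambda>x. \<Sum>j | j \<in> K \<and> lam j = \<mu>. c j * e j x)"
private definition "tot = (\<lambda>x. \<Sum>j\<in>K. c j * e j x)"

private lemma grp_eigs: "grp \<mu> \<in> eigs \<mu>"
  unfolding grp_def using K e by (intro eigs_sum) auto

private lemma tot_sum_grp: "tot = (\<lambda>x. \<Sum>\<mu>\<in>lam ` K. 1 * grp \<mu> x)"
  unfolding tot_def grp_def by (subst sum.image_gen[OF K, of _ lam]) simp

private lemma tot_mem: "tot \<in> W"
  unfolding tot_def using K e eigs_mem by (intro sum_mem) blast+

private lemma ip_grp_tot: 
  assumes "\<mu> \<in> lam ` K" 
  shows "ip (grp \<mu>) tot = ip (grp \<mu>) (grp \<mu>)"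
proof -
  have "ip tot (grp \<mu>) = (\<Sum>\<nu>\<in>lam ` K. 1 * ip (grp \<nu>) (grp \<mu>))"
    unfolding tot_sum_grp using K grp_eigs eigs_mem by (intro ip_sum) blast+
  also have "\<dots> = (\<Sum>\<nu>\<in>lam ` K. if \<nu> = \<mu> then ip (grp \<mu>) (grp \<mu>) else 0)"
    using eigs_orthogonal[OF grp_eigs grp_eigs] by (intro sum.cong) auto
  finally show ?thesis using assms K by (simp add: ip_sym)
qed

private lemma a_tot: "a tot tot = (\<Sum>\<mu>\<in>lam ` K. \<mu> * ip (grp \<mu>) (grp \<mu>))"
proof -
  have "a tot tot = (\<Sum>\<mu>\<in>lam ` K. 1 * a (grp \<mu>) tot)"
    using K grp_eigs eigs_mem by (subst (1) tot_sum_grp, intro a_sum tot_mem) blast+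
  also have "\<dots> = (\<Sum>\<mu>\<in>lam ` K. \<mu> * ip (grp \<mu>) tot)"
    using grp_eigs tot_mem by (intro sum.cong) (auto simp: eigs_def)
  finally show ?thesis using ip_grp_tot by simp
qed

private lemma ip_tot: "ip tot tot = (\<Sum>\<mu>\<in>lam ` K. ip (grp \<mu>) (grp \<mu>))"
proof -
  have "ip tot tot = (\<Sum>\<mu>\<in>lam ` K. 1 * ip (grp \<mu>) tot)"
    using K grp_eigs eigs_mem by (subst (1) tot_sum_grp, intro ip_sum tot_mem) blast+
  then show ?thesis using ip_grp_tot by simp
qed

text \<open>Pairing a null combination with one group leaves the squared norm of that group, all
  other groups being orthogonal to it.\<close>

lemma eigenspan_independent:
  assumes "AE x in M. (\<Sum>j\<in>K. c j * e j x) = 0" "\<mu> \<in> lam ` K"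
  shows "AE x in M. (\<Sum>j | j \<in> K \<and> lam j = \<mu>. c j * e j x) = 0"
proof -
  have "ip (grp \<mu>) (grp \<mu>) = 0"
    unfolding ip_grp_tot[OF assms(2), symmetric]
    using assms(1) by (intro integral_eq_zero_AE) (auto simp: tot_def)
  then show ?thesis
    using ip_self_0[OF eigs_mem[OF grp_eigs]] by (simp add: grp_def)
qed

text \<open>Both forms are diagonal in the groups: each squared norm is weighted by its eigenvalue
  on one side and by \<open>L\<close> on the other.\<close>

lemma eigenspan_upper:
  assumes "\<And>j. j \<in> K \<Longrightarrow> lam j \<le> L"
  defines "u \<equiv> \<lambda>x. \<Sum>j\<in>K. c j * e j x"
  shows "a u u \<le> L * ip u u"
proof -
  have "a tot tot \<le> L * ip tot tot"
    unfolding a_tot ip_tot sum_distrib_left using assms(1)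
    by (intro sum_mono mult_right_mono) auto
  then show ?thesis by (simp add: u_def tot_def)
qed

text \<open>Groups below \<open>L\<close> have norm zero because their eigenfunctions are orthogonal
  to \<open>u\<close>; the remaining weights are at least \<open>L\<close>. Testing strictly below
  \<open>L\<close> avoids any discussion of multiplicities.\<close>

lemma eigenspan_lower:
  defines "u \<equiv> \<lambda>x. \<Sum>j\<in>K. c j * e j x"
  assumes "\<And>j. j \<in> K \<Longrightarrow> lam j < L \<Longrightarrow> ip (e j) u = 0"
  shows "a u u \<ge> L * ip u u"
proof -
  have *: "ip (grp \<mu>) (grp \<mu>) = 0" if "\<mu> \<in> lam ` K" "\<mu> < L" for \<mu>
  proof -
    have "ip (grp \<mu>) tot = (\<Sum>j | j \<in> K \<and> lam j = \<mu>. c j * ip (e j) tot)"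
      unfolding grp_def using K e eigs_mem by (intro ip_sum tot_mem) auto
    also have "\<dots> = 0"
      using assms(2) that by (intro sum.neutral) (auto simp: u_def tot_def)
    finally show ?thesis using ip_grp_tot that by simp
  qed
  have "L * ip tot tot \<le> a tot tot"
    unfolding a_tot ip_tot sum_distrib_left 
  proof (intro sum_mono)
    fix \<mu> assume "\<mu> \<in> lam ` K"
    then show "L * ip (grp \<mu>) (grp \<mu>) \<le> \<mu> * ip (grp \<mu>) (grp \<mu>)"
      using *[of \<mu>] by (cases "\<mu> < L") (auto intro!: mult_right_mono)
  qed
  then show ?thesis by (simp add: u_def tot_def)
qed

end

text \<open>\<open>lists_eigenvalues\<close> merely matches multiplicities with dimensions. A basis
  of each eigenspace and a bijection with the indices carrying that eigenvalue attach one
  eigenfunction to each index; independence across eigenvalues is orthogonality.\<close>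

lemma eigenbasis:
  assumes "lists_eigenvalues M eigs J lam"
  obtains e where "\<And>j. j \<in> J \<Longrightarrow> e j \<in> eigs (lam j)"
    and "\<And>K c. finite K \<Longrightarrow> K \<subseteq> J \<Longrightarrow> AE x in M. (\<Sum>j\<in>K. c j * e j x) = 0 \<Longrightarrow> \<forall>j\<in>K. c j = 0"
proof -
  define J' where "J' \<mu> = {j\<in>J. lam j = \<mu>}" for \<mu>
  have J': "finite (J' \<mu>)" "has_dim_ae M (eigs \<mu>) (card (J' \<mu>))" if "\<mu> > 0" for \<mu>
    using assms that by (auto simp: lists_eigenvalues_def J'_def)
  have pos: "lam j > 0" if "j \<in> J" for j
    using assms that by (auto simp: lists_eigenvalues_def)
  have "\<forall>\<mu>. \<exists>b. \<mu> > 0 \<longrightarrow> (\<forall>i<card (J' \<mu>). b i \<in> eigs \<mu>) \<and> (\<forall>c. (AE x in M. (\<Sum>i<card (J' \<mu>). c i * b i x) = 0) \<longrightarrow> (\<forall>i<card (J' \<mu>). c i = 0))"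
    using J'(2) unfolding has_dim_ae_def by blast
  then obtain b where b': "\<forall>\<mu>. \<mu> > 0 \<longrightarrow> (\<forall>i<card (J' \<mu>). b \<mu> i \<in> eigs \<mu>) \<and> (\<forall>c. (AE x in M. (\<Sum>i<card (J' \<mu>). c i * b \<mu> i x) = 0) \<longrightarrow> (\<forall>i<card (J' \<mu>). c i = 0))"
    unfolding choice_iff by (elim exE)
  have b: "b \<mu> i \<in> eigs \<mu>" if "\<mu> > 0" "i < card (J' \<mu>)" for \<mu> i
    using b' that by blast
  have b_ind: "c i = 0" if "\<mu> > 0" "AE x in M. (\<Sum>i<card (J' \<mu>). c i * b \<mu> i x) = 0" "i < card (J' \<mu>)" for \<mu> c i
    using b' that by blast
  have "\<exists>g. bij_betw g (J' \<mu>) {..<card (J' \<mu>)}" if "\<mu> > 0" for \<mu>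
    using J'(1)[OF that] by (metis ex_bij_betw_finite_nat lessThan_atLeast0)
  then obtain g where g: "\<And>\<mu>. \<mu> > 0 \<Longrightarrow> bij_betw (g \<mu>) (J' \<mu>) {..<card (J' \<mu>)}" by metis
  define e where "e j = b (lam j) (g (lam j) j)" for j
  have e: "e j \<in> eigs (lam j)" if "j \<in> J" for j
  proof -
    have "g (lam j) j \<in> {..<card (J' (lam j))}"
      using g[OF pos[OF that]] that by (auto simp: bij_betw_def J'_def)
    then show ?thesis using b[OF pos[OF that]] by (simp add: e_def)
  qed
  moreover have "\<forall>j\<in>K. c j = 0" 
    if K: "finite K" "K \<subseteq> J" and ae: "AE x in M. (\<Sum>j\<in>K. c j * e j x) = 0" for K and c :: "nat \<Rightarrow> real"
  proof
    fix j assume j: "j \<in> K"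
    define \<mu> where "\<mu> = lam j"
    have \<mu>: "\<mu> > 0" using j K pos by (auto simp: \<mu>_def)
    \<comment> \<open>Indices of this eigenvalue outside \<open>K\<close> get coefficient zero, so
      that the independence of the whole basis applies.\<close>
    let ?c = "\<lambda>i. if i \<in> K then c i else 0"
    let ?h = "inv_into (J' \<mu>) (g \<mu>)"
    have "(\<Sum>i | i \<in> K \<and> lam i = \<mu>. c i * e i x) = (\<Sum>i<card (J' \<mu>). ?c (?h i) * b \<mu> i x)" for x
    proof -
      have "(\<Sum>i | i \<in> K \<and> lam i = \<mu>. c i * e i x) = (\<Sum>i\<in>J' \<mu>. ?c i * e i x)"
        using J'(1)[OF \<mu>] K by (intro sum.mono_neutral_cong_left) (auto simp: J'_def)
      also have "\<dots> = (\<Sum>i\<in>J' \<mu>. ?c (?h (g \<mu> i)) * b \<mu> (g \<mu> i) x)"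
        using g[OF \<mu>] by (intro sum.cong) (auto simp: e_def bij_betw_def J'_def)
      also have "\<dots> = (\<Sum>i<card (J' \<mu>). ?c (?h i) * b \<mu> i x)"
        by (rule sum.reindex_bij_betw[OF g[OF \<mu>]])
      finally show ?thesis .
    qed
    moreover have "AE x in M. (\<Sum>i | i \<in> K \<and> lam i = \<mu>. c i * e i x) = 0"
      using K e j by (intro eigenspan_independent[OF _ _ ae]) (auto simp: \<mu>_def)
    ultimately have "AE x in M. (\<Sum>i<card (J' \<mu>). ?c (?h i) * b \<mu> i x) = 0" by simp
    note b_ind[OF \<mu> this, of "g \<mu> j"]
    moreover have "j \<in> J' \<mu>" using j K by (auto simp: J'_def \<mu>_def)
    then have "g \<mu> j < card (J' \<mu>)" "?h (g \<mu> j) = j"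
      using g[OF \<mu>] by (auto simp: bij_betw_def)
    ultimately show "c j = 0" using j by simp
  qed
  ultimately show ?thesis using that by blast
qed

text \<open>No spectral theorem is needed: the \<open>N\<close> listed eigenfunctions are linearly independent, hence span the
  \<open>N\<close>-dimensional space \<open>W\<close>.\<close>

lemma eigenvalue_lower_bound:
  assumes dim: "has_dim_ae M W N" and k: "1 \<le> k" "k \<le> N"
    and ev: "lists_eigenvalues M eigs {1..N} lam"
    and e: "\<And>j. j \<in> {1..N} \<Longrightarrow> e j \<in> eigs (lam j)"
    and ind: "\<And>K c. finite K \<Longrightarrow> K \<subseteq> {1..N} \<Longrightarrow> AE x in M. (\<Sum>j\<in>K. c j * e j x) = 0 \<Longrightarrow> \<forall>j\<in>K. c j = 0"
    and a_ae: "\<And>u v. u \<in> W \<Longrightarrow> v \<in> W \<Longrightarrow> AE x in M. u x = 0 \<Longrightarrow> a u v = 0"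
    and w: "w \<in> W" "\<And>j. 1 \<le> j \<Longrightarrow> j < k \<Longrightarrow> ip (e j) w = 0"
  shows "a w w \<ge> lam k * ip w w"
proof -
  obtain b where "\<forall>u\<in>W. \<exists>c. AE x in M. u x = (\<Sum>i<N. c i * b i x)"
    using dim unfolding has_dim_ae_def by (elim exE conjE)
  then have b: "\<exists>c. AE x in M. u x = (\<Sum>i<N. c i * b i x)" if "u \<in> W" for u
    using that by blast
  \<comment> \<open>Index 0 carries \<open>w\<close>: these \<open>N + 1\<close> functions lie in a
    space of dimension \<open>N\<close>, so some nontrivial combination vanishes.\<close>
  define f where "f j = (if j = 0 then w else e j)" for j
  have f: "f j \<in> W" if "j < Suc N" for j
    using that w e[THEN eigs_mem, of j] by (auto simp: f_def)
  have "\<exists>c. AE x in M. f j x = (\<Sum>i<N. c i * b i x)" if "j < Suc N" for j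
    using b[OF f[OF that]] .
  then have "\<forall>j. \<exists>c. j < Suc N \<longrightarrow> (AE x in M. f j x = (\<Sum>i<N. c i * b i x))" by blast
  then obtain A where "\<forall>j. j < Suc N \<longrightarrow> (AE x in M. f j x = (\<Sum>i<N. A j i * b i x))"
    unfolding choice_iff by (elim exE)
  then have A: "AE x in M. f j x = (\<Sum>i<N. A j i * b i x)" if "j < Suc N" for j
    using that by blast
  obtain y where y: "\<exists>j<Suc N. y j \<noteq> 0" "\<forall>i<N. (\<Sum>j<Suc N. A j i * y j) = 0"
    using homogeneous_system_nontrivial_solution[of N "Suc N" "\<lambda>i j. A j i"] by auto
  have "AE x in M. \<forall>j\<in>{..<Suc N}. f j x = (\<Sum>i<N. A j i * b i x)"
    using A by (subst AE_ball_countable) auto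
  then have ae: "AE x in M. (\<Sum>j<Suc N. y j * f j x) = 0"
  proof eventually_elim
    case (elim x)
    then have "(\<Sum>j<Suc N. y j * f j x) = (\<Sum>j<Suc N. \<Sum>i<N. A j i * y j * b i x)"
      by (intro sum.cong) (auto simp: sum_distrib_left mult_ac)
    also have "\<dots> = (\<Sum>i<N. (\<Sum>j<Suc N. A j i * y j) * b i x)"
      by (subst sum.swap) (simp only: sum_distrib_right)
    finally show ?case using y(2) by simp
  qed
  have split: "(\<Sum>j<Suc N. y j * f j x) = y 0 * w x + (\<Sum>j\<in>{1..N}. y j * e j x)" for x
  proof -
    have "{..<Suc N} = insert 0 {1..N}" by auto
    then show ?thesis by (simp add: f_def)
  qed
  \<comment> \<open>Otherwise the \<open>N\<close> eigenfunctions alone would be dependent; hence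
    \<open>w\<close> is a combination of them.\<close>
  have y0: "y 0 \<noteq> 0"
  proof
    assume "y 0 = 0"
    then have "\<forall>j\<in>{1..N}. y j = 0"
      using ae \<open>y 0 = 0\<close> unfolding split by (intro ind) simp_all
    moreover obtain j where j: "j < Suc N" "y j \<noteq> 0" using y(1) by blast
    moreover have "j \<noteq> 0" using j \<open>y 0 = 0\<close> by (intro notI) simp
    ultimately show False by auto
  qed
  define c where "c j = - y j / y 0" for j
  define u where "u = (\<lambda>x. \<Sum>j\<in>{1..N}. c j * e j x)"
  have u: "u \<in> W" unfolding u_def using e eigs_mem by (intro sum_mem) auto
  have wu: "AE x in M. w x = u x"
    using ae
  proof eventually_elim
    case (elim x)
    have "u x = - (\<Sum>j\<in>{1..N}. y j * e j x) / y 0"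
      by (simp add: u_def c_def sum_divide_distrib sum_negf)
    then have "u x * y 0 = w x * y 0" using elim y0 unfolding split by (simp add: field_simps)
    then show ?case using y0 by simp
  qed
  have cong: "ip p w = ip p u" if "p \<in> W" for p
  proof (rule integral_cong_AE)
    show "AE x in M. p x * w x = p x * u x" using wu by eventually_elim simp
  qed (use integrable_prod[OF that w(1)] integrable_prod[OF that u] in auto)
  have "a u u \<ge> lam k * ip u u"
    unfolding u_def
  proof (rule eigenspan_lower)
    fix j assume j: "j \<in> {1..N}" "lam j < lam k"
    \<comment> \<open>By monotonicity a strictly smaller eigenvalue has a smaller index, which the
      orthogonality assumed of \<open>w\<close> covers.\<close>
    have "j < k"
    proof (rule ccontr)
      assume "\<not> j < k"
      moreover have "mono_on {1..N} lam" using ev by (simp add: lists_eigenvalues_def)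
      ultimately have "lam k \<le> lam j" using j k by (auto simp: mono_on_def)
      with j show False by simp
    qed
    then show "ip (e j) (\<lambda>x. \<Sum>j\<in>{1..N}. c j * e j x) = 0"
      using w(2)[of j] j cong[OF eigs_mem[OF e[OF j(1)]]] unfolding u_def by simp
  qed (simp_all add: e)
  moreover have "ip u u = ip w w"
    using cong[OF u] cong[OF w(1)] ip_sym[of w u] by simp
  \<comment> \<open>\<open>w\<close> and \<open>u\<close> agree only almost everywhere;
    \<open>a_ae\<close> exchanges them in the first argument, symmetry in the second.\<close>
  moreover have "a w w = a u u"
  proof -
    have ae0: "AE x in M. 1 * w x + (-1) * u x = 0" using wu by eventually_elim simp
    have "a w v = a u v" if "v \<in> W" for v
      using a_ae[OF lin_mem[OF w(1) u, of 1 "-1"] that ae0] a_lin[OF w(1) u that, of 1 "-1"] by simp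
    from this[OF w(1)] this[OF u] show ?thesis using a_sym[OF w(1) u] by simp
  qed
  ultimately show ?thesis by simp
qed

end

section \<open>Square integrable functions\<close>

lemma L2_measurable [measurable_dest]: "f \<in> L2 M \<Longrightarrow> f \<in> borel_measurable M"
  by (simp add: L2_def)

lemma L2_square_integrable: "f \<in> L2 M \<Longrightarrow> integrable M (\<lambda>x. (norm (f x))\<^sup>2)"
  by (simp add: L2_def)

lemma L2_norm_nonneg: "0 \<le> L2_norm M f"
  by (simp add: L2_norm_def)

lemma L2_norm_power2: "(L2_norm M f)\<^sup>2 = (\<integral>x. (norm (f x))\<^sup>2 \<partial>M)"
  by (simp add: L2_norm_def)

lemma L2_norm_minus_commute: "L2_norm M (\<lambda>x. f x - g x) = L2_norm M (\<lambda>x. g x - f x)"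
  by (simp add: L2_norm_def norm_minus_commute)

lemma L2_norm_cong_AE:
  fixes f g :: "'a \<Rightarrow> 'b::{real_normed_vector, second_countable_topology}"
  assumes "f \<in> borel_measurable M" "g \<in> borel_measurable M" "AE x in M. f x = g x"
  shows "L2_norm M f = L2_norm M g"
proof -
  have "(\<integral>x. (norm (f x))\<^sup>2 \<partial>M) = (\<integral>x. (norm (g x))\<^sup>2 \<partial>M)"
    using assms(3) by (intro integral_cong_AE) (use assms(1,2) in \<open>auto elim: eventually_mono\<close>)
  then show ?thesis by (simp add: L2_norm_def)
qed

lemma L2_add:
  fixes f g :: "'a \<Rightarrow> 'b::{real_normed_vector, second_countable_topology}"
  assumes "f \<in> L2 M" "g \<in> L2 M"
  shows "(\<lambda>x. f x + g x) \<in> L2 M"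
proof -
  have "integrable M (\<lambda>x. (norm (f x + g x))\<^sup>2)"
  proof (rule Bochner_Integration.integrable_bound)
    show "integrable M (\<lambda>x. 2 * (norm (f x))\<^sup>2 + 2 * (norm (g x))\<^sup>2)"
      using assms by (auto simp: L2_def)
    show "AE x in M. norm ((norm (f x + g x))\<^sup>2) \<le> norm (2 * (norm (f x))\<^sup>2 + 2 * (norm (g x))\<^sup>2)"
    proof (intro AE_I2)
      fix x
      have "(norm (f x + g x))\<^sup>2 \<le> (norm (f x) + norm (g x))\<^sup>2"
        by (intro power_mono norm_triangle_ineq norm_ge_zero)
      also have "\<dots> \<le> 2 * (norm (f x))\<^sup>2 + 2 * (norm (g x))\<^sup>2"
        using sum_squares_bound[of "norm (f x)" "norm (g x)"] by (simp add: power2_sum)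
      finally show "norm ((norm (f x + g x))\<^sup>2) \<le> norm (2 * (norm (f x))\<^sup>2 + 2 * (norm (g x))\<^sup>2)"
        by simp
    qed
  qed (use assms in measurable)
  then show ?thesis using assms by (auto simp: L2_def)
qed

lemma L2_scaleR:
  fixes f :: "'a \<Rightarrow> 'b::{real_normed_vector, second_countable_topology}"
  shows "f \<in> L2 M \<Longrightarrow> (\<lambda>x. c *\<^sub>R f x) \<in> L2 M"
  by (auto simp: L2_def power_mult_distrib)

lemma L2_cmult: "f \<in> L2 M \<Longrightarrow> (\<lambda>x. c * f x :: real) \<in> L2 M"
  using L2_scaleR[of f M c] by simp

lemma L2_diff:
  fixes f g :: "'a \<Rightarrow> 'b::{real_normed_vector, second_countable_topology}"
  shows "f \<in> L2 M \<Longrightarrow> g \<in> L2 M \<Longrightarrow> (\<lambda>x. f x - g x) \<in> L2 M"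
  using L2_add[of f M "\<lambda>x. (-1) *\<^sub>R g x"] L2_scaleR[of g M "-1"] by simp

lemma L2_bounded:
  fixes f :: "'a \<Rightarrow> 'b::{real_normed_vector, second_countable_topology}"
  assumes "finite_measure M" "f \<in> borel_measurable M" "AE x in M. norm (f x) \<le> B"
  shows "f \<in> L2 M"
proof -
  interpret finite_measure M by fact
  have "integrable M (\<lambda>x. (norm (f x))\<^sup>2)"
  proof (rule integrable_const_bound)
    show "AE x in M. norm ((norm (f x))\<^sup>2) \<le> B\<^sup>2"
      using assms(3) by eventually_elim (simp add: power_mono)
  qed (use assms(2) in measurable)
  then show ?thesis using assms(2) by (simp add: L2_def)
qed

lemma L2_inner_integrable:
  fixes f g :: "'a \<Rightarrow> 'b::euclidean_space"
  assumes "f \<in> L2 M" "g \<in> L2 M"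
  shows "integrable M (\<lambda>x. f x \<bullet> g x)"
proof (rule Bochner_Integration.integrable_bound)
  show "integrable M (\<lambda>x. (norm (f x))\<^sup>2 + (norm (g x))\<^sup>2)"
    using assms by (auto simp: L2_def)
  show "AE x in M. norm (f x \<bullet> g x) \<le> norm ((norm (f x))\<^sup>2 + (norm (g x))\<^sup>2)"
  proof (intro AE_I2)
    fix x
    have "\<bar>f x \<bullet> g x\<bar> \<le> norm (f x) * norm (g x)" by (rule Cauchy_Schwarz_ineq2)
    also have "\<dots> \<le> (norm (f x))\<^sup>2 + (norm (g x))\<^sup>2"
      using sum_squares_bound[of "norm (f x)" "norm (g x)"] mult_nonneg_nonneg[of "norm (f x)" "norm (g x)"]
      by (simp del: mult_nonneg_nonneg)
    finally show "norm (f x \<bullet> g x) \<le> norm ((norm (f x))\<^sup>2 + (norm (g x))\<^sup>2)" by simp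
  qed
qed (use assms in measurable)

lemma L2_mult_integrable:
  fixes f g :: "'a \<Rightarrow> real"
  shows "f \<in> L2 M \<Longrightarrow> g \<in> L2 M \<Longrightarrow> integrable M (\<lambda>x. f x * g x)"
  using L2_inner_integrable[of f M g] by simp

lemma L2_scaleR_integrable:
  fixes f :: "'a \<Rightarrow> real" and g :: "'a \<Rightarrow> 'b::euclidean_space"
  assumes "f \<in> L2 M" "g \<in> L2 M"
  shows "integrable M (\<lambda>x. f x *\<^sub>R g x)"
proof (rule Bochner_Integration.integrable_bound)
  have "(\<lambda>x. norm (g x)) \<in> L2 M" "(\<lambda>x. norm (f x)) \<in> L2 M" using assms by (auto simp: L2_def)
  then show "integrable M (\<lambda>x. norm (f x) * norm (g x))" by (intro L2_mult_integrable)
  show "AE x in M. norm (f x *\<^sub>R g x) \<le> norm (norm (f x) * norm (g x))" by simp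
qed (use assms in measurable)

lemma L2_integrable:
  fixes f :: "'a \<Rightarrow> 'b::euclidean_space"
  assumes "finite_measure M" "f \<in> L2 M"
  shows "integrable M f"
proof -
  have "(\<lambda>_. 1::real) \<in> L2 M" by (rule L2_bounded[where B = 1]) (simp_all add: assms(1))
  from L2_scaleR_integrable[OF this assms(2)] show ?thesis by simp
qed

lemma L2_norm_add_power2:
  fixes f g :: "'a \<Rightarrow> 'b::euclidean_space"
  assumes "f \<in> L2 M" "g \<in> L2 M"
  shows "(L2_norm M (\<lambda>x. f x + g x))\<^sup>2 = (L2_norm M f)\<^sup>2 + 2 * (\<integral>x. f x \<bullet> g x \<partial>M) + (L2_norm M g)\<^sup>2"
proof -
  have "(\<lambda>x. (norm (f x + g x))\<^sup>2) = (\<lambda>x. (norm (f x))\<^sup>2 + 2 * (f x \<bullet> g x) + (norm (g x))\<^sup>2)"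
    by (simp add: power2_norm_eq_inner algebra_simps inner_commute)
  then show ?thesis
    using assms by (simp add: L2_norm_power2 L2_square_integrable L2_inner_integrable)
qed

lemma L2_norm_scaleR:
  "L2_norm M (\<lambda>x. c *\<^sub>R f x) = \<bar>c\<bar> * L2_norm M f"
  by (simp add: L2_norm_def power_mult_distrib real_sqrt_mult)

text \<open>The discriminant of the nonnegative quadratic polynomial \<open>t \<mapsto> \<parallel>f + t g\<parallel>\<^sup>2\<close>.\<close>

lemma L2_Cauchy_Schwarz:
  fixes f g :: "'a \<Rightarrow> 'b::euclidean_space"
  assumes "f \<in> L2 M" "g \<in> L2 M"
  shows "\<bar>\<integral>x. f x \<bullet> g x \<partial>M\<bar> \<le> L2_norm M f * L2_norm M g"
proof -
  define I where "I = (\<integral>x. f x \<bullet> g x \<partial>M)"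
  have q: "0 \<le> (L2_norm M f)\<^sup>2 + 2 * t * I + t\<^sup>2 * (L2_norm M g)\<^sup>2" for t
    using L2_norm_add_power2[OF assms(1) L2_scaleR[OF assms(2)], of t]
      zero_le_power2[of "L2_norm M (\<lambda>x. f x + t *\<^sub>R g x)"]
    by (simp add: L2_norm_scaleR power_mult_distrib I_def)
  have "I\<^sup>2 \<le> (L2_norm M f)\<^sup>2 * (L2_norm M g)\<^sup>2"
  proof (cases "L2_norm M g = 0")
    case True
    have "I = 0"
    proof (rule ccontr)
      assume "I \<noteq> 0"
      \<comment> \<open>For \<open>L2_norm M g = 0\<close> the polynomial is affine in
        \<open>t\<close>, and at this \<open>t\<close> it takes the value -1.\<close>
      then show False
        using q[of "- ((L2_norm M f)\<^sup>2 + 1) / (2 * I)"] True by (simp add: field_simps)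
    qed
    with True show ?thesis by simp
  next
    case False
    then have *: "(L2_norm M g)\<^sup>2 > 0" by simp
    define G where "G = (L2_norm M g)\<^sup>2"
    \<comment> \<open>\<open>- I / G\<close> is the minimiser of the polynomial.\<close>
    have "(- I / G)\<^sup>2 * G = I\<^sup>2 / G" "2 * (- I / G) * I = - 2 * (I\<^sup>2 / G)"
      using * by (simp_all add: G_def[symmetric] power2_eq_square)
    then have "0 \<le> (L2_norm M f)\<^sup>2 - I\<^sup>2 / (L2_norm M g)\<^sup>2"
      using q[of "- I / G"] unfolding G_def[symmetric] by linarith
    then have "I\<^sup>2 / (L2_norm M g)\<^sup>2 \<le> (L2_norm M f)\<^sup>2" by simp
    then show ?thesis by (subst (asm) pos_divide_le_eq[OF *])
  qed
  then have "I\<^sup>2 \<le> (L2_norm M f * L2_norm M g)\<^sup>2" by (simp add: power_mult_distrib)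
  then show ?thesis
    using abs_le_square_iff[of I "L2_norm M f * L2_norm M g"] by (simp add: I_def L2_norm_nonneg)
qed

lemma L2_norm_triangle:
  fixes f g :: "'a \<Rightarrow> 'b::euclidean_space"
  assumes "f \<in> L2 M" "g \<in> L2 M"
  shows "L2_norm M (\<lambda>x. f x + g x) \<le> L2_norm M f + L2_norm M g"
proof -
  have "(L2_norm M (\<lambda>x. f x + g x))\<^sup>2 \<le> (L2_norm M f + L2_norm M g)\<^sup>2"
    using L2_Cauchy_Schwarz[OF assms] unfolding L2_norm_add_power2[OF assms]
    by (simp add: power2_sum)
  then show ?thesis
    by (rule power2_le_imp_le) (simp add: L2_norm_nonneg)
qed

lemma L2_norm_triangle_diff:
  fixes f g h :: "'a \<Rightarrow> 'b::euclidean_space"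
  assumes "f \<in> L2 M" "g \<in> L2 M" "h \<in> L2 M"
  shows "L2_norm M (\<lambda>x. f x - h x) \<le> L2_norm M (\<lambda>x. f x - g x) + L2_norm M (\<lambda>x. g x - h x)"
  using L2_norm_triangle[OF L2_diff[OF assms(1,2)] L2_diff[OF assms(2,3)]] by simp

lemma L2_inner_tendsto:
  fixes f :: "nat \<Rightarrow> 'a \<Rightarrow> 'b::euclidean_space"
  assumes "\<And>m. f m \<in> L2 M" "h \<in> L2 M" "g \<in> L2 M"
    and "(\<lambda>m. L2_norm M (\<lambda>x. f m x - h x)) \<longlonglongrightarrow> 0"
  shows "(\<lambda>m. \<integral>x. f m x \<bullet> g x \<partial>M) \<longlonglongrightarrow> (\<integral>x. h x \<bullet> g x \<partial>M)"
proof (rule LIM_zero_cancel, rule Lim_null_comparison)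
  show "\<forall>\<^sub>F m in sequentially. norm ((\<integral>x. f m x \<bullet> g x \<partial>M) - (\<integral>x. h x \<bullet> g x \<partial>M))
      \<le> L2_norm M (\<lambda>x. f m x - h x) * L2_norm M g"
  proof (intro always_eventually allI)
    fix m
    have "(\<integral>x. f m x \<bullet> g x \<partial>M) - (\<integral>x. h x \<bullet> g x \<partial>M) = (\<integral>x. (f m x - h x) \<bullet> g x \<partial>M)"
      using assms by (simp add: inner_diff_left L2_inner_integrable)
    then show "norm ((\<integral>x. f m x \<bullet> g x \<partial>M) - (\<integral>x. h x \<bullet> g x \<partial>M))
      \<le> L2_norm M (\<lambda>x. f m x - h x) * L2_norm M g"
      using L2_Cauchy_Schwarz[OF L2_diff[OF assms(1,2)] assms(3), of m] by simp
  qed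
  show "(\<lambda>m. L2_norm M (\<lambda>x. f m x - h x) * L2_norm M g) \<longlonglongrightarrow> 0"
    using tendsto_mult_left_zero[OF assms(4)] .
qed

text \<open>The Riesz-Fischer argument, used later to produce traces on facets. A subsequence with
  differences below \<open>(1/2)^k\<close> converges almost everywhere, since on a finite measure
  the \<open>L2\<close> norm controls the \<open>L1\<close> norm; Fatou's lemma then carries the
  Cauchy estimate over to the limit.\<close>

lemma L2_complete:
  fixes f :: "nat \<Rightarrow> 'a \<Rightarrow> real"
  assumes "finite_measure M" and f: "\<And>m. f m \<in> L2 M"
    and cauchy: "\<And>e. e > 0 \<Longrightarrow> \<exists>N. \<forall>m\<ge>N. \<forall>n\<ge>N. L2_norm M (\<lambda>x. f m x - f n x) < e"
  shows "\<exists>w\<in>L2 M. (\<lambda>m. L2_norm M (\<lambda>x. f m x - w x)) \<longlonglongrightarrow> 0"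
proof -
  interpret finite_measure M by fact
  note [measurable] = L2_measurable[OF f]
  have "\<forall>k. \<exists>N. \<forall>m\<ge>N. \<forall>n\<ge>N. L2_norm M (\<lambda>x. f m x - f n x) < (1/2)^k"
    using cauchy by simp
  then obtain N where N: "\<And>k m n. m \<ge> N k \<Longrightarrow> n \<ge> N k \<Longrightarrow> L2_norm M (\<lambda>x. f m x - f n x) < (1/2)^k"
    by (auto dest!: choice)
  \<comment> \<open>The summand \<open>k\<close> gives strict growth, the sum of the thresholds
    keeps \<open>r k\<close> beyond \<open>N k\<close>.\<close>
  define r where "r k = k + (\<Sum>i\<le>k. N i)" for k
  have rN: "r k \<ge> N k" for k
    by (simp add: r_def trans_le_add2 member_le_sum)
  have "strict_mono r"
    by (rule strict_mono_Suc_iff[THEN iffD2]) (simp add: r_def)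
  define g where "g k x = f (r (Suc k)) x - f (r k) x" for k x
  have [measurable]: "g k \<in> borel_measurable M" for k by (simp add: g_def[abs_def])
  define C where "C = L2_norm M (\<lambda>_. 1::real)"
  have one: "(\<lambda>_. 1::real) \<in> L2 M" by (rule L2_bounded[where B = 1]) (auto intro: finite_measure_axioms)
  have gL: "g k \<in> L2 M" for k unfolding g_def using f by (intro L2_diff)
  have gabs: "(\<integral>\<^sup>+x. ennreal \<bar>g k x\<bar> \<partial>M) \<le> ennreal (C * (1/2)^k)" for k
  proof -
    have L: "(\<lambda>x. \<bar>g k x\<bar>) \<in> L2 M" using gL[of k] by (auto simp: L2_def)
    have int: "integrable M (\<lambda>x. \<bar>g k x\<bar>)" using L2_integrable[OF assms(1) L] .
    have "(\<integral>x. \<bar>g k x\<bar> \<partial>M) \<le> L2_norm M (\<lambda>x. \<bar>g k x\<bar>) * C"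
      using L2_Cauchy_Schwarz[OF L one] by (simp add: C_def)
    also have "L2_norm M (\<lambda>x. \<bar>g k x\<bar>) = L2_norm M (\<lambda>x. f (r (Suc k)) x - f (r k) x)"
      by (simp add: L2_norm_def g_def)
    also have "\<dots> * C \<le> (1/2)^k * C"
    proof (rule mult_right_mono)
      have "r k < r (Suc k)" using \<open>strict_mono r\<close> by (simp add: strict_mono_Suc_iff)
      then show "L2_norm M (\<lambda>x. f (r (Suc k)) x - f (r k) x) \<le> (1/2)^k"
        using N[of k "r (Suc k)" "r k"] rN[of k] by simp
    qed (simp add: C_def L2_norm_nonneg)
    finally show ?thesis
      using int by (subst nn_integral_eq_integral) (auto simp: mult.commute intro!: ennreal_leI)
  qed
  have "(\<integral>\<^sup>+x. (\<Sum>k. ennreal \<bar>g k x\<bar>) \<partial>M) = (\<Sum>k. \<integral>\<^sup>+x. ennreal \<bar>g k x\<bar> \<partial>M)"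
    by (rule nn_integral_suminf) measurable
  also have "\<dots> \<le> (\<Sum>k. ennreal (C * (1/2)^k))"
    by (intro suminf_le gabs) auto
  also have "\<dots> = ennreal (\<Sum>k. C * (1/2)^k)"
    by (rule suminf_ennreal2) (auto simp: C_def L2_norm_nonneg intro!: summable_mult summable_geometric)
  also have "\<dots> < \<infinity>" by simp
  finally have "AE x in M. (\<Sum>k. ennreal \<bar>g k x\<bar>) \<noteq> \<infinity>"
    by (intro nn_integral_PInf_AE) auto
  then have conv: "AE x in M. convergent (\<lambda>k. f (r k) x)"
  proof eventually_elim
    case (elim x)
    then have "summable (\<lambda>k. \<bar>g k x\<bar>)"
      by (intro summable_suminf_not_top) auto
    then have "summable (\<lambda>k. g k x)" by (rule summable_rabs_cancel)
    then have "convergent (\<lambda>n. \<Sum>k<n. g k x)" by (simp add: summable_iff_convergent)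
    moreover have "(\<Sum>k<n. g k x) = f (r n) x - f (r 0) x" for n
      unfolding g_def by (rule sum_lessThan_telescope)
    ultimately have "convergent (\<lambda>n. (f (r n) x - f (r 0) x) + f (r 0) x)"
      by (intro convergent_add convergent_const) simp
    then show ?case by simp
  qed
  define w where "w x = lim (\<lambda>k. f (r k) x)" for x
  have [measurable]: "w \<in> borel_measurable M" unfolding w_def by measurable
  \<comment> \<open>Stated for an arbitrary threshold \<open>N0\<close> and bound \<open>e\<close>,
    so that it yields both the membership of \<open>w\<close> in \<open>L2\<close> and the
    convergence.\<close>
  have fatou: "integrable M (\<lambda>x. (f m x - w x)\<^sup>2) \<and> L2_norm M (\<lambda>x. f m x - w x) \<le> e"
    if m: "m \<ge> N0" and N0: "\<And>m n. m \<ge> N0 \<Longrightarrow> n \<ge> N0 \<Longrightarrow> L2_norm M (\<lambda>x. f m x - f n x) < e" for m N0 e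
  proof -
    have "(\<integral>\<^sup>+x. ennreal ((f m x - w x)\<^sup>2) \<partial>M) = (\<integral>\<^sup>+x. liminf (\<lambda>k. ennreal ((f m x - f (r k) x)\<^sup>2)) \<partial>M)"
    proof (rule nn_integral_cong_AE)
      show "AE x in M. ennreal ((f m x - w x)\<^sup>2) = liminf (\<lambda>k. ennreal ((f m x - f (r k) x)\<^sup>2))"
        using conv
      proof eventually_elim
        case (elim x)
        then have "(\<lambda>k. f (r k) x) \<longlonglongrightarrow> w x" by (simp add: w_def convergent_LIMSEQ_iff)
        then have "(\<lambda>k. ennreal ((f m x - f (r k) x)\<^sup>2)) \<longlonglongrightarrow> ennreal ((f m x - w x)\<^sup>2)"
          by (intro tendsto_ennrealI tendsto_intros)
        then show ?case by (intro lim_imp_Liminf[symmetric]) simp_all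
      qed
    qed
    also have "\<dots> \<le> liminf (\<lambda>k. \<integral>\<^sup>+x. ennreal ((f m x - f (r k) x)\<^sup>2) \<partial>M)"
      by (rule nn_integral_liminf) measurable
    also have "\<dots> \<le> ennreal (e\<^sup>2)"
    proof (rule Liminf_le)
      show "\<forall>\<^sub>F k in sequentially. (\<integral>\<^sup>+x. ennreal ((f m x - f (r k) x)\<^sup>2) \<partial>M) \<le> ennreal (e\<^sup>2)"
        using eventually_ge_at_top[of N0]
      proof eventually_elim
        case (elim k)
        then have "r k \<ge> N0" by (simp add: r_def)
        have "(\<integral>\<^sup>+x. ennreal ((f m x - f (r k) x)\<^sup>2) \<partial>M) = ennreal ((L2_norm M (\<lambda>x. f m x - f (r k) x))\<^sup>2)"
          using L2_square_integrable[OF L2_diff[OF f f]]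
          by (subst nn_integral_eq_integral) (auto simp: L2_norm_power2)
        also have "\<dots> \<le> ennreal (e\<^sup>2)"
          using N0[OF m \<open>r k \<ge> N0\<close>]
          by (intro ennreal_leI power_mono) (auto simp: L2_norm_nonneg)
        finally show ?case .
      qed
    qed simp
    finally have le: "(\<integral>\<^sup>+x. ennreal ((f m x - w x)\<^sup>2) \<partial>M) \<le> ennreal (e\<^sup>2)" .
    then have int: "integrable M (\<lambda>x. (f m x - w x)\<^sup>2)"
      by (intro integrableI_bounded) (auto simp: less_top[symmetric] top_unique)
    have "e > 0" using N0[OF m m] by (simp add: L2_norm_def)
    have "(L2_norm M (\<lambda>x. f m x - w x))\<^sup>2 \<le> e\<^sup>2"
      using le int by (subst (asm) nn_integral_eq_integral) (auto simp: L2_norm_power2)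
    then show ?thesis using int \<open>e > 0\<close> power2_le_imp_le[of _ e] by auto
  qed
  show ?thesis
  proof
    obtain N0 where N0: "\<And>m n. m \<ge> N0 \<Longrightarrow> n \<ge> N0 \<Longrightarrow> L2_norm M (\<lambda>x. f m x - f n x) < 1"
      using cauchy[of 1] by auto
    have "(\<lambda>x. f N0 x - w x) \<in> L2 M" using fatou[OF order.refl N0] by (simp add: L2_def)
    from L2_diff[OF f this, of N0] show "w \<in> L2 M" by simp
    show "(\<lambda>m. L2_norm M (\<lambda>x. f m x - w x)) \<longlonglongrightarrow> 0"
    proof (rule LIMSEQ_I)
      fix e :: real assume "e > 0"
      then obtain N0 where N0: "\<And>m n. m \<ge> N0 \<Longrightarrow> n \<ge> N0 \<Longrightarrow> L2_norm M (\<lambda>x. f m x - f n x) < e / 2"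
        using cauchy[of "e/2"] by auto
      show "\<exists>no. \<forall>n\<ge>no. norm (L2_norm M (\<lambda>x. f n x - w x) - 0) < e"
      proof (intro exI[of _ N0] allI impI)
        fix n assume "n \<ge> N0"
        from fatou[OF this N0] have "L2_norm M (\<lambda>x. f n x - w x) \<le> e / 2" by simp
        then show "norm (L2_norm M (\<lambda>x. f n x - w x) - 0) < e"
          using \<open>e > 0\<close> L2_norm_nonneg[of M "\<lambda>x. f n x - w x"] by simp
      qed
    qed
  qed
qed

section \<open>Barycentric coordinates\<close>

text \<open>Carrying the vertex set instead of the body makes every facet
  \<open>convex hull (C - {c})\<close>, indexed by its opposite vertex.\<close>

locale full_simplex =
  fixes C :: "(real^'n) set"
  assumes indep: "\<not> affine_dependent C" and card_C: "card C = Suc CARD('n)"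
begin

lemma finite_C: "finite C"
  using indep aff_independent_finite by blast

text \<open>The facet opposite to \<open>c\<close> spans a hyperplane by counting dimensions, and
  \<open>c\<close> lies off it, so the equation of the hyperplane can be scaled to take the value 1
  at \<open>c\<close>. Gradient and constant form one pair so that a single choice yields
  both.\<close>

lemma affine_coordinates_exist:
  "\<exists>ab :: (real^'n \<Rightarrow> real^'n) \<times> (real^'n \<Rightarrow> real).
     \<forall>c\<in>C. \<forall>c'\<in>C. fst ab c \<bullet> c' + snd ab c = (if c' = c then 1 else 0)"
proof -
  have "\<exists>a b. \<forall>c'\<in>C. a \<bullet> c' + b = (if c' = c then 1 else 0)" if c: "c \<in> C" for c
  proof -
    have "\<not> affine_dependent (C - {c})"
      using indep by (rule affine_independent_Diff)
    then have "aff_dim (C - {c}) = int (card (C - {c})) - 1"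
      by (simp add: aff_dim_affine_independent)
    also have "\<dots> = DIM(real^'n) - 1"
      using c card_C finite_C by simp
    finally obtain a b where ab: "a \<noteq> 0" "affine hull (C - {c}) = {x. a \<bullet> x = b}"
      using aff_dim_eq_hyperplane[of "C - {c}"] by auto
    have "c \<notin> affine hull (C - {c})" using indep c by (auto simp: affine_dependent_def)
    then have nz: "a \<bullet> c - b \<noteq> 0" using ab by auto
    have "a \<bullet> c' = b" if "c' \<in> C" "c' \<noteq> c" for c'
      using hull_inc[of c' "C - {c}" affine] that ab by auto
    with nz show ?thesis
      by (intro exI[of _ "a /\<^sub>R (a \<bullet> c - b)"] exI[of _ "- b / (a \<bullet> c - b)"])
        (auto simp: divide_simps)
  qed
  then have "\<forall>c\<in>C. \<exists>a b. \<forall>c'\<in>C. a \<bullet> c' + b = (if c' = c then 1 else 0)" by blast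
  then obtain a b where "\<forall>c\<in>C. \<forall>c'\<in>C. a c \<bullet> c' + b c = (if c' = c then 1 else 0)"
    unfolding bchoice_iff by (elim exE)
  then show ?thesis by (intro exI[of _ "(a, b)"]) simp
qed

definition "coords = (SOME ab :: (real^'n \<Rightarrow> real^'n) \<times> (real^'n \<Rightarrow> real).
     \<forall>c\<in>C. \<forall>c'\<in>C. fst ab c \<bullet> c' + snd ab c = (if c' = c then 1 else 0))"

text \<open>The gradient of the barycentric coordinate \<open>ell c\<close>. Its norm is the
  reciprocal of the distance from \<open>c\<close> to the opposite facet; this is how heights enter
  below.\<close>

definition grd :: "real^'n \<Rightarrow> real^'n" where "grd c = fst coords c"
definition ell :: "real^'n \<Rightarrow> real^'n \<Rightarrow> real" where "ell c x = grd c \<bullet> x + snd coords c"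

lemma ell_vertex: "c \<in> C \<Longrightarrow> c' \<in> C \<Longrightarrow> ell c c' = (if c' = c then 1 else 0)"
  using someI_ex[OF affine_coordinates_exist] by (simp add: coords_def ell_def grd_def)

lemma ell_add: "ell c (x + y) = ell c x + grd c \<bullet> y"
  by (simp add: ell_def inner_add_right)

lemma affine_combination:
  assumes "(\<Sum>v\<in>S. u v) = 1"
  shows "a \<bullet> (\<Sum>v\<in>S. u v *\<^sub>R v) + b = (\<Sum>v\<in>S. u v * (a \<bullet> v + b))"
proof -
  have "(\<Sum>v\<in>S. u v * (a \<bullet> v + b)) = a \<bullet> (\<Sum>v\<in>S. u v *\<^sub>R v) + b * (\<Sum>v\<in>S. u v)"
    by (simp add: inner_sum_right algebra_simps sum.distrib sum_distrib_left)
  with assms show ?thesis by simp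
qed

lemma ell_combination:
  assumes "(\<Sum>v\<in>C. u v) = 1" "c \<in> C"
  shows "ell c (\<Sum>v\<in>C. u v *\<^sub>R v) = u c"
proof -
  have "ell c (\<Sum>v\<in>C. u v *\<^sub>R v) = (\<Sum>v\<in>C. u v * ell c v)"
    unfolding ell_def by (rule affine_combination[OF assms(1)])
  also have "\<dots> = (\<Sum>v\<in>C. if v = c then u v else 0)"
    using assms by (intro sum.cong) (auto simp: ell_vertex)
  finally show ?thesis using assms finite_C by simp
qed

lemma affine_hull_C: "affine hull C = UNIV"
proof -
  have "aff_dim C = DIM(real^'n)"
    using aff_dim_affine_independent[OF indep] card_C by simp
  then show ?thesis by (simp only: aff_dim_eq_full)
qed

lemma combination_exists: "\<exists>u. (\<Sum>v\<in>C. u v) = 1 \<and> (\<Sum>v\<in>C. u v *\<^sub>R v) = x"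
proof -
  have "x \<in> affine hull C" by (simp add: affine_hull_C)
  then show ?thesis by (auto simp: affine_hull_finite[OF finite_C])
qed

lemma sum_ell: "(\<Sum>c\<in>C. ell c x) = 1"
proof -
  obtain u where u: "(\<Sum>v\<in>C. u v) = 1" "(\<Sum>v\<in>C. u v *\<^sub>R v) = x" using combination_exists by blast
  then show ?thesis using ell_combination[OF u(1)] by simp
qed

lemma sum_ell_scaleR: "(\<Sum>c\<in>C. ell c x *\<^sub>R c) = x"
proof -
  obtain u where u: "(\<Sum>v\<in>C. u v) = 1" "(\<Sum>v\<in>C. u v *\<^sub>R v) = x" using combination_exists by blast
  then show ?thesis using ell_combination[OF u(1)] by simp
qed

lemma sum_grd: "(\<Sum>c\<in>C. grd c) = 0"
proof (rule vector_eq_rdot[THEN iffD1, rule_format])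
  fix y
  have "(\<Sum>c\<in>C. ell c (0 + y)) = (\<Sum>c\<in>C. ell c 0) + (\<Sum>c\<in>C. grd c \<bullet> y)"
    unfolding ell_add by (rule sum.distrib)
  then show "(\<Sum>c\<in>C. grd c) \<bullet> y = 0 \<bullet> y" by (simp add: sum_ell inner_sum_left)
qed

text \<open>The derivative of \<open>sum_ell_scaleR\<close> in direction \<open>h\<close>.\<close>

lemma sum_grd_inner_vertex: "(\<Sum>c\<in>C. (grd c \<bullet> h) *\<^sub>R c) = h"
proof -
  have "(\<Sum>c\<in>C. ell c (0 + h) *\<^sub>R c) = (\<Sum>c\<in>C. ell c 0 *\<^sub>R c) + (\<Sum>c\<in>C. (grd c \<bullet> h) *\<^sub>R c)"
    unfolding ell_add by (simp add: scaleR_left_distrib sum.distrib)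
  then show ?thesis by (simp only: sum_ell_scaleR) simp
qed

text \<open>The rank-one maps of \<open>sum_grd_inner_vertex\<close> add up to the identity, and so
  do their transposes.\<close>

lemma sum_vertex_inner_grd: "(\<Sum>c\<in>C. (c \<bullet> g) *\<^sub>R grd c) = g"
proof (rule vector_eq_rdot[THEN iffD1, rule_format])
  fix h
  have "(\<Sum>c\<in>C. (c \<bullet> g) *\<^sub>R grd c) \<bullet> h = (\<Sum>c\<in>C. (grd c \<bullet> h) *\<^sub>R c) \<bullet> g"
    by (simp add: inner_sum_left mult.commute)
  also have "\<dots> = g \<bullet> h"
    unfolding sum_grd_inner_vertex by (rule inner_commute)
  finally show "(\<Sum>c\<in>C. (c \<bullet> g) *\<^sub>R grd c) \<bullet> h = g \<bullet> h" .
qed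

lemma grd_diff: "i \<in> C \<Longrightarrow> j \<in> C \<Longrightarrow> c \<in> C \<Longrightarrow>
    grd c \<bullet> (i - j) = (if i = c then 1 else 0) - (if j = c then 1 else 0)"
  using ell_vertex[of c i] ell_vertex[of c j] by (simp add: ell_def inner_diff_right)

text \<open>Barycentric coordinates are unique, so those of a point of the smaller hull are its
  weights padded by zeros.\<close>

lemma hull_subset_iff:
  assumes "S \<subseteq> C"
  shows "x \<in> convex hull S \<longleftrightarrow> (\<forall>c\<in>C. 0 \<le> ell c x) \<and> (\<forall>c\<in>C - S. ell c x = 0)"
proof
  have fS: "finite S" using assms finite_C finite_subset by blast
  {
    assume "x \<in> convex hull S"
    then obtain u where u: "\<And>v. v \<in> S \<Longrightarrow> 0 \<le> u v" "sum u S = 1" "(\<Sum>v\<in>S. u v *\<^sub>R v) = x"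
      by (auto simp: convex_hull_finite[OF fS])
    define w where "w v = (if v \<in> S then u v else 0)" for v
    have "sum w C = 1" "(\<Sum>v\<in>C. w v *\<^sub>R v) = x"
      using u(2,3) assms finite_C
      by (auto simp: w_def sum.inter_restrict[symmetric] Int_absorb1 if_distrib[of "\<lambda>z. z *\<^sub>R _"] cong: if_cong)
    then have "ell c x = w c" if "c \<in> C" for c
      using ell_combination that by blast
    then show "(\<forall>c\<in>C. 0 \<le> ell c x) \<and> (\<forall>c\<in>C - S. ell c x = 0)"
      using u(1) by (auto simp: w_def)
  }
  assume r: "(\<forall>c\<in>C. 0 \<le> ell c x) \<and> (\<forall>c\<in>C - S. ell c x = 0)"
  have "(\<Sum>c\<in>S. ell c x) = 1" "(\<Sum>c\<in>S. ell c x *\<^sub>R c) = x"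
    using sum_ell[of x] sum_ell_scaleR[of x] r assms finite_C
      sum.mono_neutral_left[of C S "\<lambda>c. ell c x"] sum.mono_neutral_left[of C S "\<lambda>c. ell c x *\<^sub>R c"] by auto
  then show "x \<in> convex hull S"
    using r assms unfolding convex_hull_finite[OF fS] by (intro CollectI exI[of _ "\<lambda>c. ell c x"]) auto
qed

lemma hull_iff: "x \<in> convex hull C \<longleftrightarrow> (\<forall>c\<in>C. 0 \<le> ell c x)"
  using hull_subset_iff[of C x] by simp

lemma facet_iff: "c \<in> C \<Longrightarrow> x \<in> convex hull (C - {c}) \<longleftrightarrow> (\<forall>c'\<in>C. 0 \<le> ell c' x) \<and> ell c x = 0"
  using hull_subset_iff[of "C - {c}" x] by auto

lemma affine_hull_facet:
  assumes "c \<in> C"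
  shows "affine hull (C - {c}) = {x. ell c x = 0}"
proof (intro set_eqI iffI)
  fix x assume "x \<in> affine hull (C - {c})"
  then obtain u where u: "sum u (C - {c}) = 1" "(\<Sum>v\<in>C - {c}. u v *\<^sub>R v) = x"
    using finite_C by (auto simp: affine_hull_finite)
  have "ell c x = (\<Sum>v\<in>C - {c}. u v * ell c v)"
    unfolding ell_def u(2)[symmetric] by (rule affine_combination[OF u(1)])
  also have "\<dots> = 0" using assms by (intro sum.neutral) (auto simp: ell_vertex)
  finally show "x \<in> {x. ell c x = 0}" by simp
next
  fix x assume "x \<in> {x. ell c x = 0}"
  then have "(\<Sum>v\<in>C - {c}. ell v x) = 1" "(\<Sum>v\<in>C - {c}. ell v x *\<^sub>R v) = x"
    using sum_ell[of x] sum_ell_scaleR[of x] assms finite_C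
    by (simp_all add: sum.remove[of C c])
  then show "x \<in> affine hull (C - {c})"
    using finite_C by (auto simp: affine_hull_finite)
qed

lemma card_facet: "c \<in> C \<Longrightarrow> card (C - {c}) = CARD('n)"
  using card_C finite_C by simp

lemma other_vertex:
  assumes "c \<in> C"
  shows "\<exists>c'\<in>C. c' \<noteq> c"
proof -
  have "C - {c} \<noteq> {}" using card_facet[OF assms] by (metis card.empty zero_less_card_finite less_irrefl)
  then show ?thesis by blast
qed

lemma grd_nonzero:
  assumes "c \<in> C"
  shows "grd c \<noteq> 0"
proof -
  obtain d where "d \<in> C" "d \<noteq> c" using other_vertex[OF assms] by blast
  then have "grd c \<bullet> (c - d) = 1" using grd_diff[of c d c] assms by simp
  then show ?thesis by auto
qed

section \<open>Facets and their barycentres\<close>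

lemma facet_of_iff: "F facet_of convex hull C \<longleftrightarrow> (\<exists>c\<in>C. F = convex hull (C - {c}))"
proof -
  have "2 \<le> card C" using card_C by (simp add: Suc_le_eq)
  then show ?thesis unfolding facet_of_convex_hull_affine_independent_alt[OF indep] by auto
qed

lemma facet_inj:
  assumes "c \<in> C" "d \<in> C" "convex hull (C - {c}) = convex hull (C - {d})"
  shows "c = d"
proof (rule ccontr)
  assume "c \<noteq> d"
  then have "d \<in> convex hull (C - {c})" using assms by (intro hull_inc) auto
  then show False using assms facet_iff[of d d] by (simp add: ell_vertex)
qed

lemma mid_facet:
  assumes "c \<in> C"
  shows "mid (convex hull (C - {c})) = (\<Sum>x\<in>C - {c}. x) /\<^sub>R CARD('n)"
proof -
  have "{x. x extreme_point_of convex hull (C - {c})} = C - {c}"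
    using extreme_point_of_convex_hull_affine_independent[of "C - {c}"] indep affine_independent_Diff by blast
  then show ?thesis using card_facet[OF assms] by (simp add: mid_def)
qed

lemma affine_mid:
  assumes "c \<in> C"
  shows "a \<bullet> mid (convex hull (C - {c})) + b = (\<Sum>v\<in>C - {c}. a \<bullet> v + b) / CARD('n)"
proof -
  note card = card_facet[OF assms]
  have "a \<bullet> (\<Sum>v\<in>C - {c}. (1 / CARD('n)) *\<^sub>R v) + b = (\<Sum>v\<in>C - {c}. 1 / CARD('n) * (a \<bullet> v + b))"
    by (rule affine_combination) (simp add: card)
  then show ?thesis
    by (simp add: mid_facet[OF assms] scaleR_sum_right sum_divide_distrib inverse_eq_divide)
qed

lemma ell_mid:
  assumes "c \<in> C" "d \<in> C"
  shows "ell d (mid (convex hull (C - {c}))) = (if d = c then 0 else 1 / CARD('n))"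
proof -
  have "ell d (mid (convex hull (C - {c}))) = (\<Sum>v\<in>C - {c}. ell d v) / CARD('n)"
    unfolding ell_def by (rule affine_mid[OF assms(1)])
  also have "(\<Sum>v\<in>C - {c}. ell d v) = (\<Sum>v\<in>C - {c}. if v = d then 1 else 0)"
    using assms by (intro sum.cong) (auto simp: ell_vertex)
  finally have "ell d (mid (convex hull (C - {c}))) = (\<Sum>v\<in>C - {c}. if v = d then 1 else 0) / CARD('n)" .
  then show ?thesis using assms finite_C by simp
qed

lemma mid_in_facet: "c \<in> C \<Longrightarrow> mid (convex hull (C - {c})) \<in> convex hull (C - {c})"
  by (auto simp: facet_iff ell_mid)

text \<open>The functions \<open>1 - CARD('n) * ell c\<close> are the local Crouzeix-Raviart basis:
  by \<open>ell_mid\<close> they are 1 at the barycentre of the facet opposite to \<open>c\<close>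
  and 0 at the other barycentres.\<close>

lemma affine_eq_mid_sum:
  "a \<bullet> x + b = (\<Sum>c\<in>C. (a \<bullet> mid (convex hull (C - {c})) + b) * (1 - CARD('n) * ell c x))"
proof -
  define f where "f x = a \<bullet> x + b" for x
  define n where "n = real CARD('n)"
  have n: "n > 0" by (simp add: n_def)
  have fm: "f (mid (convex hull (C - {c}))) = ((\<Sum>v\<in>C. f v) - f c) / n" if "c \<in> C" for c
    unfolding f_def affine_mid[OF that] using that finite_C
    by (simp add: sum.remove[of C c] n_def)
  have fx: "f x = (\<Sum>c\<in>C. ell c x * f c)"
    using affine_combination[of "\<lambda>c. ell c x" C a b] by (simp add: f_def sum_ell sum_ell_scaleR)
  define s where "s = (\<Sum>v\<in>C. f v)"
  have "(\<Sum>c\<in>C. f (mid (convex hull (C - {c}))) * (1 - n * ell c x)) = (\<Sum>c\<in>C. (s - f c) / n * (1 - n * ell c x))"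
    by (intro sum.cong) (simp_all add: fm s_def)
  also have "\<dots> = (\<Sum>c\<in>C. s / n - f c / n - s * ell c x + ell c x * f c)"
    using n by (intro sum.cong) (auto simp: field_simps)
  also have "\<dots> = real (card C) * (s / n) - s / n - s * (\<Sum>c\<in>C. ell c x) + f x"
    by (simp add: sum.distrib sum_subtractf fx s_def sum_divide_distrib sum_distrib_left)
  also have "\<dots> = f x"
    using n by (simp add: card_C sum_ell n_def[symmetric] field_simps)
  finally show ?thesis by (simp add: f_def n_def)
qed

lemma interior_nonempty: "interior (convex hull C) \<noteq> {}"
proof -
  have "aff_dim (convex hull C) = DIM(real^'n)"
    using aff_dim_affine_independent[OF indep] card_C by (simp add: aff_dim_convex_hull)
  then show ?thesis by (simp add: interior_convex_hull_eq_empty card_C indep)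
qed

lemma compact_hull: "compact (convex hull C)"
  using finite_C by (simp add: compact_convex_hull finite_imp_compact)

lemma closure_interior: "closure (interior (convex hull C)) = convex hull C"
  using convex_closure_interior[OF convex_convex_hull interior_nonempty]
    compact_imp_closed[OF compact_hull] by simp

lemma bounded_hull: "bounded (convex hull C)"
  using compact_hull compact_imp_bounded by blast

lemma compact_facet: "compact (convex hull (C - {c}))"
  using finite_C by (simp add: compact_convex_hull finite_imp_compact)

end

section \<open>Integration along fibres over a hyperplane\<close>

locale hyperplane =
  fixes a :: "'a::euclidean_space" and b :: real
  assumes a: "a \<noteq> 0"
begin

text \<open>\<open>hf\<close> is \<open>norm a\<close> times the signed distance to its zero set,
  \<open>prj\<close> the orthogonal projection onto that hyperplane, and \<open>slab\<close> the
  layer of thickness one that occurs in \<open>face_measure\<close>.\<close>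

definition "hf y = a \<bullet> y + b"
definition "prj y = y - (hf y / (norm a)\<^sup>2) *\<^sub>R a"
definition "slab = {y. \<bar>hf y\<bar> \<le> norm a / 2}"

lemma hf_add: "hf (x + y) = hf x + a \<bullet> y"
  by (simp add: hf_def inner_add_right)

lemma hf_prj: "hf (prj y) = 0"
  using a by (simp add: hf_def prj_def inner_diff_right power2_norm_eq_inner)

lemma prj_add: "a \<bullet> w = 0 \<Longrightarrow> prj (y + w) = prj y + w"
  by (simp add: prj_def hf_add)

lemma continuous_hf [continuous_intros]: "continuous_on A hf"
  unfolding hf_def[abs_def] by (intro continuous_intros)

lemma continuous_prj [continuous_intros]: "continuous_on A prj"
  unfolding prj_def[abs_def] by (intro continuous_intros continuous_hf) (use a in auto)

lemma measurable_hf [measurable]: "hf \<in> borel_measurable borel"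
  by (intro borel_measurable_continuous_onI continuous_hf)

lemma measurable_prj [measurable]: "prj \<in> borel_measurable borel"
  by (intro borel_measurable_continuous_onI continuous_prj)

lemma closed_slab: "closed slab"
  unfolding slab_def by (intro closed_Collect_le continuous_intros)

lemma slab_borel [measurable]: "slab \<in> sets borel"
  using closed_slab by simp

lemma norm_diff_prj: "norm (y - prj y) = \<bar>hf y\<bar> / norm a"
  using a by (simp add: prj_def power2_eq_square)

lemma closest_point_hyperplane: "closest_point {x. hf x = 0} y = prj y"
proof (rule closest_point_unique[symmetric])
  have eq: "{x. hf x = 0} = {x. a \<bullet> x = - b}" by (auto simp: hf_def)
  show "convex {x. hf x = 0}" "closed {x. hf x = 0}"
    unfolding eq by (simp_all add: convex_hyperplane closed_hyperplane)
  show "\<forall>z\<in>{x. hf x = 0}. dist y (prj y) \<le> dist y z"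
  proof
    fix z assume "z \<in> {x. hf x = 0}"
    then have "hf y = a \<bullet> (y - z)" by (simp add: hf_def inner_diff_right)
    then have "\<bar>hf y\<bar> \<le> norm a * norm (y - z)"
      by (simp add: Cauchy_Schwarz_ineq2)
    then show "dist y (prj y) \<le> dist y z"
      using a by (simp add: dist_norm norm_diff_prj pos_divide_le_eq mult.commute)
  qed
qed (simp add: hf_prj)

lemma infdist_hyperplane: "infdist y {x. hf x = 0} = \<bar>hf y\<bar> / norm a"
proof -
  have eq: "{x. hf x = 0} = {x. a \<bullet> x = - b}" by (auto simp: hf_def)
  have cl: "closed {x. hf x = 0}" unfolding eq by (simp add: closed_hyperplane)
  have ne: "{x. hf x = 0} \<noteq> {}" using hf_prj by auto
  have "infdist y {x. hf x = 0} = dist y (closest_point {x. hf x = 0} y)"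
    using setdist_closest_point[OF cl ne, of y] by (simp add: infdist_eq_setdist)
  then show ?thesis by (simp add: closest_point_hyperplane dist_norm norm_diff_prj)
qed

lemma slab_eq_infdist: "{y. infdist y {x. hf x = 0} \<le> 1/2} = slab"
  using a by (auto simp: slab_def infdist_hyperplane pos_divide_le_eq)

lemma nn_integral_lborel_translate:
  fixes f :: "'a \<Rightarrow> ennreal"
  assumes [measurable]: "f \<in> borel_measurable borel"
  shows "(\<integral>\<^sup>+y. f (y + c) \<partial>lborel) = (\<integral>\<^sup>+y. f y \<partial>lborel)"
proof -
  have "(\<integral>\<^sup>+y. f y \<partial>lborel) = (\<integral>\<^sup>+y. f y \<partial>distr lborel borel ((+) c))"
    by (simp add: lborel_distr_plus)
  also have "\<dots> = (\<integral>\<^sup>+y. f (c + y) \<partial>lborel)"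
    by (rule nn_integral_distr) auto
  finally show ?thesis by (simp add: add.commute)
qed

text \<open>Averaging over translations in the normal direction; this replaces a change to orthonormal coordinates.\<close>

lemma nn_integral_normal_fibres:
  fixes h :: "'a \<Rightarrow> ennreal"
  assumes [measurable]: "h \<in> borel_measurable borel"
  defines "\<nu> \<equiv> a /\<^sub>R norm a"
  shows "(\<integral>\<^sup>+y. (\<integral>\<^sup>+\<tau>. indicator slab y * h (prj y + \<tau> *\<^sub>R \<nu>) \<partial>lborel) \<partial>lborel) = (\<integral>\<^sup>+y. h y \<partial>lborel)"
proof -
  have "(\<integral>\<^sup>+\<tau>. indicator slab y * h (prj y + \<tau> *\<^sub>R \<nu>) \<partial>lborel) = (\<integral>\<^sup>+\<tau>. indicator slab y * h (y + \<tau> *\<^sub>R \<nu>) \<partial>lborel)" for y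
  proof -
    have "(\<integral>\<^sup>+\<tau>. indicator slab y * h (prj y + \<tau> *\<^sub>R \<nu>) \<partial>lborel)
      = ennreal \<bar>1\<bar> * (\<integral>\<^sup>+\<tau>. indicator slab y * h (prj y + (hf y / norm a + 1 * \<tau>) *\<^sub>R \<nu>) \<partial>lborel)"
      by (rule nn_integral_real_affine) auto
    \<comment> \<open>The shift by \<open>hf y / norm a\<close> moves the base point of the normal
      line from \<open>prj y\<close> to \<open>y\<close>.\<close>
    moreover have "prj y + (hf y / norm a + 1 * \<tau>) *\<^sub>R \<nu> = y + \<tau> *\<^sub>R \<nu>" for \<tau>
      by (simp add: prj_def \<nu>_def scaleR_left_distrib power2_eq_square divide_inverse
          scaleR_diff_left[symmetric] algebra_simps)
    ultimately show ?thesis by simp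
  qed
  then have "(\<integral>\<^sup>+y. (\<integral>\<^sup>+\<tau>. indicator slab y * h (prj y + \<tau> *\<^sub>R \<nu>) \<partial>lborel) \<partial>lborel)
      = (\<integral>\<^sup>+y. (\<integral>\<^sup>+\<tau>. indicator slab y * h (y + \<tau> *\<^sub>R \<nu>) \<partial>lborel) \<partial>lborel)" by simp
  also have "\<dots> = (\<integral>\<^sup>+\<tau>. (\<integral>\<^sup>+y. indicator slab y * h (y + \<tau> *\<^sub>R \<nu>) \<partial>lborel) \<partial>lborel)"
    by (rule lborel_pair.Fubini'[symmetric]) measurable
  also have "\<dots> = (\<integral>\<^sup>+\<tau>. (\<integral>\<^sup>+y. indicator slab (y - \<tau> *\<^sub>R \<nu>) * h y \<partial>lborel) \<partial>lborel)"
  proof (rule nn_integral_cong)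
    fix \<tau> :: real
    show "(\<integral>\<^sup>+y. indicator slab y * h (y + \<tau> *\<^sub>R \<nu>) \<partial>lborel) = (\<integral>\<^sup>+y. indicator slab (y - \<tau> *\<^sub>R \<nu>) * h y \<partial>lborel)"
      using nn_integral_lborel_translate[of "\<lambda>y. indicator slab (y - \<tau> *\<^sub>R \<nu>) * h y" "\<tau> *\<^sub>R \<nu>"] by simp
  qed
  also have "\<dots> = (\<integral>\<^sup>+y. (\<integral>\<^sup>+\<tau>. indicator slab (y - \<tau> *\<^sub>R \<nu>) * h y \<partial>lborel) \<partial>lborel)"
    by (rule lborel_pair.Fubini') measurable
  also have "\<dots> = (\<integral>\<^sup>+y. h y \<partial>lborel)"
  proof (rule nn_integral_cong)
    fix y
    \<comment> \<open>For fixed \<open>y\<close> the admissible steps fill an interval of length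
      one, the thickness of the slab; hence no factor remains.\<close>
    have "y - \<tau> *\<^sub>R \<nu> \<in> slab \<longleftrightarrow> \<tau> \<in> {hf y / norm a - 1/2 .. hf y / norm a + 1/2}" for \<tau>
    proof -
      have "hf (y - \<tau> *\<^sub>R \<nu>) = hf y - \<tau> * norm a"
        using hf_add[of y "- \<tau> *\<^sub>R \<nu>"] a by (simp add: \<nu>_def dot_square_norm power2_eq_square)
      then show ?thesis using a by (auto simp: slab_def abs_le_iff field_simps)
    qed
    then have "indicator slab (y - \<tau> *\<^sub>R \<nu>) = (indicator {hf y / norm a - 1/2 .. hf y / norm a + 1/2} \<tau> :: ennreal)" for \<tau>
      by (simp add: indicator_def)
    then have "(\<integral>\<^sup>+\<tau>. indicator slab (y - \<tau> *\<^sub>R \<nu>) * h y \<partial>lborel)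
        = (\<integral>\<^sup>+\<tau>. indicator {hf y / norm a - 1/2 .. hf y / norm a + 1/2} \<tau> \<partial>lborel) * h y"
      by (simp add: nn_integral_multc)
    then show "(\<integral>\<^sup>+\<tau>. indicator slab (y - \<tau> *\<^sub>R \<nu>) * h y \<partial>lborel) = h y" by simp
  qed
  finally show ?thesis .
qed

text \<open>For fixed \<open>\<tau>\<close>, the normal step \<open>\<tau> \<nu>\<close> and the oblique step \<open>(\<tau> / \<eta>) e\<close> differ by a vector parallel to
  the hyperplane, so a translation of the slab turns one into the other.\<close>

lemma nn_integral_oblique_fibres:
  fixes h :: "'a \<Rightarrow> ennreal"
  assumes [measurable]: "h \<in> borel_measurable borel" and e: "a \<bullet> e = 1"
  shows "(\<integral>\<^sup>+y. (\<integral>\<^sup>+s. indicator slab y * h (prj y + s *\<^sub>R e) \<partial>lborel) \<partial>lborel)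
    = ennreal (norm a) * (\<integral>\<^sup>+y. h y \<partial>lborel)"
proof -
  define \<nu> where "\<nu> = a /\<^sub>R norm a"
  define w where "w = \<nu> - norm a *\<^sub>R e"
  have w: "a \<bullet> w = 0" 
    using a e by (simp add: w_def \<nu>_def inner_diff_right dot_square_norm power2_eq_square)
  have "(\<integral>\<^sup>+y. (\<integral>\<^sup>+\<tau>. indicator slab y * h (prj y + (norm a * \<tau>) *\<^sub>R e) \<partial>lborel) \<partial>lborel)
    = (\<integral>\<^sup>+\<tau>. (\<integral>\<^sup>+y. indicator slab y * h (prj y + (norm a * \<tau>) *\<^sub>R e) \<partial>lborel) \<partial>lborel)"
    by (rule lborel_pair.Fubini'[symmetric]) measurable
  also have "\<dots> = (\<integral>\<^sup>+\<tau>. (\<integral>\<^sup>+y. indicator slab y * h (prj y + \<tau> *\<^sub>R \<nu>) \<partial>lborel) \<partial>lborel)"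
  proof (rule nn_integral_cong)
    fix \<tau> :: real
    have "(\<integral>\<^sup>+y. indicator slab y * h (prj y + (norm a * \<tau>) *\<^sub>R e) \<partial>lborel)
      = (\<integral>\<^sup>+y. indicator slab (y + \<tau> *\<^sub>R w) * h (prj (y + \<tau> *\<^sub>R w) + (norm a * \<tau>) *\<^sub>R e) \<partial>lborel)"
      by (rule nn_integral_lborel_translate[symmetric]) measurable
    also have "\<dots> = (\<integral>\<^sup>+y. indicator slab y * h (prj y + \<tau> *\<^sub>R \<nu>) \<partial>lborel)"
    proof (rule nn_integral_cong)
      fix y
      have "y + \<tau> *\<^sub>R w \<in> slab \<longleftrightarrow> y \<in> slab" using w by (simp add: slab_def hf_add)
      moreover have "prj (y + \<tau> *\<^sub>R w) = prj y + \<tau> *\<^sub>R w"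
        using w by (intro prj_add) simp
      then have "prj (y + \<tau> *\<^sub>R w) + (norm a * \<tau>) *\<^sub>R e = prj y + \<tau> *\<^sub>R \<nu>"
        by (simp only:) (simp add: w_def scaleR_diff_right mult.commute)
      ultimately show "indicator slab (y + \<tau> *\<^sub>R w) * h (prj (y + \<tau> *\<^sub>R w) + (norm a * \<tau>) *\<^sub>R e)
          = indicator slab y * h (prj y + \<tau> *\<^sub>R \<nu>)"
        by (simp add: indicator_def)
    qed
    finally show "(\<integral>\<^sup>+y. indicator slab y * h (prj y + (norm a * \<tau>) *\<^sub>R e) \<partial>lborel)
      = (\<integral>\<^sup>+y. indicator slab y * h (prj y + \<tau> *\<^sub>R \<nu>) \<partial>lborel)" .
  qed
  also have "\<dots> = (\<integral>\<^sup>+y. (\<integral>\<^sup>+\<tau>. indicator slab y * h (prj y + \<tau> *\<^sub>R \<nu>) \<partial>lborel) \<partial>lborel)"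
    by (rule lborel_pair.Fubini') measurable
  also have "\<dots> = (\<integral>\<^sup>+y. h y \<partial>lborel)"
    unfolding \<nu>_def by (rule nn_integral_normal_fibres) measurable
  finally have "(\<integral>\<^sup>+y. (\<integral>\<^sup>+\<tau>. indicator slab y * h (prj y + (norm a * \<tau>) *\<^sub>R e) \<partial>lborel) \<partial>lborel) = (\<integral>\<^sup>+y. h y \<partial>lborel)" .
  \<comment> \<open>Substituting \<open>s = norm a * \<tau>\<close> produces the factor
    \<open>norm a\<close>.\<close>
  moreover have "(\<integral>\<^sup>+y. (\<integral>\<^sup>+s. indicator slab y * h (prj y + s *\<^sub>R e) \<partial>lborel) \<partial>lborel)
     = ennreal (norm a) * (\<integral>\<^sup>+y. (\<integral>\<^sup>+\<tau>. indicator slab y * h (prj y + (norm a * \<tau>) *\<^sub>R e) \<partial>lborel) \<partial>lborel)"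
  proof -
    have "(\<integral>\<^sup>+s. indicator slab y * h (prj y + s *\<^sub>R e) \<partial>lborel)
       = ennreal \<bar>norm a\<bar> * (\<integral>\<^sup>+\<tau>. indicator slab y * h (prj y + (0 + norm a * \<tau>) *\<^sub>R e) \<partial>lborel)" for y
      by (rule nn_integral_real_affine) (use a in auto)
    then have "(\<integral>\<^sup>+y. (\<integral>\<^sup>+s. indicator slab y * h (prj y + s *\<^sub>R e) \<partial>lborel) \<partial>lborel)
       = (\<integral>\<^sup>+y. ennreal (norm a) * (\<integral>\<^sup>+\<tau>. indicator slab y * h (prj y + (norm a * \<tau>) *\<^sub>R e) \<partial>lborel) \<partial>lborel)" by simp
    also have "\<dots> = ennreal (norm a) * (\<integral>\<^sup>+y. (\<integral>\<^sup>+\<tau>. indicator slab y * h (prj y + (norm a * \<tau>) *\<^sub>R e) \<partial>lborel) \<partial>lborel)"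
      by (rule nn_integral_cmult) measurable
    finally show ?thesis .
  qed
  ultimately show ?thesis by simp
qed

text \<open>Applied to the positive and negative parts of \<open>f\<close>, the preceding identity
  gives integrability on the product space; Fubini's theorem then yields both claims.\<close>

lemma integral_oblique_fibres:
  fixes f :: "'a \<Rightarrow> real"
  assumes f: "integrable lborel f" "f \<in> borel_measurable borel" and e: "a \<bullet> e = 1"
  shows "(\<integral>y. indicator slab y * (\<integral>s. f (prj y + s *\<^sub>R e) \<partial>lborel) \<partial>lborel) = norm a * (\<integral>y. f y \<partial>lborel)"
    and "integrable lborel (\<lambda>y. indicator slab y * (\<integral>s. f (prj y + s *\<^sub>R e) \<partial>lborel))"
proof -
  note [measurable] = f(2)
  let ?P = "lborel \<Otimes>\<^sub>M lborel :: ('a \<times> real) measure"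
  let ?k = "\<lambda>(y, s). indicator slab y * f (prj y + s *\<^sub>R e)"
  have nn: "(\<integral>\<^sup>+z. (case z of (y, s) \<Rightarrow> indicator slab y * h (prj y + s *\<^sub>R e)) \<partial>?P) = ennreal (norm a) * (\<integral>\<^sup>+y. h y \<partial>lborel)"
    if [measurable]: "h \<in> borel_measurable borel" for h :: "'a \<Rightarrow> ennreal"
    unfolding nn_integral_oblique_fibres[OF that e, symmetric]
    by (subst lborel.nn_integral_fst[symmetric]) (auto simp: split_beta')
  have meas: "?k \<in> borel_measurable ?P" by measurable
  have fin: "(\<integral>\<^sup>+y. ennreal (f y) \<partial>lborel) < \<infinity>" "(\<integral>\<^sup>+y. ennreal (- f y) \<partial>lborel) < \<infinity>"
    using f(1) by (auto simp: real_integrable_def less_top)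
  have pn: "(\<integral>\<^sup>+z. ennreal (?k z) \<partial>?P) = ennreal (norm a) * (\<integral>\<^sup>+y. ennreal (f y) \<partial>lborel)"
    "(\<integral>\<^sup>+z. ennreal (- ?k z) \<partial>?P) = ennreal (norm a) * (\<integral>\<^sup>+y. ennreal (- f y) \<partial>lborel)"
    by (subst nn[symmetric], simp, intro nn_integral_cong, auto simp: indicator_def)+
  have int: "integrable ?P ?k"
    unfolding real_integrable_def using meas fin by (auto simp: pn ennreal_mult_eq_top_iff)
  have "(\<integral>z. ?k z \<partial>?P) = norm a * (\<integral>y. f y \<partial>lborel)"
    using int f(1) by (simp add: real_lebesgue_integral_def pn enn2real_mult right_diff_distrib)
  moreover have "(\<integral>z. ?k z \<partial>?P) = (\<integral>y. (\<integral>s. ?k (y, s) \<partial>lborel) \<partial>lborel)"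
    using lborel_pair.integral_fst'[OF int] by simp
  ultimately show "(\<integral>y. indicator slab y * (\<integral>s. f (prj y + s *\<^sub>R e) \<partial>lborel) \<partial>lborel) = norm a * (\<integral>y. f y \<partial>lborel)"
    by simp
  show "integrable lborel (\<lambda>y. indicator slab y * (\<integral>s. f (prj y + s *\<^sub>R e) \<partial>lborel))"
    using lborel_pair.integrable_fst'[OF int] by simp
qed

end

section \<open>Integrals over the facets of a simplex\<close>

lemma integrable_continuous_lebesgue_on:
  fixes f :: "real^'n \<Rightarrow> 'b::euclidean_space"
  assumes "continuous_on UNIV f" "compact K"
  shows "integrable (lebesgue_on K) f"
proof -
  have "integrable lborel (\<lambda>x. indicator K x *\<^sub>R f x)"
    by (rule borel_integrable_compact[OF assms(2) continuous_on_subset[OF assms(1)]]) simp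
  then have "integrable lebesgue (\<lambda>x. indicator K x *\<^sub>R f x)"
    by (subst integrable_completion) auto
  then show ?thesis
    using assms(2) by (subst integrable_restrict_space) (auto simp: compact_imp_closed)
qed

lemma continuous_L2_compact:
  fixes f :: "real^'n \<Rightarrow> 'b::euclidean_space"
  assumes f: "continuous_on UNIV f" and K: "compact K"
  shows "f \<in> L2 (lebesgue_on K)"
proof -
  have "continuous_on UNIV (\<lambda>x. (norm (f x))\<^sup>2)" by (intro continuous_intros f)
  from integrable_continuous_lebesgue_on[OF this K] borel_measurable_integrable[OF integrable_continuous_lebesgue_on[OF f K]]
  show ?thesis by (simp add: L2_def)
qed

lemma space_face_measure: "space (face_measure F) = F"
  by (simp add: face_measure_def space_restrict_space)

lemma borel_measurable_face_measure: "f \<in> borel_measurable borel \<Longrightarrow> f \<in> borel_measurable (face_measure F)"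
  unfolding face_measure_def by (rule measurable_restrict_space1) simp

context full_simplex
begin

lemma hyperplane: "j \<in> C \<Longrightarrow> hyperplane (grd j)"
  by unfold_locales (rule grd_nonzero)

lemma hf_eq_ell: "j \<in> C \<Longrightarrow> hyperplane.hf (grd j) (snd coords j) = ell j"
  by (auto simp: hyperplane.hf_def[OF hyperplane] ell_def fun_eq_iff)

text \<open>Replaces the closest points and distances of the definition by linear formulas, to which
  integration along fibres applies.\<close>

lemma face_measure_eq:
  assumes "j \<in> C"
  shows "face_measure (convex hull (C - {j})) = restrict_space
    (distr (restrict_space lborel (hyperplane.slab (grd j) (snd coords j))) borel
      (hyperplane.prj (grd j) (snd coords j))) (convex hull (C - {j}))"
proof -
  interpret hyperplane "grd j" "snd coords j" by (rule hyperplane[OF assms])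
  have "closest_point {x. ell j x = 0} = prj"
    using closest_point_hyperplane by (simp add: fun_eq_iff hf_eq_ell[OF assms])
  then show ?thesis
    using slab_eq_infdist
    by (simp add: face_measure_def affine_hull_facet[OF assms] hf_eq_ell[OF assms])
qed

lemma facet_borel [measurable]: "convex hull (C - {j}) \<in> sets borel"
  using compact_facet by (simp add: borel_compact)

text \<open>The points of the slab that project into the facet stay within 1/2 of it, hence in a
  ball.\<close>

lemma finite_face_measure:
  assumes "j \<in> C"
  shows "finite_measure (face_measure (convex hull (C - {j})))" (is "finite_measure (face_measure ?F)")
proof
  interpret hyperplane "grd j" "snd coords j" by (rule hyperplane[OF assms])
  obtain B where B: "\<And>x. x \<in> ?F \<Longrightarrow> norm x \<le> B"
    using compact_imp_bounded[OF compact_facet[of j]] by (auto simp: bounded_iff)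
  have sub: "prj -` ?F \<inter> slab \<subseteq> cball 0 (B + 1/2)"
  proof
    fix y assume y: "y \<in> prj -` ?F \<inter> slab"
    have "norm (y - prj y) \<le> 1/2"
      using y a by (simp add: norm_diff_prj slab_def pos_divide_le_eq)
    moreover have "norm y \<le> norm (y - prj y) + norm (prj y)"
      using norm_triangle_ineq[of "y - prj y" "prj y"] by simp
    moreover have "norm (prj y) \<le> B" using y B by auto
    ultimately show "y \<in> cball 0 (B + 1/2)" by simp
  qed
  have "prj -` ?F \<in> sets borel"
    using measurable_sets[OF measurable_prj facet_borel] by simp
  have "emeasure (face_measure ?F) ?F = emeasure (distr (restrict_space lborel slab) borel prj) ?F"
    unfolding face_measure_eq[OF assms] by (rule emeasure_restrict_space) auto
  also have "\<dots> = emeasure (restrict_space lborel slab) (prj -` ?F \<inter> slab)"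
    by (subst emeasure_distr) (auto simp: space_restrict_space intro!: measurable_restrict_space1)
  also have "\<dots> = emeasure lborel (prj -` ?F \<inter> slab)"
    by (rule emeasure_restrict_space) auto
  also have "\<dots> \<le> emeasure lborel (cball (0 :: real^'n) (B + 1/2))"
    by (intro Measure_Space.emeasure_mono sub) simp
  also have "\<dots> < \<infinity>" by (rule emeasure_lborel_cball_finite)
  finally show "emeasure (face_measure ?F) (space (face_measure ?F)) \<noteq> \<infinity>"
    by (simp add: space_face_measure)
qed

lemma face_integral:
  fixes f :: "real^'n \<Rightarrow> real"
  assumes j: "j \<in> C" and [measurable]: "f \<in> borel_measurable borel"
  shows "(\<integral>y. f y \<partial>face_measure (convex hull (C - {j}))) = (\<integral>y. indicator (hyperplane.slab (grd j) (snd coords j)) y *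
     (indicator (convex hull (C - {j})) (hyperplane.prj (grd j) (snd coords j) y) * f (hyperplane.prj (grd j) (snd coords j) y)) \<partial>lborel)"
proof -
  interpret hyperplane "grd j" "snd coords j" by (rule hyperplane[OF j])
  let ?F = "convex hull (C - {j})"
  have "(\<integral>y. f y \<partial>face_measure ?F) = (\<integral>y. indicator ?F y *\<^sub>R f y \<partial>distr (restrict_space lborel slab) borel prj)"
    unfolding face_measure_eq[OF j] by (rule integral_restrict_space) simp
  also have "\<dots> = (\<integral>y. indicator ?F (prj y) *\<^sub>R f (prj y) \<partial>restrict_space lborel slab)"
    by (rule integral_distr) (auto intro!: measurable_restrict_space1)
  also have "\<dots> = (\<integral>y. indicator slab y *\<^sub>R (indicator ?F (prj y) *\<^sub>R f (prj y)) \<partial>lborel)"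
    by (rule integral_restrict_space) simp
  finally show ?thesis by simp
qed

lemma hull_borel [measurable]: "convex hull C \<in> sets borel"
  using compact_hull by (simp add: borel_compact)

lemma integral_lebesgue_on_hull:
  fixes f :: "real^'n \<Rightarrow> real"
  assumes [measurable]: "f \<in> borel_measurable borel"
  shows "(\<integral>x. f x \<partial>lebesgue_on (convex hull C)) = (\<integral>x. indicator (convex hull C) x * f x \<partial>lborel)"
proof -
  have "(\<integral>x. f x \<partial>lebesgue_on (convex hull C)) = (\<integral>x. indicator (convex hull C) x *\<^sub>R f x \<partial>lebesgue)"
    by (rule integral_restrict_space) simp
  also have "\<dots> = (\<integral>x. indicator (convex hull C) x *\<^sub>R f x \<partial>lborel)"
    by (rule integral_completion) measurable
  finally show ?thesis by simp
qed

text \<open>Integration of \<open>d/ds (ell i \<cdot> \<phi>)\<close> along the segments in the direction \<open>j - i\<close>: each of them enters the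
  simplex through the facet opposite to \<open>j\<close> and leaves it through the one opposite to \<open>i\<close>, where \<open>ell i\<close> vanishes.\<close>

lemma edge_direction_formula:
  fixes \<phi> :: "real^'n \<Rightarrow> real" and G :: "real^'n \<Rightarrow> real^'n"
  assumes j: "j \<in> C" and i: "i \<in> C" "i \<noteq> j"
    and \<phi>: "\<And>x. (\<phi> has_derivative (\<lambda>h. G x \<bullet> h)) (at x)" and G: "continuous_on UNIV G"
  shows "(\<integral>y. ell i y * \<phi> y \<partial>face_measure (convex hull (C - {j})))
    = norm (grd j) * (\<integral>x. \<phi> x + ell i x * (G x \<bullet> (i - j)) \<partial>lebesgue_on (convex hull C))"
proof -
  interpret hyperplane "grd j" "snd coords j" by (rule hyperplane[OF j])
  define T where "T = convex hull C"
  define F where "F = convex hull (C - {j})"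
  define e where "e = j - i"
  \<comment> \<open>The negative of the derivative of \<open>ell i * \<phi>\<close> in direction
    \<open>e\<close>, along which \<open>ell i\<close> has slope -1.\<close>
  define k where "k x = \<phi> x - ell i x * (G x \<bullet> e)" for x
  define f where "f x = indicator T x * k x" for x
  have c\<phi>: "continuous_on UNIV \<phi>"
    using \<phi> by (meson has_derivative_continuous continuous_at_imp_continuous_on)
  have ck: "continuous_on UNIV k"
    unfolding k_def ell_def by (intro continuous_intros G c\<phi>)
  have [measurable]: "k \<in> borel_measurable borel" "\<phi> \<in> borel_measurable borel" "T \<in> sets borel" "ell i \<in> borel_measurable borel"
    using ck c\<phi> hull_borel by (auto intro: borel_measurable_continuous_onI simp: T_def ell_def[abs_def])
  have fb [measurable]: "f \<in> borel_measurable borel" unfolding f_def by measurable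
  have fi: "integrable lborel f"
    using borel_integrable_compact[OF compact_hull continuous_on_subset[OF ck]] by (simp add: f_def[abs_def] T_def)
  have ge: "grd c \<bullet> e = (if c = j then 1 else 0) - (if c = i then 1 else 0)" if "c \<in> C" for c
    using grd_diff[OF j i(1) that] by (auto simp: e_def)
  have line: "ell c (z + s *\<^sub>R e) = ell c z + s * ((if c = j then 1 else 0) - (if c = i then 1 else 0))" if "c \<in> C" for c z s
    using ge[OF that] by (simp add: ell_add)
  have inner: "(\<integral>s. f (z + s *\<^sub>R e) \<partial>lborel) = indicator F z * (ell i z * \<phi> z)" if z: "ell j z = 0" for z
  proof (cases "z \<in> F")
    case True
    then have nn: "\<And>c. c \<in> C \<Longrightarrow> 0 \<le> ell c z" by (auto simp: F_def facet_iff j)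
    \<comment> \<open>Along \<open>e\<close> only two coordinates change: \<open>ell j\<close>
      equals \<open>s\<close>, and \<open>ell i\<close> decreases to 0 at
      \<open>s = ell i z\<close>.\<close>
    have "z + s *\<^sub>R e \<in> T \<longleftrightarrow> s \<in> {0..ell i z}" for s
    proof
      assume "z + s *\<^sub>R e \<in> T"
      then have *: "\<And>c. c \<in> C \<Longrightarrow> 0 \<le> ell c (z + s *\<^sub>R e)" by (auto simp: T_def hull_iff)
      show "s \<in> {0..ell i z}" using *[OF j] *[OF i(1)] i(2) z line[OF j] line[OF i(1)] by auto
    next
      assume s: "s \<in> {0..ell i z}"
      show "z + s *\<^sub>R e \<in> T" unfolding T_def hull_iff
      proof
        fix c assume c: "c \<in> C"
        show "0 \<le> ell c (z + s *\<^sub>R e)" using s nn[OF c] z i(2) by (auto simp: line[OF c])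
      qed
    qed
    then have "(\<integral>s. f (z + s *\<^sub>R e) \<partial>lborel) = (\<integral>s. k (z + s *\<^sub>R e) * indicator {0..ell i z} s \<partial>lborel)"
      by (intro Bochner_Integration.integral_cong) (auto simp: f_def indicator_def)
    \<comment> \<open>The antiderivative \<open>- (ell i z - s) * \<phi>\<close> is zero at the exit
      point, so only the entry point on the facet contributes.\<close>
    also have "\<dots> = (- (ell i z - ell i z) * \<phi> (z + ell i z *\<^sub>R e)) - (- (ell i z - 0) * \<phi> (z + 0 *\<^sub>R e))"
    proof (rule integral_FTC_Icc_real)
      show "0 \<le> ell i z" by (rule nn[OF i(1)])
      fix s :: real
      have "((\<lambda>s. \<phi> (z + s *\<^sub>R e)) has_derivative (\<lambda>h. G (z + s *\<^sub>R e) \<bullet> (h *\<^sub>R e))) (at s)"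
        by (rule has_derivative_compose[where g = \<phi>]) (auto intro!: derivative_eq_intros \<phi>)
      then have d: "((\<lambda>s. \<phi> (z + s *\<^sub>R e)) has_real_derivative (G (z + s *\<^sub>R e) \<bullet> e)) (at s)"
        by (simp add: has_field_derivative_def mult_commute_abs)
      show "((\<lambda>s. - (ell i z - s) * \<phi> (z + s *\<^sub>R e)) has_real_derivative k (z + s *\<^sub>R e)) (at s)"
        by (rule derivative_eq_intros d refl)+ (use i(2) in \<open>simp add: k_def line[OF i(1)] algebra_simps\<close>)
      have "continuous_on UNIV (\<lambda>s. k (z + s *\<^sub>R e))"
        by (rule continuous_on_compose2[OF ck]) (auto intro!: continuous_intros)
      then show "isCont (\<lambda>s. k (z + s *\<^sub>R e)) s"
        by (simp add: continuous_on_eq_continuous_at)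
    qed
    finally show ?thesis using True by simp
  next
    case False
    \<comment> \<open>A negative coordinate at a point of the hyperplane is not
      \<open>ell j\<close>. Being in the simplex would require \<open>s \<ge> 0\<close>, and such a
      step cannot raise it.\<close>
    then obtain c where c: "c \<in> C" "ell c z < 0" using z by (auto simp: F_def facet_iff j not_le)
    have "z + s *\<^sub>R e \<notin> T" for s
    proof
      assume "z + s *\<^sub>R e \<in> T"
      then have *: "\<And>c. c \<in> C \<Longrightarrow> 0 \<le> ell c (z + s *\<^sub>R e)" by (auto simp: T_def hull_iff)
      show False using *[OF j] *[OF c(1)] c z line[OF j, of z s] line[OF c(1), of z s] i(2)
        by (auto split: if_splits)
    qed
    then show ?thesis using False by (simp add: f_def)
  qed
  have e1: "grd j \<bullet> e = 1" using ge[OF j] i(2) by simp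
  have "(\<integral>y. ell i y * \<phi> y \<partial>face_measure F) = (\<integral>y. indicator slab y * (indicator F (prj y) * (ell i (prj y) * \<phi> (prj y))) \<partial>lborel)"
    unfolding F_def by (rule face_integral[OF j]) measurable
  also have "\<dots> = (\<integral>y. indicator slab y * (\<integral>s. f (prj y + s *\<^sub>R e) \<partial>lborel) \<partial>lborel)"
    using hf_prj hf_eq_ell[OF j] by (simp add: inner)
  also have "\<dots> = norm (grd j) * (\<integral>y. f y \<partial>lborel)"
    by (rule integral_oblique_fibres(1)[OF fi fb e1])
  also have "(\<integral>y. f y \<partial>lborel) = (\<integral>x. k x \<partial>lebesgue_on T)"
    unfolding f_def T_def by (rule integral_lebesgue_on_hull[symmetric]) measurable
  also have "k = (\<lambda>x. \<phi> x + ell i x * (G x \<bullet> (i - j)))"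
    by (auto simp: k_def e_def inner_diff_right algebra_simps)
  finally show ?thesis by (simp add: F_def T_def)
qed

lemma integrable_continuous_face_measure:
  fixes f :: "real^'n \<Rightarrow> real"
  assumes "continuous_on UNIV f" "j \<in> C"
  shows "integrable (face_measure (convex hull (C - {j}))) f"
proof -
  interpret finite_measure "face_measure (convex hull (C - {j}))" by (rule finite_face_measure[OF assms(2)])
  have "bounded (f ` (convex hull (C - {j})))"
    by (intro compact_imp_bounded compact_continuous_image compact_facet continuous_on_subset[OF assms(1)]) simp
  then obtain B where "\<And>x. x \<in> convex hull (C - {j}) \<Longrightarrow> norm (f x) \<le> B"
    by (auto simp: bounded_iff)
  then show ?thesis
    using assms(1) by (intro integrable_const_bound[where B = B] borel_measurable_face_measure borel_measurable_continuous_onI AE_I2)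
      (auto simp: space_face_measure)
qed

text \<open>The coordinates other than \<open>ell j\<close> sum to 1 on the facet, so adding
  \<open>edge_direction_formula\<close> over all edges at \<open>j\<close> recovers
  \<open>\<phi>\<close> on the left, while on the right the edge directions combine to
  \<open>x - j\<close>. The factor \<open>norm (grd j)\<close> is the reciprocal of the height over
  the facet.\<close>

theorem face_integral_formula:
  fixes \<phi> :: "real^'n \<Rightarrow> real" and G :: "real^'n \<Rightarrow> real^'n"
  assumes j: "j \<in> C"
    and \<phi>: "\<And>x. (\<phi> has_derivative (\<lambda>h. G x \<bullet> h)) (at x)" and G: "continuous_on UNIV G"
  shows "(\<integral>y. \<phi> y \<partial>face_measure (convex hull (C - {j})))
    = norm (grd j) * (\<integral>x. CARD('n) * \<phi> x + G x \<bullet> (x - j) \<partial>lebesgue_on (convex hull C))"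
proof -
  have c\<phi>: "continuous_on UNIV \<phi>"
    using \<phi> by (meson has_derivative_continuous continuous_at_imp_continuous_on)
  have ce: "continuous_on UNIV (ell i)" for i unfolding ell_def[abs_def] by (intro continuous_intros)
  have "(\<Sum>i\<in>C - {j}. ell i y) * \<phi> y = \<phi> y" if "y \<in> convex hull (C - {j})" for y
    using sum_ell[of y] that j finite_C by (simp add: sum.remove[of C j] facet_iff)
  then have "(\<integral>y. \<phi> y \<partial>face_measure (convex hull (C - {j}))) = (\<integral>y. (\<Sum>i\<in>C - {j}. ell i y * \<phi> y) \<partial>face_measure (convex hull (C - {j})))"
    by (intro Bochner_Integration.integral_cong) (auto simp: space_face_measure sum_distrib_right)
  also have "\<dots> = (\<Sum>i\<in>C - {j}. \<integral>y. ell i y * \<phi> y \<partial>face_measure (convex hull (C - {j})))"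
    by (rule Bochner_Integration.integral_sum) (intro integrable_continuous_face_measure j continuous_intros c\<phi> ce)
  also have "\<dots> = (\<Sum>i\<in>C - {j}. norm (grd j) * (\<integral>x. \<phi> x + ell i x * (G x \<bullet> (i - j)) \<partial>lebesgue_on (convex hull C)))"
    using j by (intro sum.cong edge_direction_formula \<phi> G) auto
  also have "\<dots> = norm (grd j) * (\<integral>x. (\<Sum>i\<in>C - {j}. \<phi> x + ell i x * (G x \<bullet> (i - j))) \<partial>lebesgue_on (convex hull C))"
    unfolding sum_distrib_left[symmetric]
    by (subst Bochner_Integration.integral_sum)
      (auto intro!: integrable_continuous_lebesgue_on compact_hull continuous_intros c\<phi> ce G)
  also have "(\<lambda>x. \<Sum>i\<in>C - {j}. \<phi> x + ell i x * (G x \<bullet> (i - j))) = (\<lambda>x. CARD('n) * \<phi> x + G x \<bullet> (x - j))"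
  proof
    fix x
    \<comment> \<open>The term \<open>i = j\<close> is zero and is added to obtain sums over all
      vertices.\<close>
    have "(\<Sum>i\<in>C - {j}. ell i x * (G x \<bullet> (i - j))) = (\<Sum>i\<in>C. ell i x * (G x \<bullet> (i - j)))"
      using j finite_C by (simp add: sum.remove[of C j])
    also have "\<dots> = G x \<bullet> (\<Sum>i\<in>C. ell i x *\<^sub>R i) - (\<Sum>i\<in>C. ell i x) * (G x \<bullet> j)"
      by (simp add: inner_diff_right right_diff_distrib sum_subtractf inner_sum_right sum_distrib_right)
    finally show "(\<Sum>i\<in>C - {j}. \<phi> x + ell i x * (G x \<bullet> (i - j))) = CARD('n) * \<phi> x + G x \<bullet> (x - j)"
      using card_facet[OF j] by (simp add: sum.distrib sum_ell sum_ell_scaleR inner_diff_right)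
  qed
  finally show ?thesis .
qed

lemma continuous_L2_face_measure:
  fixes f :: "real^'n \<Rightarrow> real"
  assumes f: "continuous_on UNIV f" and j: "j \<in> C"
  shows "f \<in> L2 (face_measure (convex hull (C - {j})))"
proof -
  have "continuous_on UNIV (\<lambda>x. (norm (f x))\<^sup>2)" by (intro continuous_intros f)
  from integrable_continuous_face_measure[OF this j] borel_measurable_integrable[OF integrable_continuous_face_measure[OF f j]]
  show ?thesis by (simp add: L2_def)
qed

text \<open>The face identity for the constant function 1, that is, the volume formula of a
  cone.\<close>

lemma measure_face:
  assumes j: "j \<in> C"
  shows "measure (face_measure (convex hull (C - {j}))) (convex hull (C - {j}))
    = norm (grd j) * CARD('n) * measure lebesgue (convex hull C)"
proof -
  interpret finite_measure "face_measure (convex hull (C - {j}))" by (rule finite_face_measure[OF j])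
  have "measure (face_measure (convex hull (C - {j}))) (convex hull (C - {j})) = (\<integral>y. 1 \<partial>face_measure (convex hull (C - {j})))"
    by (simp add: space_face_measure)
  also have "\<dots> = norm (grd j) * (\<integral>x. real CARD('n) * 1 + 0 \<bullet> (x - j) \<partial>lebesgue_on (convex hull C))"
    by (rule face_integral_formula[OF j]) (auto intro!: derivative_eq_intros)
  also have "(\<integral>x. real CARD('n) * 1 + 0 \<bullet> (x - j) \<partial>lebesgue_on (convex hull C)) = CARD('n) * measure lebesgue (convex hull C)"
    by (simp add: measure_restrict_space)
  finally show ?thesis by simp
qed

lemma measure_hull_pos: "0 < measure lebesgue (convex hull C)"
proof -
  have "\<not> negligible (convex hull C)"
    using interior_nonempty negligible_subset[OF _ interior_subset] open_not_negligible[OF open_interior] by blast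
  then have "measure lebesgue (convex hull C) \<noteq> 0"
    using compact_hull by (simp add: negligible_iff_measure0 lmeasurable_compact)
  then show ?thesis using measure_nonneg[of lebesgue "convex hull C"] by linarith
qed

end

section \<open>Test functions and weak gradients\<close>

lemma grad_eq:
  assumes "(f has_derivative (\<lambda>h. G \<bullet> h)) (at x)"
  shows "grad f x = G"
proof -
  have "frechet_derivative f (at x) = (\<lambda>h. G \<bullet> h)"
    using frechet_derivative_at[OF assms] by simp
  then show ?thesis by (simp add: grad_def vec_eq_iff inner_axis)
qed

lemma has_derivative_grad:
  fixes f :: "real^'n \<Rightarrow> real"
  assumes "f differentiable (at x)"
  shows "(f has_derivative (\<lambda>h. grad f x \<bullet> h)) (at x)"
proof -
  let ?D = "frechet_derivative f (at x)"
  have D: "(f has_derivative ?D) (at x)" using assms by (simp add: frechet_derivative_works)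
  interpret D: bounded_linear ?D using D by (rule has_derivative_bounded_linear)
  have "?D h = grad f x \<bullet> h" for h
  proof -
    have "?D h = ?D (\<Sum>i\<in>UNIV. (h $ i) *\<^sub>R axis i 1)"
      by (simp add: basis_expansion[of h, unfolded scalar_mult_eq_scaleR])
    also have "\<dots> = grad f x \<bullet> h"
      by (simp add: D.sum D.scaleR grad_def inner_vec_def mult.commute)
    finally show ?thesis .
  qed
  then have "?D = (\<lambda>h. grad f x \<bullet> h)" by auto
  then show ?thesis using D by simp
qed

section \<open>Closure properties of continuously differentiable functions\<close>

lemma Ck_Suc_imp: "Ck (Suc k) f \<Longrightarrow> Ck k f"
proof (induction k arbitrary: f)
  case 0
  then show ?case
    by (simp add: continuous_on_eq_continuous_at differentiable_imp_continuous_within)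
qed auto

lemma Ck_SucI:
  assumes "\<And>x. (f has_derivative (\<lambda>h. G x \<bullet> h)) (at x)" "\<And>i. Ck k (\<lambda>x. G x $ i)"
  shows "Ck (Suc k) f"
proof -
  have "grad f = G" using grad_eq[OF assms(1)] by auto
  then show ?thesis using assms by (auto intro: differentiableI)
qed

lemma Ck_SucD:
  assumes "Ck (Suc k) f"
  shows "(f has_derivative (\<lambda>h. grad f x \<bullet> h)) (at x)" "Ck k (\<lambda>x. grad f x $ i)"
  using assms has_derivative_grad by auto

lemma Ck_const: "Ck k (\<lambda>x. c)"
proof (induction k arbitrary: c)
  case (Suc k)
  show ?case by (rule Ck_SucI[where G = "\<lambda>x. 0"]) (use Suc in auto)
qed simp

lemma Ck_add: "Ck k f \<Longrightarrow> Ck k g \<Longrightarrow> Ck k (\<lambda>x. f x + g x)"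
proof (induction k arbitrary: f g)
  case 0
  then show ?case by (auto intro: continuous_on_add)
next
  case (Suc k)
  show ?case
  proof (rule Ck_SucI[where G = "\<lambda>x. grad f x + grad g x"])
    show "((\<lambda>x. f x + g x) has_derivative (\<lambda>h. (grad f x + grad g x) \<bullet> h)) (at x)" for x
      using has_derivative_add[OF Ck_SucD(1)[OF Suc.prems(1)] Ck_SucD(1)[OF Suc.prems(2)]]
      by (simp add: inner_add_left)
    show "Ck k (\<lambda>x. (grad f x + grad g x) $ i)" for i
      using Suc.IH[OF Ck_SucD(2)[OF Suc.prems(1)] Ck_SucD(2)[OF Suc.prems(2)]] by simp
  qed
qed

lemma Ck_mult: "Ck k f \<Longrightarrow> Ck k g \<Longrightarrow> Ck k (\<lambda>x. f x * g x)"
proof (induction k arbitrary: f g)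
  case 0
  then show ?case by (auto intro: continuous_on_mult)
next
  case (Suc k)
  show ?case
  proof (rule Ck_SucI[where G = "\<lambda>x. f x *\<^sub>R grad g x + g x *\<^sub>R grad f x"])
    show "((\<lambda>x. f x * g x) has_derivative (\<lambda>h. (f x *\<^sub>R grad g x + g x *\<^sub>R grad f x) \<bullet> h)) (at x)" for x
      using has_derivative_mult[OF Ck_SucD(1)[OF Suc.prems(1)] Ck_SucD(1)[OF Suc.prems(2)]]
      by (simp add: inner_add_left mult.commute)
    show "Ck k (\<lambda>x. (f x *\<^sub>R grad g x + g x *\<^sub>R grad f x) $ i)" for i
      using Ck_add[OF Suc.IH[OF Ck_Suc_imp[OF Suc.prems(1)] Ck_SucD(2)[OF Suc.prems(2)]]
        Suc.IH[OF Ck_Suc_imp[OF Suc.prems(2)] Ck_SucD(2)[OF Suc.prems(1)]]] by simp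
  qed
qed

lemma Ck_cmult: "Ck k f \<Longrightarrow> Ck k (\<lambda>x. c * f x)"
  by (intro Ck_mult Ck_const)

lemma Ck_prod:
  assumes "finite I" "\<And>i. i \<in> I \<Longrightarrow> Ck k (f i)"
  shows "Ck k (\<lambda>x. \<Prod>i\<in>I. f i x)"
  using assms by (induction I rule: finite_induct) (auto intro: Ck_mult Ck_const)

lemma Ck_coordinate: "Ck k (\<lambda>x. c * x $ i + d)"
proof (cases k)
  case 0
  then show ?thesis by (auto intro!: continuous_intros)
next
  case (Suc k')
  show ?thesis unfolding Suc
  proof (rule Ck_SucI[where G = "\<lambda>x. c *\<^sub>R axis i 1"])
    show "((\<lambda>x. c * x $ i + d) has_derivative (\<lambda>h. (c *\<^sub>R axis i 1) \<bullet> h)) (at x)" for x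
      by (auto intro!: derivative_eq_intros bounded_linear_imp_has_derivative simp: inner_axis')
    show "Ck k' (\<lambda>x. (c *\<^sub>R axis i 1) $ j)" for j by (rule Ck_const)
  qed
qed

text \<open>The classical \<open>exp (-1/t)\<close> cut off at 0, with a polynomial factor in
  \<open>1/t\<close> that makes the family closed under differentiation.\<close>

definition flat :: "real poly \<Rightarrow> real \<Rightarrow> real" where
  "flat p t = (if t > 0 then poly p (inverse t) * exp (- inverse t) else 0)"

lemma poly_times_exp_minus_tendsto_0: "((\<lambda>u::real. poly p u * exp (- u)) \<longlongrightarrow> 0) at_top"
proof -
  have "((\<lambda>u. \<Sum>i\<le>degree p. coeff p i * (u ^ i / exp u)) \<longlongrightarrow> (\<Sum>i\<le>degree p. coeff p i * 0)) at_top"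
    by (intro tendsto_sum tendsto_mult tendsto_const tendsto_power_div_exp_0)
  then show ?thesis
    by (simp add: poly_altdef sum_distrib_right exp_minus divide_inverse mult.assoc)
qed

lemma flat_tendsto_0: "(flat p \<longlongrightarrow> 0) (at 0)"
proof (rule filterlim_split_at)
  show "(flat p \<longlongrightarrow> 0) (at_left 0)"
    by (rule tendsto_eventually) (auto simp: flat_def eventually_at_filter)
  have "((\<lambda>t. poly p (inverse t) * exp (- inverse t)) \<longlongrightarrow> 0) (at_right (0::real))"
    using poly_times_exp_minus_tendsto_0 filterlim_inverse_at_top_right by (rule filterlim_compose)
  then show "(flat p \<longlongrightarrow> 0) (at_right 0)"
    by (rule Lim_transform_eventually) (auto simp: flat_def eventually_at_filter)
qed

text \<open>For positive \<open>t\<close> the chain rule turns \<open>p\<close> into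
  \<open>X^2 (p - p')\<close>. At 0 the difference quotient is the member of the family for
  \<open>X p\<close>, which tends to 0.\<close>

lemma flat_has_derivative: "(flat p has_real_derivative flat ([:0, 0, 1:] * (p - pderiv p)) t) (at t)"
proof -
  consider "t > 0" | "t < 0" | "t = 0" by linarith
  then show ?thesis
  proof cases
    case 1
    have "((\<lambda>t. poly p (inverse t) * exp (- inverse t)) has_real_derivative flat ([:0, 0, 1:] * (p - pderiv p)) t) (at t)"
      using 1 by (auto intro!: derivative_eq_intros poly_DERIV[THEN DERIV_chain2]
          simp: flat_def power2_eq_square field_simps)
    then show ?thesis
      by (rule has_field_derivative_transform_within_open[where S = "{0<..}"]) (use 1 in \<open>auto simp: flat_def\<close>)
  next
    case 2
    have "((\<lambda>t. 0) has_real_derivative flat ([:0, 0, 1:] * (p - pderiv p)) t) (at t)"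
      using 2 by (simp add: flat_def)
    then show ?thesis
      by (rule has_field_derivative_transform_within_open[where S = "{..<0}"]) (use 2 in \<open>auto simp: flat_def\<close>)
  next
    case 3
    have "(\<lambda>h. (flat p (0 + h) - flat p 0) / h) = flat (pCons 0 p)"
      by (auto simp: flat_def fun_eq_iff field_simps)
    then show ?thesis using flat_tendsto_0[of "pCons 0 p"] 3 by (simp add: DERIV_def flat_def)
  qed
qed

text \<open>Leaving \<open>p\<close> arbitrary closes the induction on \<open>k\<close>: a
  derivative is another member of the family times a smooth factor.\<close>

lemma Ck_flat:
  assumes "\<And>k. Ck k q"
  shows "Ck k (\<lambda>x. flat p (q x))"
proof (induction k arbitrary: p)
  case 0
  have "continuous_on UNIV (flat p)"
    using flat_has_derivative by (meson DERIV_isCont continuous_at_imp_continuous_on)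
  then show ?case using assms[of 0] by (auto intro: continuous_on_compose2)
next
  case (Suc k)
  let ?p = "[:0, 0, 1:] * (p - pderiv p)"
  show ?case
  proof (rule Ck_SucI[where G = "\<lambda>x. flat ?p (q x) *\<^sub>R grad q x"])
    show "((\<lambda>x. flat p (q x)) has_derivative (\<lambda>h. (flat ?p (q x) *\<^sub>R grad q x) \<bullet> h)) (at x)" for x
      using has_derivative_compose[OF Ck_SucD(1)[OF assms[of "Suc 0"]], of "flat p"]
        flat_has_derivative[of p "q x"] by (simp add: has_field_derivative_def)
    show "Ck k (\<lambda>x. (flat ?p (q x) *\<^sub>R grad q x) $ i)" for i
      using Ck_mult[OF Suc.IH[of ?p] Ck_SucD(2)[OF assms[of "Suc k"]]] by simp
  qed
qed

text \<open>The functions multiply \<open>flat 1\<close> at the distances to the faces of the box,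
  magnified by \<open>Suc m\<close>. Since \<open>exp (- 1 / (m t))\<close> tends to 1, the
  magnification alone sharpens the bump to the indicator. The supports lie in the closed box, which
  is why that box must be inside \<open>\<Omega>\<close>.\<close>

lemma box_indicator_approx:
  fixes a b :: "real^'n"
  assumes "cbox a b \<subseteq> \<Omega>"
  obtains \<phi> :: "nat \<Rightarrow> real^'n \<Rightarrow> real"
  where "\<And>m. \<phi> m \<in> test_functions \<Omega>" "\<And>m x. \<bar>\<phi> m x\<bar> \<le> 1"
    "\<And>x. (\<lambda>m. \<phi> m x) \<longlonglongrightarrow> indicator (box a b) x"
proof
  define \<rho> where "\<rho> = flat 1"
  have \<rho>: "\<rho> t = (if t > 0 then exp (- inverse t) else 0)" for t by (simp add: \<rho>_def flat_def)
  have \<rho>01: "0 \<le> \<rho> t" "\<rho> t \<le> 1" for t by (auto simp: \<rho>)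
  have lim: "(\<lambda>m. \<rho> (real (Suc m) * t)) \<longlonglongrightarrow> 1" if "t > 0" for t
  proof -
    have "(\<lambda>m. exp (- (inverse (real (Suc m)) * inverse t))) \<longlonglongrightarrow> exp (- (0 * inverse t))"
      by (intro tendsto_intros LIMSEQ_inverse_real_of_nat)
    then show ?thesis using that by (simp add: \<rho>)
  qed
  define \<phi> :: "nat \<Rightarrow> real^'n \<Rightarrow> real" where "\<phi> m x = (\<Prod>i\<in>UNIV. \<rho> (real (Suc m) * (x $ i - a $ i)) * \<rho> (real (Suc m) * (b $ i - x $ i)))" for m x
  have zero: "\<phi> m x = 0" if "x \<notin> box a b" for m x
  proof -
    have "\<exists>i. \<not> (a $ i < x $ i \<and> x $ i < b $ i)" using that by (auto simp: mem_box_cart)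
    then obtain i where "\<not> (a $ i < x $ i \<and> x $ i < b $ i)" by blast
    then have "\<rho> (real (Suc m) * (x $ i - a $ i)) * \<rho> (real (Suc m) * (b $ i - x $ i)) = 0"
      by (auto simp: \<rho> zero_less_mult_iff)
    then show ?thesis unfolding \<phi>_def by (intro prod_zero) auto
  qed
  show "\<phi> m \<in> test_functions \<Omega>" for m
  proof -
    have sub: "closure {x. \<phi> m x \<noteq> 0} \<subseteq> cbox a b"
      using zero[of _ m] box_subset_cbox by (intro closure_minimal closed_cbox) blast
    have "Ck k (\<lambda>x. \<rho> (real (Suc m) * (x $ i - a $ i)))" "Ck k (\<lambda>x. \<rho> (real (Suc m) * (b $ i - x $ i)))" for k i
      using Ck_flat[of "\<lambda>x. real (Suc m) * x $ i + (- real (Suc m) * a $ i)" k 1, OF Ck_coordinate]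
        Ck_flat[of "\<lambda>x. (- real (Suc m)) * x $ i + real (Suc m) * b $ i" k 1, OF Ck_coordinate]
      by (simp_all add: \<rho>_def algebra_simps)
    then have "Ck k (\<phi> m)" for k unfolding \<phi>_def by (intro Ck_prod Ck_mult) auto
    moreover have "compact (closure {x. \<phi> m x \<noteq> 0})"
      using compact_Int_closed[OF compact_cbox closed_closure, of a b "{x. \<phi> m x \<noteq> 0}"] sub by (simp add: Int_absorb1)
    ultimately show ?thesis using sub assms by (auto simp: test_functions_def)
  qed
  show "\<bar>\<phi> m x\<bar> \<le> 1" for m x
    unfolding \<phi>_def abs_prod by (rule prod_le_1) (auto simp: abs_mult \<rho>01 intro!: mult_le_one)
  show "(\<lambda>m. \<phi> m x) \<longlonglongrightarrow> indicator (box a b) x" for x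
  proof (cases "x \<in> box a b")
    case True
    have "(\<lambda>m. \<phi> m x) \<longlonglongrightarrow> (\<Prod>i\<in>(UNIV::'n set). 1 * 1)"
      unfolding \<phi>_def by (intro tendsto_prod tendsto_mult lim) (use True in \<open>auto simp: mem_box_cart\<close>)
    then show ?thesis using True by simp
  qed (simp add: zero)
qed

text \<open>The positive and negative parts of \<open>h\<close> are densities of two measures that
  agree on boxes, an intersection-stable generator of the Borel sets.\<close>

lemma zero_AE_if_box_integrals_zero:
  fixes h :: "real^'n \<Rightarrow> real"
  assumes h: "integrable lborel h" and box: "\<And>a b. (\<integral>x. indicator (box a b) x * h x \<partial>lborel) = 0"
  shows "AE x in lborel. h x = 0"
proof -
  have [measurable]: "h \<in> borel_measurable borel" using h by (simp add: borel_measurable_integrable)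
  let ?P = "density lborel (\<lambda>x. ennreal (h x))" and ?N = "density lborel (\<lambda>x. ennreal (- h x))"
  let ?E = "range (\<lambda>(a, b). box a b :: (real^'n) set)"
  have fin: "(\<integral>\<^sup>+x. ennreal (h x) * indicator A x \<partial>lborel) < \<infinity>" "(\<integral>\<^sup>+x. ennreal (- h x) * indicator A x \<partial>lborel) < \<infinity>"
    if [measurable]: "A \<in> sets borel" for A
  proof -
    have "(\<integral>\<^sup>+x. ennreal (h x) * indicator A x \<partial>lborel) \<le> (\<integral>\<^sup>+x. ennreal (h x) \<partial>lborel)"
      "(\<integral>\<^sup>+x. ennreal (- h x) * indicator A x \<partial>lborel) \<le> (\<integral>\<^sup>+x. ennreal (- h x) \<partial>lborel)"
      by (intro nn_integral_mono; simp add: indicator_def)+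
    then show "(\<integral>\<^sup>+x. ennreal (h x) * indicator A x \<partial>lborel) < \<infinity>" "(\<integral>\<^sup>+x. ennreal (- h x) * indicator A x \<partial>lborel) < \<infinity>"
      using h by (auto simp: real_integrable_def less_top[symmetric] top_unique)
  qed
  have "?P = ?N"
  proof (rule measure_eqI_generator_eq)
    show "Int_stable ?E"
      by (auto simp: Int_stable_def box_Int_box intro!: image_eqI)
    fix X assume "X \<in> ?E"
    then obtain a b where X: "X = box a b" by auto
    let ?p = "\<integral>\<^sup>+x. ennreal (h x) * indicator X x \<partial>lborel" and ?n = "\<integral>\<^sup>+x. ennreal (- h x) * indicator X x \<partial>lborel"
    have int: "integrable lborel (\<lambda>x. indicator X x * h x)"
      using integrable_real_mult_indicator[of X lborel h] h X by (simp add: mult.commute)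
    have eq: "(\<integral>\<^sup>+x. ennreal (indicator X x * h x) \<partial>lborel) = ?p" "(\<integral>\<^sup>+x. ennreal (- (indicator X x * h x)) \<partial>lborel) = ?n"
      by (intro nn_integral_cong; simp add: indicator_def)+
    have "enn2real ?p = enn2real ?n"
      using box[of a b] real_lebesgue_integral_def[OF int] unfolding X[symmetric] eq by simp
    moreover have "?p < \<infinity>" "?n < \<infinity>" using fin X by auto
    ultimately have "?p = ?n" by (metis ennreal_enn2real infinity_ennreal_def)
    then show "emeasure ?P X = emeasure ?N X" using X by (simp add: emeasure_density)
  next
    show "sets ?P = sigma_sets UNIV ?E" "sets ?N = sigma_sets UNIV ?E"
      by (simp_all add: borel_eq_box)
    show "range (\<lambda>i::nat. box (- (real i *\<^sub>R One)) (real i *\<^sub>R One)) \<subseteq> ?E" by auto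
    show "(\<Union>i::nat. box (- (real i *\<^sub>R One)) (real i *\<^sub>R One)) = (UNIV :: (real^'n) set)"
      by (rule UN_box_eq_UNIV)
    show "emeasure ?P (box (- (real i *\<^sub>R One)) (real i *\<^sub>R One)) \<noteq> \<infinity>" for i :: nat
      using fin(1)[of "box (- (real i *\<^sub>R One)) (real i *\<^sub>R One)"] by (simp add: emeasure_density)
  qed auto
  \<comment> \<open>\<open>ennreal\<close> truncates at 0, so equality of the two truncations leaves
    only \<open>h x = 0\<close>.\<close>
  then have "AE x in lborel. ennreal (h x) = ennreal (- h x)"
    by (subst (asm) sigma_finite_measure.density_unique_iff[OF sigma_finite_lborel]) auto
  then show ?thesis
  proof eventually_elim
    case (elim x)
    then show ?case
      by (metis ennreal_eq_0_iff ennreal_inj le_minus_iff neg_0_le_iff_le nle_le minus_equation_iff neg_equal_zero)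
  qed
qed

lemma finite_measure_lebesgue_on_bounded:
  "open S \<Longrightarrow> bounded S \<Longrightarrow> finite_measure (lebesgue_on S)" for S :: "'a::euclidean_space set"
  by (intro finite_measure_lebesgue_on bounded_set_imp_lmeasurable) (auto simp: lborelD borel_open)

lemma L2_inner_const:
  fixes f :: "'a \<Rightarrow> 'b::euclidean_space"
  assumes "f \<in> L2 M"
  shows "(\<lambda>x. f x \<bullet> w) \<in> L2 M"
proof -
  note [measurable] = L2_measurable[OF assms]
  have "integrable M (\<lambda>x. (norm (f x \<bullet> w))\<^sup>2)"
  proof (rule Bochner_Integration.integrable_bound)
    show "integrable M (\<lambda>x. (norm (f x))\<^sup>2 * (norm w)\<^sup>2)"
      using L2_square_integrable[OF assms] by simp
    show "AE x in M. norm ((norm (f x \<bullet> w))\<^sup>2) \<le> norm ((norm (f x))\<^sup>2 * (norm w)\<^sup>2)"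
    proof (intro AE_I2)
      fix x
      have "\<bar>f x \<bullet> w\<bar>\<^sup>2 \<le> (norm (f x) * norm w)\<^sup>2"
        by (intro power_mono Cauchy_Schwarz_ineq2) simp
      then show "norm ((norm (f x \<bullet> w))\<^sup>2) \<le> norm ((norm (f x))\<^sup>2 * (norm w)\<^sup>2)"
        by (simp add: power_mult_distrib)
    qed
  qed measurable
  then show ?thesis by (simp add: L2_def)
qed

lemma continuous_L2_lebesgue_on:
  fixes f :: "real^'n \<Rightarrow> 'b::euclidean_space"
  assumes "continuous_on UNIV f" "open S" "bounded S"
  shows "f \<in> L2 (lebesgue_on S)"
proof -
  have "compact (f ` closure S)"
    using assms(3) by (intro compact_continuous_image continuous_on_subset[OF assms(1)]) auto
  then have "bounded (f ` closure S)" by (rule compact_imp_bounded)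
  then obtain B where "\<forall>y\<in>f ` closure S. norm y \<le> B" unfolding bounded_iff by blast
  then have B: "norm (f x) \<le> B" if "x \<in> closure S" for x using that by blast
  have "f \<in> borel_measurable (lebesgue_on S)"
    using assms(1) by (intro measurable_restrict_space1 measurable_completion) (simp add: borel_measurable_continuous_onI)
  moreover have "AE x in lebesgue_on S. norm (f x) \<le> B"
    by (intro AE_I2 B) (simp add: space_restrict_space closure_subset[THEN subsetD])
  ultimately show ?thesis
    by (intro L2_bounded[OF finite_measure_lebesgue_on_bounded[OF assms(2,3)]])
qed

lemma
  assumes "\<phi> \<in> test_functions \<Omega>"
  shows test_function_has_derivative: "(\<phi> has_derivative (\<lambda>h. grad \<phi> x \<bullet> h)) (at x)"
    and test_function_continuous: "continuous_on A \<phi>"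
    and test_function_grad_continuous: "continuous_on A (grad \<phi>)"
    and test_function_zero: "y \<notin> \<Omega> \<Longrightarrow> \<phi> y = 0"
proof -
  have ck: "Ck k \<phi>" for k using assms by (auto simp: test_functions_def)
  show "(\<phi> has_derivative (\<lambda>h. grad \<phi> x \<bullet> h)) (at x)" by (rule Ck_SucD(1)[OF ck[of "Suc 0"]])
  show "continuous_on A \<phi>" using ck[of 0] continuous_on_subset by auto
  have "continuous_on UNIV (\<lambda>x. grad \<phi> x $ i)" for i using Ck_SucD(2)[OF ck[of "Suc 0"], of i] by simp
  then have "continuous_on UNIV (\<lambda>x. \<chi> i. grad \<phi> x $ i)" by (intro continuous_on_vec_lambda) auto
  then show "continuous_on A (grad \<phi>)" using continuous_on_subset by auto
  show "y \<notin> \<Omega> \<Longrightarrow> \<phi> y = 0"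
    using assms closure_subset[of "{x. \<phi> x \<noteq> 0}"] by (auto simp: test_functions_def)
qed

lemma test_functions_lin:
  assumes "\<phi> \<in> test_functions \<Omega>" "\<psi> \<in> test_functions \<Omega>"
  shows "(\<lambda>x. \<alpha> * \<phi> x + \<beta> * \<psi> x) \<in> test_functions \<Omega>"
    and "grad (\<lambda>x. \<alpha> * \<phi> x + \<beta> * \<psi> x) x = \<alpha> *\<^sub>R grad \<phi> x + \<beta> *\<^sub>R grad \<psi> x"
proof -
  let ?A = "closure {x. \<phi> x \<noteq> 0}" and ?B = "closure {x. \<psi> x \<noteq> 0}" and ?C = "closure {x. \<alpha> * \<phi> x + \<beta> * \<psi> x \<noteq> 0}"
  have sub: "?C \<subseteq> ?A \<union> ?B"
    unfolding closure_Un[symmetric] by (intro closure_mono) auto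
  have "compact (?A \<union> ?B)" using assms by (auto simp: test_functions_def)
  then have "compact ?C"
    using compact_Int_closed[of "?A \<union> ?B" ?C] sub by (simp add: Int_absorb1)
  then show "(\<lambda>x. \<alpha> * \<phi> x + \<beta> * \<psi> x) \<in> test_functions \<Omega>"
    using assms sub by (auto simp: test_functions_def intro!: Ck_add Ck_cmult)
  show "grad (\<lambda>x. \<alpha> * \<phi> x + \<beta> * \<psi> x) x = \<alpha> *\<^sub>R grad \<phi> x + \<beta> *\<^sub>R grad \<psi> x"
    by (rule grad_eq) (auto intro!: derivative_eq_intros test_function_has_derivative[OF assms(1)]
      test_function_has_derivative[OF assms(2)] simp: inner_add_left)
qed

lemma zero_test_function: "(\<lambda>x. 0) \<in> test_functions \<Omega>"
  by (simp add: test_functions_def Ck_const)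

text \<open>The fundamental lemma of the calculus of variations. Smooth bumps and dominated
  convergence give vanishing integrals over boxes whose closure lies in \<open>\<Omega>\<close>; the
  box criterion and a countable cover by closed boxes do the rest.\<close>

theorem test_functions_separate:
  fixes \<Omega> :: "(real^'n) set" and g :: "real^'n \<Rightarrow> real"
  assumes \<Omega>: "open \<Omega>" and g: "integrable (lebesgue_on \<Omega>) g"
    and orth: "\<And>\<phi>. \<phi> \<in> test_functions \<Omega> \<Longrightarrow> (\<integral>x. \<phi> x * g x \<partial>lebesgue_on \<Omega>) = 0"
  shows "AE x in lebesgue_on \<Omega>. g x = 0"
proof -
  have \<Omega>s: "\<Omega> \<inter> space lebesgue \<in> sets lebesgue" using \<Omega> by (simp add: borel_open lborelD)
  have gi: "integrable lebesgue (\<lambda>x. indicator \<Omega> x * g x)"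
    using g integrable_restrict_space[OF \<Omega>s, of g] by simp
  have box0: "(\<integral>x. indicator (box a b) x * g x \<partial>lebesgue_on \<Omega>) = 0" if ab: "cbox a b \<subseteq> \<Omega>" for a b
  proof -
    obtain \<phi> :: "nat \<Rightarrow> real^'n \<Rightarrow> real" where \<phi>: "\<And>m. \<phi> m \<in> test_functions \<Omega>" "\<And>m x. \<bar>\<phi> m x\<bar> \<le> 1"
      "\<And>x. (\<lambda>m. \<phi> m x) \<longlonglongrightarrow> indicator (box a b) x"
      using box_indicator_approx[OF ab] by blast
    have [measurable]: "\<phi> m \<in> borel_measurable (lebesgue_on \<Omega>)" for m
      using test_function_continuous[OF \<phi>(1), of UNIV]
      by (intro measurable_restrict_space1 measurable_completion) (simp add: borel_measurable_continuous_onI)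
    have [measurable]: "g \<in> borel_measurable (lebesgue_on \<Omega>)" using g by simp
    have [measurable]: "indicator (box a b) \<in> borel_measurable (lebesgue_on \<Omega>)"
      by (intro measurable_restrict_space1 measurable_completion) simp
    have "(\<lambda>m. \<integral>x. \<phi> m x * g x \<partial>lebesgue_on \<Omega>) \<longlonglongrightarrow> (\<integral>x. indicator (box a b) x * g x \<partial>lebesgue_on \<Omega>)"
    proof (rule integral_dominated_convergence)
      show "integrable (lebesgue_on \<Omega>) (\<lambda>x. \<bar>g x\<bar>)" using g by simp
      show "AE x in lebesgue_on \<Omega>. (\<lambda>m. \<phi> m x * g x) \<longlonglongrightarrow> indicator (box a b) x * g x"
        by (intro AE_I2 tendsto_intros \<phi>(3))
      show "AE x in lebesgue_on \<Omega>. norm (\<phi> m x * g x) \<le> \<bar>g x\<bar>" for m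
        using \<phi>(2) by (intro AE_I2) (simp add: abs_mult mult_left_le_one_le)
    qed measurable
    then have "(\<lambda>m. 0) \<longlonglongrightarrow> (\<integral>x. indicator (box a b) x * g x \<partial>lebesgue_on \<Omega>)"
      unfolding orth[OF \<phi>(1)] .
    then show ?thesis by (simp add: LIMSEQ_const_iff)
  qed
  \<comment> \<open>Only boxes inside \<open>\<Omega>\<close> are under control. Cutting
    \<open>g\<close> off outside one closed box turns the integral over an arbitrary box into one
    over an intersection, which is again such a box.\<close>
  have cbox: "AE x in lebesgue. x \<in> cbox p q \<longrightarrow> g x = 0" if pq: "cbox p q \<subseteq> \<Omega>" for p q
  proof -
    let ?h = "\<lambda>x. indicator (cbox p q) x * g x"
    have heq: "?h = (\<lambda>x. indicator (cbox p q) x *\<^sub>R (indicator \<Omega> x * g x))"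
      using pq by (auto simp: indicator_def fun_eq_iff)
    have hi: "integrable lebesgue ?h"
      unfolding heq by (rule integrable_mult_indicator[OF _ gi]) simp
    \<comment> \<open>The box criterion is about Borel functions, so \<open>?h\<close> is replaced
      by a Borel version.\<close>
    obtain h where h: "h \<in> borel_measurable lborel" "AE x in lborel. ?h x = h x"
      using completion_ex_borel_measurable_real[of ?h lborel] hi by (auto simp: borel_measurable_integrable)
    have h_ae: "AE x in lebesgue. ?h x = h x" using h(2) by (rule AE_completion)
    have [measurable]: "h \<in> borel_measurable borel" "h \<in> borel_measurable lebesgue"
      using h(1) measurable_completion[OF h(1)] by simp_all
    have "integrable lebesgue h"
      using hi h_ae by (subst integrable_cong_AE[of h lebesgue ?h]) (auto simp: borel_measurable_integrable elim: eventually_mono)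
    then have "integrable lborel h" by (subst (asm) integrable_completion) simp_all
    moreover have "(\<integral>x. indicator (box a b) x * h x \<partial>lborel) = 0" for a b
    proof -
      let ?c = "\<Sum>i\<in>Basis. max (a \<bullet> i) (p \<bullet> i) *\<^sub>R i" and ?d = "\<Sum>i\<in>Basis. min (b \<bullet> i) (q \<bullet> i) *\<^sub>R i"
      have cd: "box a b \<inter> box p q = box ?c ?d" by (rule box_Int_box)
      have "cbox ?c ?d = cbox a b \<inter> cbox p q" by (rule Int_interval[symmetric])
      then have cd': "cbox ?c ?d \<subseteq> \<Omega>" using pq by auto
      have "(\<integral>x. indicator (box a b) x * h x \<partial>lborel) = (\<integral>x. indicator (box a b) x * h x \<partial>lebesgue)"
        by (rule integral_completion[symmetric]) measurable
      also have "\<dots> = (\<integral>x. indicator (box ?c ?d) x * (indicator \<Omega> x * g x) \<partial>lebesgue)"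
      proof (rule integral_cong_AE)
        \<comment> \<open>The closed box serves for the cutoff, the open one for the test functions;
          they differ by a null set.\<close>
        have "cbox p q - box p q \<in> null_sets lebesgue"
          using negligible_frontier_interval[of p q] by (simp add: negligible_iff_null_sets)
        note AE_not_in[OF this]
        with h_ae show "AE x in lebesgue. indicator (box a b) x * h x = indicator (box ?c ?d) x * (indicator \<Omega> x * g x)"
        proof eventually_elim
          case (elim x)
          then show ?case
            using pq box_subset_cbox[of p q] unfolding cd[symmetric] elim(1)[symmetric] by (auto simp: indicator_def)
        qed
        show "(\<lambda>x. indicator (box a b) x * h x) \<in> borel_measurable lebesgue"
          by (intro borel_measurable_times borel_measurable_indicator measurable_completion[OF h(1)]) simp
        show "(\<lambda>x. indicator (box ?c ?d) x * (indicator \<Omega> x * g x)) \<in> borel_measurable lebesgue"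
          by (intro borel_measurable_times borel_measurable_integrable[OF gi] borel_measurable_indicator) simp
      qed
      also have "\<dots> = (\<integral>x. indicator \<Omega> x *\<^sub>R (indicator (box ?c ?d) x * g x) \<partial>lebesgue)"
        by (intro Bochner_Integration.integral_cong) auto
      also have "\<dots> = (\<integral>x. indicator (box ?c ?d) x * g x \<partial>lebesgue_on \<Omega>)"
        by (rule integral_restrict_space[OF \<Omega>s, symmetric])
      also have "\<dots> = 0" by (rule box0[OF cd'])
      finally show ?thesis .
    qed
    ultimately have "AE x in lborel. h x = 0" by (rule zero_AE_if_box_integrals_zero)
    then have "AE x in lebesgue. h x = 0" by (rule AE_completion)
    with h_ae show ?thesis by eventually_elim (auto simp: indicator_def)
  qed
  obtain D where D: "countable D" "D \<subseteq> Pow \<Omega>" "\<And>X. X \<in> D \<Longrightarrow> \<exists>a b. X = cbox a b" "\<Union>D = \<Omega>"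
    using open_countable_Union_open_cbox[OF \<Omega>] by metis
  have "AE x in lebesgue. x \<in> X \<longrightarrow> g x = 0" if "X \<in> D" for X
    using D(2) D(3)[OF that] that cbox by blast
  then have "AE x in lebesgue. \<forall>X\<in>D. x \<in> X \<longrightarrow> g x = 0"
    using D(1) by (subst AE_ball_countable) auto
  then have "AE x in lebesgue. x \<in> \<Omega> \<longrightarrow> g x = 0"
    by eventually_elim (use D(4) in auto)
  then show ?thesis using \<Omega>s by (subst AE_restrict_space_iff) auto
qed

section \<open>Weak gradients and the linear structure of \<open>H10\<close>\<close>

context
  fixes \<Omega> :: "(real^'n) set"
  assumes open_\<Omega>: "open \<Omega>" and bounded_\<Omega>: "bounded \<Omega>"
begin

lemma test_function_L2: "\<phi> \<in> test_functions \<Omega>' \<Longrightarrow> \<phi> \<in> L2 (lebesgue_on \<Omega>)"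
  by (intro continuous_L2_lebesgue_on test_function_continuous open_\<Omega> bounded_\<Omega>)

lemma test_function_grad_L2: "\<phi> \<in> test_functions \<Omega>' \<Longrightarrow> grad \<phi> \<in> L2 (lebesgue_on \<Omega>)"
  by (intro continuous_L2_lebesgue_on test_function_grad_continuous open_\<Omega> bounded_\<Omega>)

text \<open>Two candidates have the same integrals against test functions, so each component of
  their difference is annihilated. This frees later arguments from the choice made in
  \<open>weak_grad\<close>.\<close>

lemma weak_grad_unique:
  assumes "is_weak_grad \<Omega> v g" "is_weak_grad \<Omega> v g'"
  shows "AE x in lebesgue_on \<Omega>. g x = g' x"
proof -
  let ?M = "lebesgue_on \<Omega>"
  have L: "g \<in> L2 ?M" "g' \<in> L2 ?M" using assms by (auto simp: is_weak_grad_def)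
  note dL = L2_diff[OF L]
  have fin: "finite_measure ?M" by (rule finite_measure_lebesgue_on_bounded[OF open_\<Omega> bounded_\<Omega>])
  have "AE x in ?M. (g x - g' x) \<bullet> axis i 1 = 0" for i
  proof (rule test_functions_separate[OF open_\<Omega>])
    show "integrable ?M (\<lambda>x. (g x - g' x) \<bullet> axis i 1)"
      by (intro L2_integrable[OF fin] L2_inner_const dL)
    fix \<phi> assume \<phi>: "\<phi> \<in> test_functions \<Omega>"
    note \<phi>L = test_function_L2[OF \<phi>]
    have "(\<integral>x. \<phi> x *\<^sub>R g x \<partial>?M) = (\<integral>x. \<phi> x *\<^sub>R g' x \<partial>?M)"
      using assms \<phi> by (simp add: is_weak_grad_def)
    then have "(\<integral>x. \<phi> x *\<^sub>R (g x - g' x) \<partial>?M) = 0"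
      using L2_scaleR_integrable[OF \<phi>L L(1)] L2_scaleR_integrable[OF \<phi>L L(2)] by (simp add: scaleR_diff_right)
    then have "(\<integral>x. (\<phi> x *\<^sub>R (g x - g' x)) \<bullet> axis i 1 \<partial>?M) = 0"
      using L2_scaleR_integrable[OF \<phi>L dL] by (subst integral_inner_left) auto
    then show "(\<integral>x. \<phi> x * ((g x - g' x) \<bullet> axis i 1) \<partial>?M) = 0" by simp
  qed
  then have "AE x in ?M. \<forall>i\<in>UNIV. (g x - g' x) \<bullet> axis i 1 = 0"
    by (subst AE_ball_countable) auto
  then show ?thesis
    by eventually_elim (simp add: inner_axis vec_eq_iff)
qed

lemma is_weak_grad_weak_grad: "v \<in> H1 \<Omega> \<Longrightarrow> is_weak_grad \<Omega> v (weak_grad \<Omega> v)"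
  unfolding weak_grad_def using someI_ex[of "is_weak_grad \<Omega> v"] by (auto simp: H1_def)

lemma H10_H1: "v \<in> H10 \<Omega> \<Longrightarrow> v \<in> H1 \<Omega>"
  by (simp add: H10_def)

lemma H10_L2: "v \<in> H10 \<Omega> \<Longrightarrow> v \<in> L2 (lebesgue_on \<Omega>)"
  by (simp add: H10_def H1_def)

lemma weak_grad_L2: "v \<in> H10 \<Omega> \<Longrightarrow> weak_grad \<Omega> v \<in> L2 (lebesgue_on \<Omega>)"
  using is_weak_grad_weak_grad[OF H10_H1] by (simp add: is_weak_grad_def)

lemma is_weak_grad_lin:
  assumes "u \<in> L2 (lebesgue_on \<Omega>)" "v \<in> L2 (lebesgue_on \<Omega>)" "is_weak_grad \<Omega> u g" "is_weak_grad \<Omega> v g'"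
  shows "is_weak_grad \<Omega> (\<lambda>x. \<alpha> * u x + \<beta> * v x) (\<lambda>x. \<alpha> *\<^sub>R g x + \<beta> *\<^sub>R g' x)"
  unfolding is_weak_grad_def
proof (intro conjI ballI)
  let ?M = "lebesgue_on \<Omega>"
  have L: "g \<in> L2 ?M" "g' \<in> L2 ?M" using assms(3,4) by (auto simp: is_weak_grad_def)
  then show "(\<lambda>x. \<alpha> *\<^sub>R g x + \<beta> *\<^sub>R g' x) \<in> L2 ?M" by (intro L2_add L2_scaleR)
  fix \<phi> assume \<phi>: "\<phi> \<in> test_functions \<Omega>"
  note \<phi>L = test_function_L2[OF \<phi>] and gL = test_function_grad_L2[OF \<phi>]
  have "(\<integral>x. (\<alpha> * u x + \<beta> * v x) *\<^sub>R grad \<phi> x \<partial>?M) = \<alpha> *\<^sub>R (\<integral>x. u x *\<^sub>R grad \<phi> x \<partial>?M) + \<beta> *\<^sub>R (\<integral>x. v x *\<^sub>R grad \<phi> x \<partial>?M)"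
    using L2_scaleR_integrable[OF assms(1) gL] L2_scaleR_integrable[OF assms(2) gL]
    by (simp add: scaleR_left_distrib scaleR_scaleR[symmetric] del: scaleR_scaleR)
  also have "\<dots> = - (\<alpha> *\<^sub>R (\<integral>x. \<phi> x *\<^sub>R g x \<partial>?M) + \<beta> *\<^sub>R (\<integral>x. \<phi> x *\<^sub>R g' x \<partial>?M))"
    using assms(3,4) \<phi> by (simp add: is_weak_grad_def)
  also have "\<alpha> *\<^sub>R (\<integral>x. \<phi> x *\<^sub>R g x \<partial>?M) + \<beta> *\<^sub>R (\<integral>x. \<phi> x *\<^sub>R g' x \<partial>?M) = (\<integral>x. \<phi> x *\<^sub>R (\<alpha> *\<^sub>R g x + \<beta> *\<^sub>R g' x) \<partial>?M)"
  proof -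
    have "(\<lambda>x. \<phi> x *\<^sub>R (\<alpha> *\<^sub>R g x + \<beta> *\<^sub>R g' x)) = (\<lambda>x. \<alpha> *\<^sub>R (\<phi> x *\<^sub>R g x) + \<beta> *\<^sub>R (\<phi> x *\<^sub>R g' x))"
      by (auto simp: scaleR_right_distrib mult.commute)
    then show ?thesis
      using L2_scaleR_integrable[OF \<phi>L L(1)] L2_scaleR_integrable[OF \<phi>L L(2)] by (simp del: scaleR_scaleR)
  qed
  finally show "(\<integral>x. (\<alpha> * u x + \<beta> * v x) *\<^sub>R grad \<phi> x \<partial>?M) = - (\<integral>x. \<phi> x *\<^sub>R (\<alpha> *\<^sub>R g x + \<beta> *\<^sub>R g' x) \<partial>?M)" .
qed

text \<open>The choices made for \<open>u\<close>, \<open>v\<close> and their combination are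
  unrelated; uniqueness is what links them, hence equality almost everywhere.\<close>

lemma weak_grad_lin:
  assumes "u \<in> H10 \<Omega>" "v \<in> H10 \<Omega>"
  shows "AE x in lebesgue_on \<Omega>. weak_grad \<Omega> (\<lambda>x. \<alpha> * u x + \<beta> * v x) x = \<alpha> *\<^sub>R weak_grad \<Omega> u x + \<beta> *\<^sub>R weak_grad \<Omega> v x"
proof -
  have *: "is_weak_grad \<Omega> (\<lambda>x. \<alpha> * u x + \<beta> * v x) (\<lambda>x. \<alpha> *\<^sub>R weak_grad \<Omega> u x + \<beta> *\<^sub>R weak_grad \<Omega> v x)"
    using assms by (intro is_weak_grad_lin H10_L2 is_weak_grad_weak_grad H10_H1)
  then have "is_weak_grad \<Omega> (\<lambda>x. \<alpha> * u x + \<beta> * v x) (weak_grad \<Omega> (\<lambda>x. \<alpha> * u x + \<beta> * v x))"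
    unfolding weak_grad_def[of \<Omega> "\<lambda>x. \<alpha> * u x + \<beta> * v x"] by (rule someI[of "is_weak_grad \<Omega> (\<lambda>x. \<alpha> * u x + \<beta> * v x)"])
  then show ?thesis using * by (rule weak_grad_unique)
qed

lemma H10_lin:
  assumes u: "u \<in> H10 \<Omega>" and v: "v \<in> H10 \<Omega>"
  shows "(\<lambda>x. \<alpha> * u x + \<beta> * v x) \<in> H10 \<Omega>"
proof -
  let ?M = "lebesgue_on \<Omega>" and ?w = "\<lambda>x. \<alpha> * u x + \<beta> * v x"
  have "?w \<in> L2 ?M" using H10_L2[OF u] H10_L2[OF v] by (intro L2_add L2_cmult)
  moreover have "is_weak_grad \<Omega> ?w (\<lambda>x. \<alpha> *\<^sub>R weak_grad \<Omega> u x + \<beta> *\<^sub>R weak_grad \<Omega> v x)"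
    using u v by (intro is_weak_grad_lin H10_L2 is_weak_grad_weak_grad H10_H1)
  ultimately have wH: "?w \<in> H1 \<Omega>" by (auto simp: H1_def)
  then have wgL: "weak_grad \<Omega> ?w \<in> L2 ?M" using is_weak_grad_weak_grad by (auto simp: is_weak_grad_def)
  obtain \<phi> \<psi> where \<phi>: "test_approx \<Omega> \<phi> u" and \<psi>: "test_approx \<Omega> \<psi> v" using u v by (auto simp: H10_def)
  have t: "\<phi> m \<in> test_functions \<Omega>" "\<psi> m \<in> test_functions \<Omega>" for m using \<phi> \<psi> by (auto simp: test_approx_def)
  have tL: "(\<lambda>x. \<phi> m x - u x) \<in> L2 ?M" "(\<lambda>x. \<psi> m x - v x) \<in> L2 ?M"
    "(\<lambda>x. grad (\<phi> m) x - weak_grad \<Omega> u x) \<in> L2 ?M" "(\<lambda>x. grad (\<psi> m) x - weak_grad \<Omega> v x) \<in> L2 ?M" for m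
    by (intro L2_diff test_function_L2[OF t(1)] test_function_L2[OF t(2)] test_function_grad_L2[OF t(1)]
      test_function_grad_L2[OF t(2)] H10_L2[OF u] H10_L2[OF v] weak_grad_L2[OF u] weak_grad_L2[OF v])+
  let ?\<chi> = "\<lambda>m x. \<alpha> * \<phi> m x + \<beta> * \<psi> m x"
  have bound: "L2_norm ?M (\<lambda>x. \<alpha> *\<^sub>R f x + \<beta> *\<^sub>R f' x) \<le> \<bar>\<alpha>\<bar> * L2_norm ?M f + \<bar>\<beta>\<bar> * L2_norm ?M f'"
    if "f \<in> L2 ?M" "f' \<in> L2 ?M" for f f' :: "real^'n \<Rightarrow> 'b::euclidean_space"
    using L2_norm_triangle[OF L2_scaleR[OF that(1), of \<alpha>] L2_scaleR[OF that(2), of \<beta>]] by (simp add: L2_norm_scaleR)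
  have "test_approx \<Omega> ?\<chi> ?w"
    unfolding test_approx_def
  proof (intro conjI allI)
    show "?\<chi> m \<in> test_functions \<Omega>" for m using t by (rule test_functions_lin)
    have lim0: "(\<lambda>m. \<bar>\<alpha>\<bar> * f m + \<bar>\<beta>\<bar> * f' m) \<longlonglongrightarrow> 0" if "f \<longlonglongrightarrow> 0" "f' \<longlonglongrightarrow> 0" for f f' :: "nat \<Rightarrow> real"
      using tendsto_add[OF tendsto_mult_left[OF that(1), of "\<bar>\<alpha>\<bar>"] tendsto_mult_left[OF that(2), of "\<bar>\<beta>\<bar>"]] by simp
    show "(\<lambda>m. L2_norm ?M (\<lambda>x. ?\<chi> m x - ?w x)) \<longlonglongrightarrow> 0"
    proof (rule Lim_null_comparison[OF always_eventually lim0], rule allI)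
      show "(\<lambda>m. L2_norm ?M (\<lambda>x. \<phi> m x - u x)) \<longlonglongrightarrow> 0" "(\<lambda>m. L2_norm ?M (\<lambda>x. \<psi> m x - v x)) \<longlonglongrightarrow> 0"
        using \<phi> \<psi> by (auto simp: test_approx_def)
      fix m
      have "(\<lambda>x. ?\<chi> m x - ?w x) = (\<lambda>x. \<alpha> *\<^sub>R (\<phi> m x - u x) + \<beta> *\<^sub>R (\<psi> m x - v x))"
        by (auto simp: algebra_simps)
      then show "norm (L2_norm ?M (\<lambda>x. ?\<chi> m x - ?w x)) \<le> \<bar>\<alpha>\<bar> * L2_norm ?M (\<lambda>x. \<phi> m x - u x) + \<bar>\<beta>\<bar> * L2_norm ?M (\<lambda>x. \<psi> m x - v x)"
        using bound[OF tL(1,2), of m m] by (simp only: real_norm_def abs_of_nonneg[OF L2_norm_nonneg])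
    qed
    show "(\<lambda>m. L2_norm ?M (\<lambda>x. grad (?\<chi> m) x - weak_grad \<Omega> ?w x)) \<longlonglongrightarrow> 0"
    proof (rule Lim_null_comparison[OF always_eventually lim0], rule allI)
      show "(\<lambda>m. L2_norm ?M (\<lambda>x. grad (\<phi> m) x - weak_grad \<Omega> u x)) \<longlonglongrightarrow> 0" "(\<lambda>m. L2_norm ?M (\<lambda>x. grad (\<psi> m) x - weak_grad \<Omega> v x)) \<longlonglongrightarrow> 0"
        using \<phi> \<psi> by (auto simp: test_approx_def)
      fix m
      have gL: "grad (?\<chi> m) \<in> L2 ?M" by (rule test_function_grad_L2[OF test_functions_lin(1)[OF t]])
      have "L2_norm ?M (\<lambda>x. grad (?\<chi> m) x - weak_grad \<Omega> ?w x)
        = L2_norm ?M (\<lambda>x. \<alpha> *\<^sub>R (grad (\<phi> m) x - weak_grad \<Omega> u x) + \<beta> *\<^sub>R (grad (\<psi> m) x - weak_grad \<Omega> v x))"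
      \<comment> \<open>The norm ignores null sets, so the weak gradient of the combination may be
        exchanged for the combination of the weak gradients.\<close>
      proof (rule L2_norm_cong_AE)
        show "AE x in ?M. grad (?\<chi> m) x - weak_grad \<Omega> ?w x
          = \<alpha> *\<^sub>R (grad (\<phi> m) x - weak_grad \<Omega> u x) + \<beta> *\<^sub>R (grad (\<psi> m) x - weak_grad \<Omega> v x)"
          using weak_grad_lin[OF u v, of \<alpha> \<beta>]
          by eventually_elim (simp add: test_functions_lin(2)[OF t] scaleR_diff_right)
      qed (intro L2_measurable L2_diff L2_add L2_scaleR gL wgL tL)+
      then show "norm (L2_norm ?M (\<lambda>x. grad (?\<chi> m) x - weak_grad \<Omega> ?w x))
        \<le> \<bar>\<alpha>\<bar> * L2_norm ?M (\<lambda>x. grad (\<phi> m) x - weak_grad \<Omega> u x) + \<bar>\<beta>\<bar> * L2_norm ?M (\<lambda>x. grad (\<psi> m) x - weak_grad \<Omega> v x)"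
        using bound[OF tL(3,4), of m m] by (simp only: real_norm_def abs_of_nonneg[OF L2_norm_nonneg])
    qed
  qed
  then show ?thesis using wH by (auto simp: H10_def)
qed

text \<open>Even for the zero function \<open>weak_grad\<close> is a chosen representative, known to
  vanish only almost everywhere.\<close>

lemma H10_zero: "(\<lambda>x. 0) \<in> H10 \<Omega>"
proof -
  let ?M = "lebesgue_on \<Omega>"
  have z: "is_weak_grad \<Omega> (\<lambda>x. 0) (\<lambda>x. 0)" by (simp add: is_weak_grad_def L2_def)
  then have H: "(\<lambda>x. 0) \<in> H1 \<Omega>" by (auto simp: H1_def L2_def)
  have g0: "grad (\<lambda>x::real^'n. 0) = (\<lambda>x. 0)" by (auto intro!: grad_eq)
  have "weak_grad \<Omega> (\<lambda>x. 0) \<in> L2 ?M" using is_weak_grad_weak_grad[OF H] by (simp add: is_weak_grad_def)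
  then have "L2_norm ?M (\<lambda>x. grad (\<lambda>x. 0) x - weak_grad \<Omega> (\<lambda>x. 0) x) = L2_norm ?M (\<lambda>x. 0 :: real^'n)"
    using weak_grad_unique[OF z is_weak_grad_weak_grad[OF H]]
    by (intro L2_norm_cong_AE) (auto simp: g0 L2_measurable elim: eventually_mono)
  then have "test_approx \<Omega> (\<lambda>m x. 0) (\<lambda>x. 0)"
    by (simp add: test_approx_def zero_test_function L2_norm_def)
  then show ?thesis using H by (auto simp: H10_def)
qed

end

section \<open>Triangulated domains\<close>

text \<open>Locally the frontier lies in a graph over a hyperplane, the image of a null set under a
  Lipschitz map. This makes the difference between \<open>\<Omega>\<close> and the union of the
  simplices negligible.\<close>

lemma lipschitz_boundary_negligible:
  fixes \<Omega> :: "(real^'n) set"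
  assumes op: "open \<Omega>" and lip: "lipschitz_boundary \<Omega>"
  shows "negligible (frontier \<Omega>)"
proof (rule locally_negligible_alt[THEN iffD2], rule ballI)
  fix x assume x: "x \<in> frontier \<Omega>"
  obtain U e \<gamma> L where U: "open U" "x \<in> U" and e: "norm e = 1"
    and L: "L-lipschitz_on {z. e \<bullet> z = 0} \<gamma>" and eq: "\<Omega> \<inter> U = {y \<in> U. \<gamma> (y - (e \<bullet> y) *\<^sub>R e) < e \<bullet> y}"
    using lip x unfolding lipschitz_boundary_def by meson
  define P where "P y = y - (e \<bullet> y) *\<^sub>R e" for y
  have ee: "e \<bullet> e = 1" using e by (simp add: norm_eq_1)
  have P: "e \<bullet> P y = 0" for y by (simp add: P_def inner_diff_right ee)
  have cP: "continuous_on A P" for A unfolding P_def by (intro continuous_intros)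
  have c\<gamma>: "continuous_on A (\<lambda>y. \<gamma> (P y))" for A
    by (rule continuous_on_compose2[OF lipschitz_on_continuous_on[OF L] cP]) (use P in auto)
  define S where "S = (\<lambda>z. z + \<gamma> z *\<^sub>R e) ` {z. e \<bullet> z = 0}"
  have "negligible S"
    unfolding S_def
  proof (rule negligible_locally_Lipschitz_image)
    show "negligible {z. e \<bullet> z = 0}" using e by (intro negligible_hyperplane) auto
    fix z assume z: "z \<in> {z. e \<bullet> z = 0}"
    have "norm ((y + \<gamma> y *\<^sub>R e) - (z + \<gamma> z *\<^sub>R e)) \<le> (1 + L) * norm (y - z)" if "y \<in> {z. e \<bullet> z = 0} \<inter> UNIV" for y
    proof -
      have d: "(y + \<gamma> y *\<^sub>R e) - (z + \<gamma> z *\<^sub>R e) = (y - z) + (\<gamma> y - \<gamma> z) *\<^sub>R e"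
        by (simp add: algebra_simps)
      have "norm ((y + \<gamma> y *\<^sub>R e) - (z + \<gamma> z *\<^sub>R e)) \<le> norm (y - z) + \<bar>\<gamma> y - \<gamma> z\<bar>"
        unfolding d using norm_triangle_ineq[of "y - z" "(\<gamma> y - \<gamma> z) *\<^sub>R e"] e by simp
      moreover have "\<bar>\<gamma> y - \<gamma> z\<bar> \<le> L * norm (y - z)"
        using lipschitz_onD[OF L, of y z] that z by (simp add: dist_norm)
      ultimately show ?thesis by (simp add: algebra_simps)
    qed
    then show "\<exists>T B. open T \<and> z \<in> T \<and> (\<forall>y\<in>{z. e \<bullet> z = 0} \<inter> T. norm ((y + \<gamma> y *\<^sub>R e) - (z + \<gamma> z *\<^sub>R e)) \<le> B * norm (y - z))"
      by (intro exI[of _ UNIV] exI[of _ "1 + L"]) auto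
  qed simp
  moreover have "frontier \<Omega> \<inter> U \<subseteq> S"
  proof
    fix y assume y: "y \<in> frontier \<Omega> \<inter> U"
    then have "y \<notin> \<Omega>" using op by (simp add: frontier_def interior_open)
    then have "y \<notin> {y \<in> U. \<gamma> (y - (e \<bullet> y) *\<^sub>R e) < e \<bullet> y}" unfolding eq[symmetric] by blast
    then have ge: "e \<bullet> y \<le> \<gamma> (P y)" using y by (simp add: P_def not_less)
    \<comment> \<open>The part of \<open>U\<close> strictly below the graph is open and free of
      points of \<open>\<Omega>\<close>, so a frontier point cannot lie there.\<close>
    have "\<not> e \<bullet> y < \<gamma> (P y)"
    proof
      assume lt: "e \<bullet> y < \<gamma> (P y)"
      let ?N = "U \<inter> {y. e \<bullet> y < \<gamma> (P y)}"
      have "open ?N"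
        using U(1) by (intro open_Int open_Collect_less c\<gamma> continuous_intros)
      moreover have "y \<in> ?N" using y lt by auto
      moreover have "y \<in> closure \<Omega>" using y by (simp add: frontier_def)
      ultimately have "\<Omega> \<inter> ?N \<noteq> {}" using open_Int_closure_eq_empty[of ?N \<Omega>] by blast
      then obtain w where "w \<in> ?N" "w \<in> \<Omega>" by blast
      then have "w \<in> \<Omega> \<inter> U" "e \<bullet> w < \<gamma> (P w)" by auto
      then show False unfolding eq by (auto simp: P_def)
    qed
    with ge have "\<gamma> (P y) = e \<bullet> y" by simp
    then have "y = P y + \<gamma> (P y) *\<^sub>R e" by (simp add: P_def)
    then show "y \<in> S" unfolding S_def using P by (intro image_eqI[of _ _ "P y"]) auto
  qed
  ultimately have "negligible (frontier \<Omega> \<inter> U)" by (rule negligible_subset)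
  then show "\<exists>U. openin (top_of_set (frontier \<Omega>)) U \<and> x \<in> U \<and> negligible U"
    using U x by (intro exI[of _ "frontier \<Omega> \<inter> U"]) auto
qed

text \<open>The values on \<open>T - S\<close> are arbitrary, but every subset of a null set is
  Lebesgue measurable.\<close>

lemma borel_measurable_lebesgue_on_almost_subset:
  fixes f :: "'a::euclidean_space \<Rightarrow> 'b::topological_space"
  assumes "f \<in> borel_measurable (lebesgue_on S)" "S \<in> sets lebesgue" "T \<in> sets lebesgue" "negligible (T - S)"
  shows "f \<in> borel_measurable (lebesgue_on T)"
proof (rule borel_measurableI)
  fix B :: "'b set" assume "open B"
  then have "f -` B \<inter> S \<in> sets (lebesgue_on S)"
    using measurable_sets[OF assms(1), of B] by (simp add: space_restrict_space)
  then have "f -` B \<inter> S \<in> sets lebesgue"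
    using assms(2) by (simp add: sets_restrict_space_iff)
  then have "f -` B \<inter> S \<inter> T \<in> sets lebesgue" using assms(3) by blast
  moreover have "f -` B \<inter> (T - S) \<in> sets lebesgue"
    using assms(4) negligible_subset[of "T - S" "f -` B \<inter> (T - S)"] by (simp add: negligible_imp_sets)
  moreover have "f -` B \<inter> T = (f -` B \<inter> S \<inter> T) \<union> (f -` B \<inter> (T - S))" by auto
  ultimately have "f -` B \<inter> T \<in> sets lebesgue" by auto
  then show "f -` B \<inter> space (lebesgue_on T) \<in> sets (lebesgue_on T)"
    using assms(3) by (simp add: sets_restrict_space_iff space_restrict_space)
qed

lemma integrable_lebesgue_on_almost_subset:
  fixes f :: "'a::euclidean_space \<Rightarrow> 'b::{banach, second_countable_topology}"
  assumes f: "integrable (lebesgue_on S) f" and S: "S \<in> sets lebesgue" and T: "T \<in> sets lebesgue" and neg: "negligible (T - S)"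
  shows "integrable (lebesgue_on T) f"
proof (rule integrableI_bounded)
  have "(\<integral>\<^sup>+x. ennreal (norm (f x)) \<partial>lebesgue_on T) = (\<integral>\<^sup>+x. ennreal (norm (f x)) * indicator T x \<partial>lebesgue)"
    using T by (intro nn_integral_restrict_space) simp
  also have "\<dots> \<le> (\<integral>\<^sup>+x. ennreal (norm (f x)) * indicator S x \<partial>lebesgue)"
  proof (rule nn_integral_mono_AE)
    have "T - S \<in> null_sets lebesgue" using neg by (simp add: negligible_iff_null_sets)
    from AE_not_in[OF this] show "AE x in lebesgue. ennreal (norm (f x)) * indicator T x \<le> ennreal (norm (f x)) * indicator S x"
      by eventually_elim (auto simp: indicator_def)
  qed
  also have "\<dots> = (\<integral>\<^sup>+x. ennreal (norm (f x)) \<partial>lebesgue_on S)"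
    using S by (intro nn_integral_restrict_space[symmetric]) simp
  also have "\<dots> < \<infinity>" using f by (simp add: integrable_iff_bounded)
  finally show "(\<integral>\<^sup>+x. ennreal (norm (f x)) \<partial>lebesgue_on T) < \<infinity>" .
qed (rule borel_measurable_lebesgue_on_almost_subset[OF borel_measurable_integrable[OF f] S T neg])

locale triangulated_domain =
  fixes \<Omega> :: "(real^'n) set" and \<T> :: "(real^'n) set set"
  assumes domain: "polyhedral_lipschitz_domain \<Omega>" and regular: "regular_triangulation \<Omega> \<T>"
begin

lemma open_domain: "open \<Omega>" and bounded_domain: "bounded \<Omega>" and domain_nonempty: "\<Omega> \<noteq> {}"
  using domain by (auto simp: polyhedral_lipschitz_domain_def)

lemma negligible_frontier: "negligible (frontier \<Omega>)"
  using domain by (intro lipschitz_boundary_negligible) (auto simp: polyhedral_lipschitz_domain_def)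

lemma domain_sets: "\<Omega> \<in> sets lebesgue"
  using open_domain by (simp add: borel_open lborelD)

lemma finite_triangulation: "finite \<T>"
  using regular by (simp add: regular_triangulation_def triangulation_def)

lemma closure_domain: "closure \<Omega> = \<Union>\<T>"
  using regular by (simp add: regular_triangulation_def)

lemma simplex_vertices:
  assumes "T \<in> \<T>"
  obtains C where "full_simplex C" "T = convex hull C"
proof -
  have "int CARD('n) simplex T" using regular assms by (simp add: regular_triangulation_def)
  then obtain C where "\<not> affine_dependent C" "int (card C) = int CARD('n) + 1" "T = convex hull C"
    by (auto simp: simplex_def)
  then show ?thesis by (intro that[of C]) (auto simp: full_simplex_def)
qed

lemma
  assumes "T \<in> \<T>"
  shows simplex_compact: "compact T" and simplex_convex: "convex T"
    and simplex_interior_nonempty: "interior T \<noteq> {}" and simplex_closure_interior: "closure (interior T) = T"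
    and simplex_measure_pos: "0 < measure lebesgue T"
    and simplex_aff_dim: "aff_dim T = int CARD('n)"
proof -
  obtain C where C: "full_simplex C" "T = convex hull C" by (rule simplex_vertices[OF assms])
  interpret full_simplex C by (rule C(1))
  show "compact T" "convex T" "interior T \<noteq> {}" "closure (interior T) = T"
    by (simp_all add: C(2) compact_hull convex_convex_hull interior_nonempty closure_interior)
  show "0 < measure lebesgue T" unfolding C(2) by (rule measure_hull_pos)
  show "aff_dim T = int CARD('n)"
    using aff_dim_affine_independent[OF indep] card_C by (simp add: C(2) aff_dim_convex_hull)
qed

lemma simplex_sets: "T \<in> \<T> \<Longrightarrow> T \<in> sets lebesgue"
  using simplex_compact by (simp add: borel_compact lborelD)

lemma simplex_lmeasurable: "T \<in> \<T> \<Longrightarrow> T \<in> lmeasurable"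
  using simplex_compact by (simp add: lmeasurable_compact)

lemma finite_measure_simplex: "T \<in> \<T> \<Longrightarrow> finite_measure (lebesgue_on T)"
  using simplex_lmeasurable by (rule finite_measure_lebesgue_on)

lemma negligible_simplex_frontier: "T \<in> \<T> \<Longrightarrow> negligible (frontier T)"
  using simplex_convex by (rule negligible_convex_frontier)

text \<open>The intersection is a common face. A proper face misses the relative interior, and
  \<open>T\<close> cannot be a proper face of \<open>T'\<close> because both have full
  dimension.\<close>

lemma interior_disjoint_simplex:
  assumes T: "T \<in> \<T>" "T' \<in> \<T>" "T \<noteq> T'"
  shows "interior T \<inter> T' = {}"
proof -
  have f: "T \<inter> T' face_of T" "T' \<inter> T face_of T'"
    using regular T by (auto simp: regular_triangulation_def triangulation_def)
  have ri: "rel_interior T = interior T"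
    using simplex_interior_nonempty[OF T(1)] by (rule rel_interior_nonempty_interior)
  show ?thesis
  proof (cases "T \<inter> T' = T")
    case True
    then have "T face_of T'" using f(2) by (simp add: Int_commute)
    then have "aff_dim T < aff_dim T'"
      using T(3) simplex_convex[OF T(2)] by (intro face_of_aff_dim_lt)
    then show ?thesis using simplex_aff_dim T by simp
  next
    case False
    then show ?thesis using face_of_disjoint_rel_interior[OF f(1)] ri interior_subset[of T] by blast
  qed
qed

lemma negligible_simplex_Int:
  assumes T: "T \<in> \<T>" "T' \<in> \<T>" "T \<noteq> T'"
  shows "negligible (T \<inter> T')"
proof (rule negligible_subset[OF negligible_simplex_frontier[OF T(1)]])
  show "T \<inter> T' \<subseteq> frontier T"
    using interior_disjoint_simplex[OF T] simplex_compact[OF T(1)]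
    by (auto simp: frontier_def closure_closed compact_imp_closed)
qed

section \<open>Transfer between the domain and its simplices\<close>

lemma negligible_simplex_Diff_domain: "T \<in> \<T> \<Longrightarrow> negligible (T - \<Omega>)"
  using closure_domain open_domain
  by (intro negligible_subset[OF negligible_frontier]) (auto simp: frontier_def interior_open)

lemma measurable_simplex:
  fixes f :: "real^'n \<Rightarrow> 'b::topological_space"
  shows "T \<in> \<T> \<Longrightarrow> f \<in> borel_measurable (lebesgue_on \<Omega>) \<Longrightarrow> f \<in> borel_measurable (lebesgue_on T)"
  by (rule borel_measurable_lebesgue_on_almost_subset[OF _ domain_sets simplex_sets negligible_simplex_Diff_domain])

lemma integrable_simplex:
  fixes f :: "real^'n \<Rightarrow> 'b::{banach, second_countable_topology}"
  shows "T \<in> \<T> \<Longrightarrow> integrable (lebesgue_on \<Omega>) f \<Longrightarrow> integrable (lebesgue_on T) f"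
  by (rule integrable_lebesgue_on_almost_subset[OF _ domain_sets simplex_sets negligible_simplex_Diff_domain])

lemma L2_simplex: "T \<in> \<T> \<Longrightarrow> f \<in> L2 (lebesgue_on \<Omega>) \<Longrightarrow> f \<in> L2 (lebesgue_on T)"
  unfolding L2_def using measurable_simplex integrable_simplex by blast

lemma AE_simplex:
  assumes T: "T \<in> \<T>" and "AE x in lebesgue_on \<Omega>. P x"
  shows "AE x in lebesgue_on T. P x"
proof -
  have "AE x in lebesgue. x \<in> \<Omega> \<longrightarrow> P x"
    using assms(2) domain_sets by (subst (asm) AE_restrict_space_iff) auto
  moreover have "T - \<Omega> \<in> null_sets lebesgue"
    using negligible_simplex_Diff_domain[OF T] by (simp add: negligible_iff_null_sets)
  note AE_not_in[OF this]
  ultimately have "AE x in lebesgue. x \<in> T \<longrightarrow> P x" by eventually_elim auto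
  then show ?thesis using simplex_sets[OF T] by (subst AE_restrict_space_iff) auto
qed

lemma AE_interior:
  assumes T: "T \<in> \<T>"
  shows "AE x in lebesgue_on T. x \<in> interior T"
proof -
  have "frontier T \<in> null_sets lebesgue"
    using negligible_simplex_frontier[OF T] by (simp add: negligible_iff_null_sets)
  from AE_not_in[OF this] have "AE x in lebesgue. x \<in> T \<longrightarrow> x \<in> interior T"
    by eventually_elim (auto simp: frontier_def closure_subset[THEN subsetD])
  then show ?thesis using simplex_sets[OF T] by (subst AE_restrict_space_iff) auto
qed

text \<open>The exceptional set consists of the frontier and the finitely many pairwise
  intersections of simplices, all negligible.\<close>

lemma AE_domain_partition: "AE x in lebesgue. (indicator \<Omega> x :: real) = (\<Sum>T\<in>\<T>. indicator T x)"
proof -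
  define D where "D = {S. \<exists>T\<in>\<T>. \<exists>T'\<in>\<T>. T \<noteq> T' \<and> S = T \<inter> T'}"
  have "D \<subseteq> (\<lambda>(T, T'). T \<inter> T') ` (\<T> \<times> \<T>)" by (auto simp: D_def)
  then have "finite D" using finite_triangulation by (meson finite_SigmaI finite_imageI finite_subset)
  then have "negligible (\<Union>D)"
    using negligible_simplex_Int by (intro negligible_Union) (auto simp: D_def)
  then have "frontier \<Omega> \<union> \<Union>D \<in> null_sets lebesgue"
    using negligible_frontier by (simp only: negligible_iff_null_sets null_sets.Un)
  from AE_not_in[OF this] show ?thesis
  proof eventually_elim
    case (elim x)
    show ?case
    proof (cases "x \<in> \<Omega>")
      case True
      then obtain T where T: "T \<in> \<T>" "x \<in> T" using closure_domain closure_subset by blast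
      have "(\<Sum>T'\<in>\<T>. indicator T' x) = (\<Sum>T'\<in>\<T>. if T' = T then 1 else 0 :: real)"
        using T elim by (intro sum.cong) (auto simp: indicator_def D_def)
      then show ?thesis using True T finite_triangulation by simp
    next
      case False
      then have "x \<notin> \<Union>\<T>"
        using elim open_domain unfolding closure_domain[symmetric] by (auto simp: frontier_def interior_open)
      then show ?thesis using False by (auto intro!: sum.neutral[symmetric])
    qed
  qed
qed

lemma integral_domain_split:
  fixes f :: "real^'n \<Rightarrow> real"
  assumes f: "integrable (lebesgue_on \<Omega>) f"
  shows "(\<integral>x. f x \<partial>lebesgue_on \<Omega>) = (\<Sum>T\<in>\<T>. \<integral>x. f x \<partial>lebesgue_on T)"
proof -
  have iT: "integrable lebesgue (\<lambda>x. indicator T x *\<^sub>R f x)" if "T \<in> \<T>" for T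
    using integrable_simplex[OF that f] simplex_sets[OF that] by (subst (asm) integrable_restrict_space) auto
  have i\<Omega>: "integrable lebesgue (\<lambda>x. indicator \<Omega> x *\<^sub>R f x)"
    using f domain_sets by (subst (asm) integrable_restrict_space) auto
  have "(\<integral>x. f x \<partial>lebesgue_on \<Omega>) = (\<integral>x. indicator \<Omega> x *\<^sub>R f x \<partial>lebesgue)"
    using domain_sets by (intro integral_restrict_space) simp
  also have "\<dots> = (\<integral>x. (\<Sum>T\<in>\<T>. indicator T x *\<^sub>R f x) \<partial>lebesgue)"
  proof (rule integral_cong_AE)
    show "AE x in lebesgue. indicator \<Omega> x *\<^sub>R f x = (\<Sum>T\<in>\<T>. indicator T x *\<^sub>R f x)"
      using AE_domain_partition by eventually_elim (simp add: sum_distrib_right)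
  qed (use iT i\<Omega> in \<open>auto intro!: borel_measurable_sum\<close>)
  also have "\<dots> = (\<Sum>T\<in>\<T>. \<integral>x. indicator T x *\<^sub>R f x \<partial>lebesgue)"
    by (rule Bochner_Integration.integral_sum) (rule iT)
  also have "\<dots> = (\<Sum>T\<in>\<T>. \<integral>x. f x \<partial>lebesgue_on T)"
    using simplex_sets by (intro sum.cong integral_restrict_space[symmetric]) auto
  finally show ?thesis .
qed

lemma integrable_domain_if_simplices:
  fixes f :: "real^'n \<Rightarrow> real"
  assumes f: "\<And>T. T \<in> \<T> \<Longrightarrow> integrable (lebesgue_on T) f"
  shows "integrable (lebesgue_on \<Omega>) f"
proof -
  have "set_integrable lebesgue (\<Union>T\<in>\<T>. T) f"
    using finite_triangulation f simplex_sets
    by (intro set_integrable_UN) (auto simp: set_integrable_def integrable_restrict_space)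
  moreover have "\<Omega> \<subseteq> (\<Union>T\<in>\<T>. T)" using closure_domain closure_subset[of \<Omega>] by simp
  ultimately have "set_integrable lebesgue \<Omega> f"
    by (rule set_integrable_subset[OF _ domain_sets])
  then show ?thesis using domain_sets by (simp add: set_integrable_def integrable_restrict_space)
qed

lemma L2_domain_if_simplices:
  fixes f :: "real^'n \<Rightarrow> real"
  assumes "\<And>T. T \<in> \<T> \<Longrightarrow> f \<in> L2 (lebesgue_on T)"
  shows "f \<in> L2 (lebesgue_on \<Omega>)"
proof -
  have "integrable (lebesgue_on \<Omega>) f"
    using assms by (intro integrable_domain_if_simplices L2_integrable finite_measure_simplex)
  moreover have "integrable (lebesgue_on \<Omega>) (\<lambda>x. (norm (f x))\<^sup>2)"
    using assms by (intro integrable_domain_if_simplices L2_square_integrable)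
  ultimately show ?thesis by (simp add: L2_def borel_measurable_integrable)
qed

lemma L2_norm_domain_split:
  fixes f :: "real^'n \<Rightarrow> 'b::{real_normed_vector, second_countable_topology}"
  shows "f \<in> L2 (lebesgue_on \<Omega>) \<Longrightarrow> (L2_norm (lebesgue_on \<Omega>) f)\<^sup>2 = (\<Sum>T\<in>\<T>. (L2_norm (lebesgue_on T) f)\<^sup>2)"
  by (simp add: L2_norm_power2 integral_domain_split L2_square_integrable)

lemma L2_norm_simplex_le:
  fixes f :: "real^'n \<Rightarrow> 'b::{real_normed_vector, second_countable_topology}"
  assumes "T \<in> \<T>" "f \<in> L2 (lebesgue_on \<Omega>)"
  shows "L2_norm (lebesgue_on T) f \<le> L2_norm (lebesgue_on \<Omega>) f"
proof (rule power2_le_imp_le[OF _ L2_norm_nonneg])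
  show "(L2_norm (lebesgue_on T) f)\<^sup>2 \<le> (L2_norm (lebesgue_on \<Omega>) f)\<^sup>2"
    unfolding L2_norm_domain_split[OF assms(2)]
    using member_le_sum[of T \<T> "\<lambda>T. (L2_norm (lebesgue_on T) f)\<^sup>2"] assms(1) finite_triangulation by simp
qed

end

section \<open>Traces on facets\<close>

context full_simplex
begin

text \<open>The face identity for \<open>\<phi>^2\<close>, with gradient \<open>2 \<phi> G\<close>;
  the mixed term is absorbed by \<open>2 x y \<le> x^2 + y^2\<close>. The constant depends on the
  simplex and the facet alone, which makes the bound usable along a sequence.\<close>

lemma trace_inequality:
  assumes j: "j \<in> C"
  obtains K where "0 \<le> K"
    "\<And>\<phi> G. (\<And>x. (\<phi> has_derivative (\<lambda>h. G x \<bullet> h)) (at x)) \<Longrightarrow> continuous_on UNIV G \<Longrightarrow>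
      (L2_norm (face_measure (convex hull (C - {j}))) \<phi>)\<^sup>2
      \<le> K * ((L2_norm (lebesgue_on (convex hull C)) \<phi>)\<^sup>2 + (L2_norm (lebesgue_on (convex hull C)) G)\<^sup>2)"
proof -
  let ?T = "convex hull C"
  obtain R where R: "\<And>x. x \<in> ?T \<Longrightarrow> norm x \<le> R"
    using bounded_hull unfolding bounded_iff by blast
  \<comment> \<open>\<open>R + norm j\<close> bounds \<open>norm (x - j)\<close> on the simplex, and
    \<open>CARD('n)\<close> is the coefficient of \<open>\<phi>^2\<close> in the face
    identity.\<close>
  define K where "K = norm (grd j) * (CARD('n) + (R + norm j))"
  have "norm j \<le> R" using R hull_inc[of j C convex] j by blast
  then have R0: "0 \<le> R + norm j" using norm_ge_zero[of j] by linarith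
  have "0 \<le> K" using R0 by (simp add: K_def)
  moreover have "(L2_norm (face_measure (convex hull (C - {j}))) \<phi>)\<^sup>2
      \<le> K * ((L2_norm (lebesgue_on ?T) \<phi>)\<^sup>2 + (L2_norm (lebesgue_on ?T) G)\<^sup>2)"
    if \<phi>: "\<And>x. (\<phi> has_derivative (\<lambda>h. G x \<bullet> h)) (at x)" and G: "continuous_on UNIV G" for \<phi> :: "real^'n \<Rightarrow> real" and G
  proof -
    have c\<phi>: "continuous_on UNIV \<phi>"
      using \<phi> by (meson has_derivative_continuous continuous_at_imp_continuous_on)
    have "(L2_norm (face_measure (convex hull (C - {j}))) \<phi>)\<^sup>2 = (\<integral>y. (\<phi> y)\<^sup>2 \<partial>face_measure (convex hull (C - {j})))"
      by (simp add: L2_norm_power2)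
    also have "\<dots> = norm (grd j) * (\<integral>x. CARD('n) * (\<phi> x)\<^sup>2 + (2 * \<phi> x) *\<^sub>R G x \<bullet> (x - j) \<partial>lebesgue_on ?T)"
    proof (rule face_integral_formula[OF j])
      show "((\<lambda>y. (\<phi> y)\<^sup>2) has_derivative (\<lambda>h. (2 * \<phi> x) *\<^sub>R G x \<bullet> h)) (at x)" for x
        by (rule derivative_eq_intros \<phi> refl)+ (simp add: mult_ac)
      show "continuous_on UNIV (\<lambda>x. (2 * \<phi> x) *\<^sub>R G x)" by (intro continuous_intros c\<phi> G)
    qed
    also have "(\<integral>x. CARD('n) * (\<phi> x)\<^sup>2 + (2 * \<phi> x) *\<^sub>R G x \<bullet> (x - j) \<partial>lebesgue_on ?T)
      \<le> (\<integral>x. (CARD('n) + (R + norm j)) * ((\<phi> x)\<^sup>2 + (norm (G x))\<^sup>2) \<partial>lebesgue_on ?T)"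
    proof (rule integral_mono)
      show "integrable (lebesgue_on ?T) (\<lambda>x. CARD('n) * (\<phi> x)\<^sup>2 + (2 * \<phi> x) *\<^sub>R G x \<bullet> (x - j))"
        "integrable (lebesgue_on ?T) (\<lambda>x. (CARD('n) + (R + norm j)) * ((\<phi> x)\<^sup>2 + (norm (G x))\<^sup>2))"
        by (intro integrable_continuous_lebesgue_on compact_hull continuous_intros c\<phi> G)+
      fix x assume "x \<in> space (lebesgue_on ?T)"
      then have x: "norm (x - j) \<le> R + norm j"
        using R[of x] norm_triangle_ineq4[of x j] by (simp add: space_restrict_space)
      have "(2 * \<phi> x) *\<^sub>R G x \<bullet> (x - j) \<le> norm ((2 * \<phi> x) *\<^sub>R G x) * norm (x - j)"
        by (rule norm_cauchy_schwarz)
      also have "\<dots> = (2 * \<bar>\<phi> x\<bar> * norm (G x)) * norm (x - j)" by (simp add: abs_mult)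
      also have "\<dots> \<le> ((\<phi> x)\<^sup>2 + (norm (G x))\<^sup>2) * (R + norm j)"
        using sum_squares_bound[of "\<bar>\<phi> x\<bar>" "norm (G x)"] x by (intro mult_mono) auto
      finally have "(2 * \<phi> x) *\<^sub>R G x \<bullet> (x - j) \<le> ((\<phi> x)\<^sup>2 + (norm (G x))\<^sup>2) * (R + norm j)" .
      moreover have "CARD('n) * (\<phi> x)\<^sup>2 \<le> CARD('n) * ((\<phi> x)\<^sup>2 + (norm (G x))\<^sup>2)"
        by (rule mult_left_mono) auto
      moreover have "n * X + X * r = (n + r) * X" for n r X :: real by (simp add: algebra_simps)
      ultimately show "CARD('n) * (\<phi> x)\<^sup>2 + (2 * \<phi> x) *\<^sub>R G x \<bullet> (x - j) \<le> (CARD('n) + (R + norm j)) * ((\<phi> x)\<^sup>2 + (norm (G x))\<^sup>2)"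
        by (metis add_mono)
    qed
    also have "\<dots> = (CARD('n) + (R + norm j)) * ((L2_norm (lebesgue_on ?T) \<phi>)\<^sup>2 + (L2_norm (lebesgue_on ?T) G)\<^sup>2)"
      by (subst integral_mult_right_zero, subst Bochner_Integration.integral_add)
        (auto simp: L2_norm_power2 intro!: integrable_continuous_lebesgue_on compact_hull continuous_intros c\<phi> G)
    finally show ?thesis by (simp add: K_def mult_left_mono mult.assoc)
  qed
  ultimately show ?thesis using that by blast
qed

end

section \<open>Traces of functions in \<open>H10\<close>\<close>

context triangulated_domain
begin

abbreviation "M \<equiv> lebesgue_on \<Omega>"

lemmas H10_L2_domain = H10_L2[OF open_domain bounded_domain]
  and weak_grad_L2_domain = weak_grad_L2[OF open_domain bounded_domain]
  and test_function_L2_domain = test_function_L2[OF open_domain bounded_domain]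
  and test_function_grad_L2_domain = test_function_grad_L2[OF open_domain bounded_domain]

lemma test_approx_simplex:
  assumes v: "v \<in> H10 \<Omega>" and \<phi>: "test_approx \<Omega> \<phi> v" and T: "T \<in> \<T>"
  shows "(\<lambda>m. L2_norm (lebesgue_on T) (\<lambda>x. \<phi> m x - v x)) \<longlonglongrightarrow> 0"
    and "(\<lambda>m. L2_norm (lebesgue_on T) (\<lambda>x. grad (\<phi> m) x - weak_grad \<Omega> v x)) \<longlonglongrightarrow> 0"
proof -
  have t: "\<phi> m \<in> test_functions \<Omega>" for m using \<phi> by (simp add: test_approx_def)
  have "(\<lambda>x. \<phi> m x - v x) \<in> L2 M" "(\<lambda>x. grad (\<phi> m) x - weak_grad \<Omega> v x) \<in> L2 M" for m
    by (rule L2_diff[OF test_function_L2_domain[OF t] H10_L2_domain[OF v]],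
        rule L2_diff[OF test_function_grad_L2_domain[OF t] weak_grad_L2_domain[OF v]])
  note le = this[THEN L2_norm_simplex_le[OF T]]
  have lim: "(\<lambda>m. L2_norm M (\<lambda>x. \<phi> m x - v x)) \<longlonglongrightarrow> 0"
    "(\<lambda>m. L2_norm M (\<lambda>x. grad (\<phi> m) x - weak_grad \<Omega> v x)) \<longlonglongrightarrow> 0"
    using \<phi> by (simp_all add: test_approx_def)
  show "(\<lambda>m. L2_norm (lebesgue_on T) (\<lambda>x. \<phi> m x - v x)) \<longlonglongrightarrow> 0"
    by (rule tendsto_sandwich[OF _ _ tendsto_const lim(1)]) (simp_all add: L2_norm_nonneg le)
  show "(\<lambda>m. L2_norm (lebesgue_on T) (\<lambda>x. grad (\<phi> m) x - weak_grad \<Omega> v x)) \<longlonglongrightarrow> 0"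
    by (rule tendsto_sandwich[OF _ _ tendsto_const lim(2)]) (simp_all add: L2_norm_nonneg le)
qed

text \<open>The volume side of the face identity is a sum of inner products with fixed
  \<open>L2\<close> functions, hence continuous under \<open>test_approx\<close>.\<close>

lemma facet_integral_limit:
  assumes v: "v \<in> H10 \<Omega>" and \<phi>: "test_approx \<Omega> \<phi> v" and C: "full_simplex C" and T: "convex hull C \<in> \<T>" and j: "j \<in> C"
  shows "(\<lambda>m. \<integral>y. \<phi> m y \<partial>face_measure (convex hull (C - {j}))) \<longlonglongrightarrow>
    norm (full_simplex.grd C j) * (\<integral>x. real CARD('n) * v x + weak_grad \<Omega> v x \<bullet> (x - j) \<partial>lebesgue_on (convex hull C))"
proof -
  interpret full_simplex C by (rule C)
  let ?T = "convex hull C"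
  let ?L = "lebesgue_on ?T"
  have t: "\<phi> m \<in> test_functions \<Omega>" for m using \<phi> by (simp add: test_approx_def)
  have tL: "\<phi> m \<in> L2 ?L" "grad (\<phi> m) \<in> L2 ?L" for m
    by (intro continuous_L2_compact compact_hull test_function_continuous[OF t] test_function_grad_continuous[OF t])+
  have vL: "v \<in> L2 ?L" "weak_grad \<Omega> v \<in> L2 ?L"
    using L2_simplex[OF T H10_L2_domain[OF v]] L2_simplex[OF T weak_grad_L2_domain[OF v]] by auto
  have cL: "(\<lambda>x. real CARD('n)) \<in> L2 ?L" "(\<lambda>x. x - j) \<in> L2 ?L" by (intro continuous_L2_compact compact_hull continuous_intros)+
  have split: "(\<integral>x. real CARD('n) * f x + g x \<bullet> (x - j) \<partial>?L) = (\<integral>x. f x \<bullet> CARD('n) \<partial>?L) + (\<integral>x. g x \<bullet> (x - j) \<partial>?L)"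
    if "f \<in> L2 ?L" "g \<in> L2 ?L" for f :: "real^'n \<Rightarrow> real" and g
    using L2_inner_integrable[OF that(1) cL(1)] L2_inner_integrable[OF that(2) cL(2)] by (simp add: mult.commute)
  have "(\<lambda>m. (\<integral>x. \<phi> m x \<bullet> CARD('n) \<partial>?L) + (\<integral>x. grad (\<phi> m) x \<bullet> (x - j) \<partial>?L)) \<longlonglongrightarrow>
      (\<integral>x. v x \<bullet> CARD('n) \<partial>?L) + (\<integral>x. weak_grad \<Omega> v x \<bullet> (x - j) \<partial>?L)"
    by (intro tendsto_add L2_inner_tendsto tL vL cL test_approx_simplex[OF v \<phi> T])
  then have "(\<lambda>m. \<integral>x. real CARD('n) * \<phi> m x + grad (\<phi> m) x \<bullet> (x - j) \<partial>?L) \<longlonglongrightarrow> (\<integral>x. real CARD('n) * v x + weak_grad \<Omega> v x \<bullet> (x - j) \<partial>?L)"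
    by (simp only: split[OF tL] split[OF vL])
  from tendsto_mult_left[OF this, of "norm (grd j)"] show ?thesis
    by (simp add: face_integral_formula[OF j test_function_has_derivative[OF t] test_function_grad_continuous[OF t]])
qed

text \<open>Justifies the choice in \<open>face_trace\<close>: by the trace inequality an
  approximating sequence is Cauchy on the facet, and \<open>L2\<close> is complete.\<close>

lemma is_face_trace_face_trace:
  assumes v: "v \<in> H10 \<Omega>" and C: "full_simplex C" and T: "convex hull C \<in> \<T>" and j: "j \<in> C"
  shows "is_face_trace \<Omega> (convex hull (C - {j})) v (face_trace \<Omega> (convex hull (C - {j})) v)"
proof -
  interpret full_simplex C by (rule C)
  let ?T = "convex hull C" and ?F = "convex hull (C - {j})"
  obtain \<phi> where \<phi>: "test_approx \<Omega> \<phi> v" using v by (auto simp: H10_def)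
  have t: "\<phi> m \<in> test_functions \<Omega>" for m using \<phi> by (simp add: test_approx_def)
  obtain K where K: "0 \<le> K" and trace: "\<And>\<phi> G. (\<And>x. (\<phi> has_derivative (\<lambda>h. G x \<bullet> h)) (at x)) \<Longrightarrow> continuous_on UNIV G \<Longrightarrow>
      (L2_norm (face_measure ?F) \<phi>)\<^sup>2 \<le> K * ((L2_norm (lebesgue_on ?T) \<phi>)\<^sup>2 + (L2_norm (lebesgue_on ?T) G)\<^sup>2)"
    using trace_inequality[OF j] by blast
  have fin: "finite_measure (face_measure ?F)" by (rule finite_face_measure[OF j])
  have tF: "\<phi> m \<in> L2 (face_measure ?F)" for m
    by (rule continuous_L2_face_measure[OF test_function_continuous[OF t] j])
  define A where "A m = L2_norm (lebesgue_on ?T) (\<lambda>x. \<phi> m x - v x)" for m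
  define B where "B m = L2_norm (lebesgue_on ?T) (\<lambda>x. grad (\<phi> m) x - weak_grad \<Omega> v x)" for m
  have AB: "A \<longlonglongrightarrow> 0" "B \<longlonglongrightarrow> 0" unfolding A_def B_def by (intro test_approx_simplex v \<phi> T)+
  have AB0: "0 \<le> A m" "0 \<le> B m" for m by (simp_all add: A_def B_def L2_norm_nonneg)
  have bound: "(L2_norm (face_measure ?F) (\<lambda>x. \<phi> m x - \<phi> k x))\<^sup>2 \<le> K * ((A m + A k)\<^sup>2 + (B m + B k)\<^sup>2)" for m k
  proof -
    have d: "((\<lambda>x. \<phi> m x - \<phi> k x) has_derivative (\<lambda>h. (grad (\<phi> m) x - grad (\<phi> k) x) \<bullet> h)) (at x)" for x
      using has_derivative_diff[OF test_function_has_derivative[OF t] test_function_has_derivative[OF t]]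
      by (simp add: inner_diff_left)
    have c: "continuous_on UNIV (\<lambda>x. grad (\<phi> m) x - grad (\<phi> k) x)"
      by (intro continuous_intros test_function_grad_continuous[OF t])
    have L: "\<phi> i \<in> L2 (lebesgue_on ?T)" "grad (\<phi> i) \<in> L2 (lebesgue_on ?T)" for i
      by (intro L2_simplex[OF T] test_function_L2_domain[OF t] test_function_grad_L2_domain[OF t])+
    have vL: "v \<in> L2 (lebesgue_on ?T)" "weak_grad \<Omega> v \<in> L2 (lebesgue_on ?T)"
      by (intro L2_simplex[OF T] H10_L2_domain[OF v] weak_grad_L2_domain[OF v])+
    have "L2_norm (lebesgue_on ?T) (\<lambda>x. \<phi> m x - \<phi> k x) \<le> A m + A k"
      using L2_norm_triangle_diff[OF L(1)[of m] vL(1) L(1)[of k]] L2_norm_minus_commute[of _ v "\<phi> k"] by (simp add: A_def)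
    moreover have "L2_norm (lebesgue_on ?T) (\<lambda>x. grad (\<phi> m) x - grad (\<phi> k) x) \<le> B m + B k"
      using L2_norm_triangle_diff[OF L(2)[of m] vL(2) L(2)[of k]] L2_norm_minus_commute[of _ "weak_grad \<Omega> v" "grad (\<phi> k)"]
      by (simp add: B_def)
    ultimately have "K * ((L2_norm (lebesgue_on ?T) (\<lambda>x. \<phi> m x - \<phi> k x))\<^sup>2 + (L2_norm (lebesgue_on ?T) (\<lambda>x. grad (\<phi> m) x - grad (\<phi> k) x))\<^sup>2)
      \<le> K * ((A m + A k)\<^sup>2 + (B m + B k)\<^sup>2)"
      using K by (intro mult_left_mono add_mono power_mono L2_norm_nonneg)
    with trace[OF d c] show ?thesis by (rule order.trans)
  qed
  have "\<exists>w\<in>L2 (face_measure ?F). (\<lambda>m. L2_norm (face_measure ?F) (\<lambda>x. \<phi> m x - w x)) \<longlonglongrightarrow> 0"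
  proof (rule L2_complete[OF fin tF])
    fix e :: real assume e: "e > 0"
    \<comment> \<open>Chosen so that \<open>8 K d^2 < e^2\<close>; the summand 1 keeps the
      denominator positive when \<open>K = 0\<close>.\<close>
    define d where "d = e / (4 * (K + 1))"
    have d: "d > 0" "4 * (K + 1) * d = e" using e K by (auto simp: d_def)
    have d2: "8 * K * d\<^sup>2 < e\<^sup>2"
    proof -
      have "8 * K * d\<^sup>2 \<le> 8 * (K + 1)\<^sup>2 * d\<^sup>2"
        using K by (intro mult_right_mono mult_left_mono) (auto simp: power2_eq_square algebra_simps)
      also have "\<dots> < 16 * (K + 1)\<^sup>2 * d\<^sup>2" using d K by simp
      also have "\<dots> = (4 * (K + 1) * d)\<^sup>2" by (simp add: power2_eq_square algebra_simps)
      finally show ?thesis using d(2) by simp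
    qed
    obtain N1 N2 where "\<And>m. m \<ge> N1 \<Longrightarrow> A m < d" "\<And>m. m \<ge> N2 \<Longrightarrow> B m < d"
      using order_tendstoD(2)[OF AB(1) d(1)] order_tendstoD(2)[OF AB(2) d(1)] unfolding eventually_sequentially by blast
    then have N: "A m < d" "B m < d" if "m \<ge> max N1 N2" for m using that by auto
    have "L2_norm (face_measure ?F) (\<lambda>x. \<phi> m x - \<phi> k x) < e" if "m \<ge> max N1 N2" "k \<ge> max N1 N2" for m k
    proof -
      have "(A m + A k)\<^sup>2 + (B m + B k)\<^sup>2 \<le> (2 * d)\<^sup>2 + (2 * d)\<^sup>2"
        using N[OF that(1)] N[OF that(2)] AB0[of m] AB0[of k] by (intro add_mono power_mono) auto
      then have "K * ((A m + A k)\<^sup>2 + (B m + B k)\<^sup>2) \<le> K * ((2 * d)\<^sup>2 + (2 * d)\<^sup>2)"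
        using K by (rule mult_left_mono)
      also have "\<dots> = 8 * K * d\<^sup>2" by (simp add: power2_eq_square)
      finally have "(L2_norm (face_measure ?F) (\<lambda>x. \<phi> m x - \<phi> k x))\<^sup>2 < e\<^sup>2" using bound[of m k] d2 by linarith
      then show ?thesis using e by (rule power2_less_imp_less[OF _ less_imp_le])
    qed
    then show "\<exists>N. \<forall>m\<ge>N. \<forall>k\<ge>N. L2_norm (face_measure ?F) (\<lambda>x. \<phi> m x - \<phi> k x) < e" by blast
  qed
  then have "\<exists>w. is_face_trace \<Omega> ?F v w" using \<phi> unfolding is_face_trace_def by blast
  then show ?thesis unfolding face_trace_def by (rule someI_ex)
qed

text \<open>The right-hand side mentions no approximating sequence, so the choices hidden in \<open>face_trace\<close> do not matter.\<close>

lemma face_trace_integral: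
  assumes v: "v \<in> H10 \<Omega>" and C: "full_simplex C" and T: "convex hull C \<in> \<T>" and j: "j \<in> C"
  shows "(\<integral>y. face_trace \<Omega> (convex hull (C - {j})) v y \<partial>face_measure (convex hull (C - {j})))
    = norm (full_simplex.grd C j) * (\<integral>x. real CARD('n) * v x + weak_grad \<Omega> v x \<bullet> (x - j) \<partial>lebesgue_on (convex hull C))"
proof -
  interpret full_simplex C by (rule C)
  let ?F = "convex hull (C - {j})" and ?w = "face_trace \<Omega> (convex hull (C - {j})) v"
  have fin: "finite_measure (face_measure ?F)" by (rule finite_face_measure[OF j])
  obtain \<phi> where wL: "?w \<in> L2 (face_measure ?F)" and \<phi>: "test_approx \<Omega> \<phi> v"
    and lim: "(\<lambda>m. L2_norm (face_measure ?F) (\<lambda>x. \<phi> m x - ?w x)) \<longlonglongrightarrow> 0"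
    using is_face_trace_face_trace[OF assms] unfolding is_face_trace_def by blast
  have t: "\<phi> m \<in> test_functions \<Omega>" for m using \<phi> by (simp add: test_approx_def)
  have tF: "\<phi> m \<in> L2 (face_measure ?F)" for m
    by (rule continuous_L2_face_measure[OF test_function_continuous[OF t] j])
  have one: "(\<lambda>_. 1::real) \<in> L2 (face_measure ?F)" by (rule L2_bounded[where B = 1]) (simp_all add: fin)
  have "(\<lambda>m. \<integral>y. \<phi> m y \<partial>face_measure ?F) \<longlonglongrightarrow> (\<integral>y. ?w y \<partial>face_measure ?F)"
    using L2_inner_tendsto[OF tF wL one lim] by simp
  then show ?thesis using facet_integral_limit[OF v \<phi> C T j] by (rule LIMSEQ_unique)
qed

text \<open>Test functions vanish on the frontier, so the face integrals along an approximating
  sequence are zero. With this, boundary facets obey the same formula as interior ones, although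
  \<open>I_CR\<close> sums over interior faces only.\<close>

lemma boundary_facet_integral:
  assumes v: "v \<in> H10 \<Omega>" and C: "full_simplex C" and T: "convex hull C \<in> \<T>" and j: "j \<in> C"
    and bd: "convex hull (C - {j}) \<subseteq> frontier \<Omega>"
  shows "(\<integral>x. real CARD('n) * v x + weak_grad \<Omega> v x \<bullet> (x - j) \<partial>lebesgue_on (convex hull C)) = 0"
proof -
  interpret full_simplex C by (rule C)
  let ?F = "convex hull (C - {j})"
  obtain \<phi> where \<phi>: "test_approx \<Omega> \<phi> v" using v by (auto simp: H10_def)
  have t: "\<phi> m \<in> test_functions \<Omega>" for m using \<phi> by (simp add: test_approx_def)
  have "\<phi> m y = 0" if "y \<in> ?F" for m y
    using that bd open_domain by (intro test_function_zero[OF t]) (auto simp: frontier_def interior_open)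
  then have "(\<integral>y. \<phi> m y \<partial>face_measure ?F) = 0" for m
    by (intro integral_eq_zero_AE AE_I2) (simp add: space_face_measure)
  with facet_integral_limit[OF v \<phi> C T j] show ?thesis
    using grd_nonzero[OF j] by (simp add: LIMSEQ_const_iff)
qed

end

section \<open>The Crouzeix--Raviart interpolation\<close>

context triangulated_domain
begin

text \<open>Every point of a simplex is a limit point of its interior, so \<open>Lim\<close> denotes
  a genuine, unique limit there.\<close>

lemma trace_from_affine:
  assumes T: "T \<in> \<T>" and v: "\<And>y. y \<in> interior T \<Longrightarrow> v y = a \<bullet> y + b" and x: "x \<in> T"
  shows "trace_from T v x = a \<bullet> x + b"
  unfolding trace_from_def
proof (rule tendsto_Lim)
  have "x \<in> closure (interior T)" using simplex_closure_interior[OF T] x by simp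
  then have "x islimpt interior T"
    using interior_limit_point[of x "interior T"] by (cases "x \<in> interior T") (auto simp: closure_def)
  then show "at x within interior T \<noteq> bot" by (simp add: trivial_limit_within)
  have "((\<lambda>y. a \<bullet> y + b) \<longlongrightarrow> a \<bullet> x + b) (at x within interior T)" by (intro tendsto_intros)
  then show "(v \<longlongrightarrow> a \<bullet> x + b) (at x within interior T)"
    by (rule Lim_transform_eventually) (simp add: eventually_at_filter v)
qed

lemma grad_affine:
  assumes v: "\<And>y. y \<in> interior T \<Longrightarrow> v y = a \<bullet> y + b" and x: "x \<in> interior T"
  shows "grad v x = a"
proof (rule grad_eq)
  have "((\<lambda>y. a \<bullet> y + b) has_derivative (\<lambda>h. a \<bullet> h)) (at x)" by (auto intro!: derivative_eq_intros)
  then show "(v has_derivative (\<lambda>h. a \<bullet> h)) (at x)"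
    by (rule has_derivative_transform_within_open[OF _ open_interior x]) (simp add: v)
qed

lemma P1_affine:
  assumes "v \<in> P1 \<T>" "T \<in> \<T>"
  obtains a b where "\<And>y. y \<in> interior T \<Longrightarrow> v y = a \<bullet> y + b"
  using assms unfolding P1_def by blast

lemma facet_mid:
  assumes T: "T \<in> \<T>" and G: "G facet_of T"
  shows "mid G \<in> T"
proof -
  obtain C where C: "full_simplex C" "T = convex hull C" by (rule simplex_vertices[OF T])
  interpret full_simplex C by (rule C(1))
  obtain c where c: "c \<in> C" "G = convex hull (C - {c})" using G facet_of_iff C(2) by blast
  show ?thesis
    using mid_in_facet[OF c(1)] hull_mono[of "C - {c}" C convex] c C by auto
qed

lemma P1_lin: "u \<in> P1 \<T> \<Longrightarrow> v \<in> P1 \<T> \<Longrightarrow> (\<lambda>x. \<alpha> * u x + \<beta> * v x) \<in> P1 \<T>"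
  unfolding P1_def
proof (intro CollectI ballI)
  fix T assume u: "u \<in> {v. \<forall>T\<in>\<T>. \<exists>a b. \<forall>x\<in>interior T. v x = a \<bullet> x + b}"
    and v: "v \<in> {v. \<forall>T\<in>\<T>. \<exists>a b. \<forall>x\<in>interior T. v x = a \<bullet> x + b}" and T: "T \<in> \<T>"
  obtain a b c d where "\<forall>x\<in>interior T. u x = a \<bullet> x + b" "\<forall>x\<in>interior T. v x = c \<bullet> x + d"
    using u v T by blast
  then show "\<exists>a b. \<forall>x\<in>interior T. \<alpha> * u x + \<beta> * v x = a \<bullet> x + b"
    by (intro exI[of _ "\<alpha> *\<^sub>R a + \<beta> *\<^sub>R c"] exI[of _ "\<alpha> * b + \<beta> * d"]) (simp add: inner_add_left algebra_simps)
qed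

lemma trace_from_lin:
  assumes u: "u \<in> P1 \<T>" and v: "v \<in> P1 \<T>" and T: "T \<in> \<T>" and x: "x \<in> T"
  shows "trace_from T (\<lambda>x. \<alpha> * u x + \<beta> * v x) x = \<alpha> * trace_from T u x + \<beta> * trace_from T v x"
proof -
  obtain a b where a: "\<And>y. y \<in> interior T \<Longrightarrow> u y = a \<bullet> y + b" using P1_affine[OF u T] by blast
  obtain c d where c: "\<And>y. y \<in> interior T \<Longrightarrow> v y = c \<bullet> y + d" using P1_affine[OF v T] by blast
  have "trace_from T (\<lambda>x. \<alpha> * u x + \<beta> * v x) x = (\<alpha> *\<^sub>R a + \<beta> *\<^sub>R c) \<bullet> x + (\<alpha> * b + \<beta> * d)"
    by (rule trace_from_affine[OF T _ x]) (simp add: a c inner_add_left algebra_simps)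
  then show ?thesis
    using trace_from_affine[OF T a x] trace_from_affine[OF T c x] by (simp add: inner_add_left algebra_simps)
qed

lemma CR10_P1: "v \<in> CR10 \<Omega> \<T> \<Longrightarrow> v \<in> P1 \<T>"
  by (simp add: CR10_def)

lemma CR10_jump:
  assumes "v \<in> CR10 \<Omega> \<T>" and F: "F \<in> interior_faces \<Omega> \<T>" "T \<in> \<T>" "T' \<in> \<T>" "T \<noteq> T' \<and> F facet_of T \<and> F facet_of T'"
  shows "jump T T' v (mid F) = 0"
proof -
  from assms(1) have "\<forall>F\<in>interior_faces \<Omega> \<T>. \<forall>T\<in>\<T>. \<forall>T'\<in>\<T>. T \<noteq> T' \<and> F facet_of T \<and> F facet_of T' \<longrightarrow> jump T T' v (mid F) = 0"
    unfolding CR10_def by simp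
  from this[rule_format, OF F] show ?thesis .
qed

lemma CR10_boundary:
  assumes "v \<in> CR10 \<Omega> \<T>" and F: "F \<in> faces \<T>" "F \<subseteq> frontier \<Omega>" "T \<in> \<T>" "F facet_of T"
  shows "trace_from T v (mid F) = 0"
proof -
  from assms(1) have "\<forall>F\<in>faces \<T>. F \<subseteq> frontier \<Omega> \<longrightarrow> (\<forall>T\<in>\<T>. F facet_of T \<longrightarrow> trace_from T v (mid F) = 0)"
    unfolding CR10_def by simp
  from this[rule_format, OF F] show ?thesis .
qed

lemma CR10_lin:
  assumes u: "u \<in> CR10 \<Omega> \<T>" and v: "v \<in> CR10 \<Omega> \<T>"
  shows "(\<lambda>x. \<alpha> * u x + \<beta> * v x) \<in> CR10 \<Omega> \<T>"
proof -
  let ?w = "\<lambda>x. \<alpha> * u x + \<beta> * v x"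
  note P = CR10_P1[OF u] CR10_P1[OF v]
  have tr: "trace_from T ?w (mid G) = \<alpha> * trace_from T u (mid G) + \<beta> * trace_from T v (mid G)" if "T \<in> \<T>" "G facet_of T" for T G
    by (rule trace_from_lin[OF P that(1) facet_mid[OF that]])
  show ?thesis
    unfolding CR10_def
  proof (intro CollectI conjI ballI impI)
    show "?w \<in> P1 \<T>" by (rule P1_lin[OF P])
  next
    fix F T T' assume F: "F \<in> interior_faces \<Omega> \<T>" "T \<in> \<T>" "T' \<in> \<T>" "T \<noteq> T' \<and> F facet_of T \<and> F facet_of T'"
    from CR10_jump[OF u F] CR10_jump[OF v F] show "jump T T' ?w (mid F) = 0" using tr F by (simp add: jump_def algebra_simps flip: right_diff_distrib)
  next
    fix F T assume F: "F \<in> faces \<T>" "F \<subseteq> frontier \<Omega>" "T \<in> \<T>" "F facet_of T"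
    from CR10_boundary[OF u F] CR10_boundary[OF v F] show "trace_from T ?w (mid F) = 0" using tr F by simp
  qed
qed

lemma CR10_zero: "(\<lambda>x. 0) \<in> CR10 \<Omega> \<T>"
proof -
  have "trace_from T (\<lambda>x. 0) (mid G) = 0" if "T \<in> \<T>" "G facet_of T" for T G
    using trace_from_affine[OF that(1) _ facet_mid[OF that], of "\<lambda>x. 0" 0 0] by simp
  then show ?thesis unfolding CR10_def by (auto simp: P1_def jump_def intro!: exI[of _ 0])
qed

lemma CR10_sum:
  assumes "finite K" "\<And>i. i \<in> K \<Longrightarrow> e i \<in> CR10 \<Omega> \<T>"
  shows "(\<lambda>x. \<Sum>i\<in>K. c i * e i x) \<in> CR10 \<Omega> \<T>"
  using assms
proof (induction K rule: finite_induct)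
  case (insert i K)
  then show ?case using CR10_lin[of "e i" "\<lambda>x. \<Sum>i\<in>K. c i * e i x" "c i" 1] by simp
qed (simp add: CR10_zero)

lemma trace_from_sum:
  assumes "finite K" "\<And>i. i \<in> K \<Longrightarrow> e i \<in> CR10 \<Omega> \<T>" "T \<in> \<T>" "x \<in> T"
  shows "trace_from T (\<lambda>x. \<Sum>i\<in>K. c i * e i x) x = (\<Sum>i\<in>K. c i * trace_from T (e i) x)"
  using assms
proof (induction K rule: finite_induct)
  case empty
  then show ?case using trace_from_affine[of T "\<lambda>x. 0" 0 0 x] by simp
next
  case (insert i K)
  then show ?case
    using trace_from_lin[OF CR10_P1 CR10_P1, of "e i" "\<lambda>x. \<Sum>i\<in>K. c i * e i x" T x "c i" 1] CR10_sum[of K e c] by simp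
qed

lemma finite_faces: "finite (faces \<T>)"
proof -
  have "finite {F. F facet_of T}" if T: "T \<in> \<T>" for T
  proof -
    obtain C where C: "full_simplex C" "T = convex hull C" by (rule simplex_vertices[OF T])
    interpret full_simplex C by (rule C(1))
    have "{F. F facet_of T} = (\<lambda>c. convex hull (C - {c})) ` C" using facet_of_iff C(2) by auto
    then show ?thesis using finite_C by simp
  qed
  moreover have "faces \<T> = (\<Union>T\<in>\<T>. {F. F facet_of T})" by (auto simp: faces_def)
  ultimately show ?thesis using finite_triangulation by simp
qed

lemma finite_interior_faces: "finite (interior_faces \<Omega> \<T>)"
  using finite_faces by (simp add: interior_faces_def)

text \<open>Existence behind the choice in \<open>CR_basis\<close>: on each simplex with facet
  \<open>F\<close> take \<open>1 - CARD('n) * ell c\<close>, on the others zero. The traces at a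
  barycentre then depend on the facet alone, so the jumps cancel there.\<close>

lemma CR_basis_properties:
  assumes F: "F \<in> interior_faces \<Omega> \<T>"
  shows "CR_basis \<Omega> \<T> F \<in> CR10 \<Omega> \<T>"
    and "T \<in> \<T> \<Longrightarrow> G facet_of T \<Longrightarrow> trace_from T (CR_basis \<Omega> \<T> F) (mid G) = (if G = F then 1 else 0)"
proof -
  have "\<exists>ab. \<forall>G. G facet_of T \<longrightarrow> fst ab \<bullet> mid G + snd ab = (if G = F then 1 else 0)" if T: "T \<in> \<T>" for T
  proof (cases "F facet_of T")
    case False
    then show ?thesis by (intro exI[of _ "(0, 0)"]) auto
  next
    case True
    obtain C where C: "full_simplex C" "T = convex hull C" by (rule simplex_vertices[OF T])
    interpret full_simplex C by (rule C(1))
    obtain c where c: "c \<in> C" "F = convex hull (C - {c})" using True facet_of_iff C(2) by blast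
    have "(- real CARD('n) *\<^sub>R grd c) \<bullet> mid G + (1 - real CARD('n) * snd coords c) = (if G = F then 1 else 0)"
      if G: "G facet_of T" for G
    proof -
      obtain d where d: "d \<in> C" "G = convex hull (C - {d})" using G facet_of_iff C(2) by blast
      have "(- real CARD('n) *\<^sub>R grd c) \<bullet> mid G + (1 - real CARD('n) * snd coords c) = 1 - real CARD('n) * ell c (mid G)"
        by (simp add: ell_def algebra_simps)
      also have "\<dots> = (if G = F then 1 else 0)"
        using ell_mid[OF d(1) c(1)] facet_inj[OF c(1) d(1)] c(2) d(2) by auto
      finally show ?thesis .
    qed
    then show ?thesis
      by (intro exI[of _ "(- real CARD('n) *\<^sub>R grd c, 1 - real CARD('n) * snd coords c)"]) simp
  qed
  then have "\<forall>T\<in>\<T>. \<exists>ab. \<forall>G. G facet_of T \<longrightarrow> fst ab \<bullet> mid G + snd ab = (if G = F then 1 else 0)" by blast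
  then obtain ab where ab: "\<And>T G. T \<in> \<T> \<Longrightarrow> G facet_of T \<Longrightarrow> fst (ab T) \<bullet> mid G + snd (ab T) = (if G = F then 1 else 0)"
    unfolding bchoice_iff by blast
  \<comment> \<open>Interiors are disjoint, so at most one summand is active; the skeleton receives
    the value 0.\<close>
  define \<psi> where "\<psi> x = (\<Sum>T\<in>\<T>. if x \<in> interior T then fst (ab T) \<bullet> x + snd (ab T) else 0)" for x
  have \<psi>: "\<psi> x = fst (ab T) \<bullet> x + snd (ab T)" if T: "T \<in> \<T>" and x: "x \<in> interior T" for T x
  proof -
    have "x \<in> interior T' \<longleftrightarrow> T' = T" if "T' \<in> \<T>" for T'
      using interior_disjoint_simplex[OF T that] x interior_subset[of T'] by auto
    then have "\<psi> x = (\<Sum>T'\<in>\<T>. if T' = T then fst (ab T) \<bullet> x + snd (ab T) else 0)"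
      unfolding \<psi>_def by (intro sum.cong) auto
    then show ?thesis using T finite_triangulation by simp
  qed
  have tr: "trace_from T \<psi> (mid G) = (if G = F then 1 else 0)" if "T \<in> \<T>" "G facet_of T" for T G
    using trace_from_affine[OF that(1) \<psi>[OF that(1)] facet_mid[OF that]] ab[OF that] by simp
  have "\<psi> \<in> P1 \<T>" using \<psi> unfolding P1_def by blast
  moreover have "\<not> F \<subseteq> frontier \<Omega>" using F by (simp add: interior_faces_def)
  ultimately have "\<psi> \<in> CR10 \<Omega> \<T>" using tr unfolding CR10_def by (auto simp: jump_def)
  then have "\<exists>\<psi>. \<psi> \<in> CR10 \<Omega> \<T> \<and> (\<forall>T\<in>\<T>. \<forall>G. G facet_of T \<longrightarrow> trace_from T \<psi> (mid G) = (if G = F then 1 else 0))"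
    using tr by blast
  from someI_ex[OF this] show "CR_basis \<Omega> \<T> F \<in> CR10 \<Omega> \<T>"
    "T \<in> \<T> \<Longrightarrow> G facet_of T \<Longrightarrow> trace_from T (CR_basis \<Omega> \<T> F) (mid G) = (if G = F then 1 else 0)"
    unfolding CR_basis_def by blast+
qed

section \<open>Face means and the mean value property of the gradient\<close>

definition face_mean :: "(real^'n \<Rightarrow> real) \<Rightarrow> (real^'n) set \<Rightarrow> real" where
  "face_mean v F = (\<integral>y. face_trace \<Omega> F v y \<partial>face_measure F) / measure (face_measure F) F"

lemma I_CR_eq: "I_CR \<Omega> \<T> v = (\<lambda>x. \<Sum>F\<in>interior_faces \<Omega> \<T>. face_mean v F * CR_basis \<Omega> \<T> F x)"
  by (simp add: I_CR_def face_mean_def fun_eq_iff)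

lemma I_CR_CR10: "I_CR \<Omega> \<T> v \<in> CR10 \<Omega> \<T>"
  unfolding I_CR_eq by (intro CR10_sum finite_interior_faces CR_basis_properties)

lemma trace_I_CR:
  assumes T: "T \<in> \<T>" and G: "G facet_of T"
  shows "trace_from T (I_CR \<Omega> \<T> v) (mid G) = (if G \<subseteq> frontier \<Omega> then 0 else face_mean v G)"
proof -
  have "trace_from T (I_CR \<Omega> \<T> v) (mid G) = (\<Sum>F\<in>interior_faces \<Omega> \<T>. face_mean v F * trace_from T (CR_basis \<Omega> \<T> F) (mid G))"
    unfolding I_CR_eq by (intro trace_from_sum finite_interior_faces CR_basis_properties T facet_mid[OF T G])
  also have "\<dots> = (\<Sum>F\<in>interior_faces \<Omega> \<T>. if F = G then face_mean v G else 0)"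
    using CR_basis_properties(2)[OF _ T G] by (intro sum.cong) auto
  also have "\<dots> = (if G \<in> interior_faces \<Omega> \<T> then face_mean v G else 0)"
    using finite_interior_faces by simp
  finally show ?thesis using T G by (auto simp: interior_faces_def faces_def)
qed

text \<open>The factor \<open>norm (grd j)\<close> occurs in the face integral as well as in the
  area and cancels, leaving a volume integral free of the choice in
  \<open>face_trace\<close>.\<close>

lemma face_mean_formula:
  assumes v: "v \<in> H10 \<Omega>" and C: "full_simplex C" and T: "convex hull C \<in> \<T>" and j: "j \<in> C"
  shows "face_mean v (convex hull (C - {j})) =
    (\<integral>x. real CARD('n) * v x + weak_grad \<Omega> v x \<bullet> (x - j) \<partial>lebesgue_on (convex hull C)) / (CARD('n) * measure lebesgue (convex hull C))"
proof -
  interpret full_simplex C by (rule C)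
  show ?thesis
    unfolding face_mean_def face_trace_integral[OF assms] measure_face[OF j]
    using grd_nonzero[OF j] by simp
qed

text \<open>On an interior facet this is the face mean; on a boundary facet both sides are zero. The
  reconstruction of the gradient needs one formula for all facets of the simplex.\<close>

lemma trace_I_CR_mid:
  assumes v: "v \<in> H10 \<Omega>" and C: "full_simplex C" and T: "convex hull C \<in> \<T>" and j: "j \<in> C"
  shows "trace_from (convex hull C) (I_CR \<Omega> \<T> v) (mid (convex hull (C - {j}))) =
    (\<integral>x. real CARD('n) * v x + weak_grad \<Omega> v x \<bullet> (x - j) \<partial>lebesgue_on (convex hull C)) / (CARD('n) * measure lebesgue (convex hull C))"
proof -
  interpret full_simplex C by (rule C)
  have "convex hull (C - {j}) facet_of convex hull C" using facet_of_iff j by blast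
  from trace_I_CR[OF T this, of v] show ?thesis
    using boundary_facet_integral[OF assms] face_mean_formula[OF assms] by auto
qed

lemma simplex_L2_integrable:
  fixes f :: "real^'n \<Rightarrow> 'b::euclidean_space"
  shows "T \<in> \<T> \<Longrightarrow> f \<in> L2 M \<Longrightarrow> integrable (lebesgue_on T) f"
  by (rule L2_integrable[OF finite_measure_simplex L2_simplex])

text \<open>The values at barycentres are affine in the opposite vertex, namely
  \<open>(I0 - c \<bullet> g) / (n \<mu>)\<close>. Inserted into \<open>affine_eq_mid_sum\<close>,
  the constant part is killed by \<open>sum_grd\<close>, and \<open>sum_vertex_inner_grd\<close>
  returns \<open>g\<close>.\<close>

theorem I_CR_mean_gradient:
  assumes v: "v \<in> H10 \<Omega>" and T: "T \<in> \<T>"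
  obtains a b where "\<And>x. x \<in> interior T \<Longrightarrow> I_CR \<Omega> \<T> v x = a \<bullet> x + b"
    and "measure lebesgue T *\<^sub>R a = (\<integral>x. weak_grad \<Omega> v x \<partial>lebesgue_on T)"
proof -
  obtain C where C: "full_simplex C" "T = convex hull C" by (rule simplex_vertices[OF T])
  interpret full_simplex C by (rule C(1))
  have TC: "convex hull C \<in> \<T>" using T C by simp
  define n where "n = real CARD('n)"
  have n: "n > 0" by (simp add: n_def)
  define \<mu> where "\<mu> = measure lebesgue T"
  have \<mu>: "\<mu> > 0" unfolding \<mu>_def by (rule simplex_measure_pos[OF T])
  let ?L = "lebesgue_on T" and ?g = "weak_grad \<Omega> v"
  define m where "m c = (\<integral>x. n * v x + ?g x \<bullet> (x - c) \<partial>?L)" for c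
  obtain a b where ab: "\<And>x. x \<in> interior T \<Longrightarrow> I_CR \<Omega> \<T> v x = a \<bullet> x + b"
    using P1_affine[OF CR10_P1[OF I_CR_CR10] T] by blast
  have mid: "a \<bullet> mid (convex hull (C - {c})) + b = m c / (n * \<mu>)" if c: "c \<in> C" for c
  proof -
    have "convex hull (C - {c}) facet_of T" using facet_of_iff c C(2) by blast
    from trace_from_affine[OF T ab facet_mid[OF T this]] trace_I_CR_mid[OF v C(1) TC c]
    show ?thesis by (simp add: m_def n_def \<mu>_def C(2)[symmetric])
  qed
  have vi: "integrable ?L v" and gi: "integrable ?L ?g"
    by (rule simplex_L2_integrable[OF T H10_L2_domain[OF v]], rule simplex_L2_integrable[OF T weak_grad_L2_domain[OF v]])
  have gxi: "integrable ?L (\<lambda>x. ?g x \<bullet> x)"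
  proof (rule L2_inner_integrable)
    show "?g \<in> L2 ?L" by (rule L2_simplex[OF T weak_grad_L2_domain[OF v]])
    show "(\<lambda>x. x) \<in> L2 ?L" by (intro continuous_L2_compact simplex_compact[OF T] continuous_intros)
  qed
  define I0 where "I0 = (\<integral>x. n * v x + ?g x \<bullet> x \<partial>?L)"
  define g where "g = (\<integral>x. ?g x \<partial>?L)"
  have m: "m c = I0 - c \<bullet> g" for c
  proof -
    have "m c = (\<integral>x. (n * v x + ?g x \<bullet> x) - ?g x \<bullet> c \<partial>?L)"
      by (simp add: m_def inner_diff_right algebra_simps)
    also have "\<dots> = I0 - (\<integral>x. ?g x \<bullet> c \<partial>?L)"
      unfolding I0_def using vi gi gxi by (intro Bochner_Integration.integral_diff) auto
    also have "(\<integral>x. ?g x \<bullet> c \<partial>?L) = c \<bullet> g"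
      unfolding g_def using gi by (simp add: inner_commute)
    finally show ?thesis .
  qed
  have "\<mu> *\<^sub>R a = g"
  proof (rule vector_eq_rdot[THEN iffD1, rule_format])
    fix h
    have aff: "a \<bullet> x + b = (\<Sum>c\<in>C. m c / (n * \<mu>) * (1 - n * ell c x))" for x
      unfolding n_def affine_eq_mid_sum[of a x b] using mid by (intro sum.cong) (auto simp: n_def)
    \<comment> \<open>Isolating the linear part as an increment from 0 makes the constants of the
      local basis drop out.\<close>
    have "a \<bullet> h = (a \<bullet> (0 + h) + b) - (a \<bullet> 0 + b)" by simp
    also have "\<dots> = (\<Sum>c\<in>C. m c / (n * \<mu>) * (1 - n * ell c (0 + h)) - m c / (n * \<mu>) * (1 - n * ell c 0))"
      unfolding aff sum_subtractf ..
    also have "\<dots> = (\<Sum>c\<in>C. - (m c * (grd c \<bullet> h)) / \<mu>)"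
      unfolding ell_add using n \<mu> by (intro sum.cong) (auto simp: field_simps)
    also have "\<dots> = (\<Sum>c\<in>C. (c \<bullet> g) * (grd c \<bullet> h) - I0 * (grd c \<bullet> h)) / \<mu>"
      by (simp add: m sum_divide_distrib algebra_simps)
    also have "(\<Sum>c\<in>C. (c \<bullet> g) * (grd c \<bullet> h) - I0 * (grd c \<bullet> h)) = (\<Sum>c\<in>C. (c \<bullet> g) *\<^sub>R grd c) \<bullet> h - I0 * ((\<Sum>c\<in>C. grd c) \<bullet> h)"
      by (simp add: sum_subtractf inner_sum_left sum_distrib_left)
    also have "\<dots> = g \<bullet> h" by (simp add: sum_vertex_inner_grd sum_grd)
    finally show "\<mu> *\<^sub>R a \<bullet> h = g \<bullet> h" using \<mu> by simp
  qed
  with ab that show ?thesis unfolding \<mu>_def g_def by blast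
qed

lemma I_CR_lin:
  assumes u: "u \<in> H10 \<Omega>" and v: "v \<in> H10 \<Omega>"
  shows "I_CR \<Omega> \<T> (\<lambda>x. \<alpha> * u x + \<beta> * v x) x = \<alpha> * I_CR \<Omega> \<T> u x + \<beta> * I_CR \<Omega> \<T> v x"
proof -
  let ?w = "\<lambda>x. \<alpha> * u x + \<beta> * v x"
  have w: "?w \<in> H10 \<Omega>" by (rule H10_lin[OF open_domain bounded_domain u v])
  have "face_mean ?w F = \<alpha> * face_mean u F + \<beta> * face_mean v F" if F: "F \<in> interior_faces \<Omega> \<T>" for F
  proof -
    obtain T where T: "T \<in> \<T>" "F facet_of T" using F by (auto simp: interior_faces_def faces_def)
    obtain C where C: "full_simplex C" "T = convex hull C" by (rule simplex_vertices[OF T(1)])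
    interpret full_simplex C by (rule C(1))
    obtain c where c: "c \<in> C" "F = convex hull (C - {c})" using T(2) facet_of_iff C(2) by blast
    have TC: "convex hull C \<in> \<T>" using T C by simp
    let ?L = "lebesgue_on (convex hull C)"
    let ?f = "\<lambda>v x. real CARD('n) * v x + weak_grad \<Omega> v x \<bullet> (x - c)"
    have cL: "(\<lambda>x. x - c) \<in> L2 ?L"
      by (intro continuous_L2_compact compact_hull continuous_intros)
    have fi: "integrable ?L (?f v)" if "v \<in> H10 \<Omega>" for v
      using L2_inner_integrable[OF L2_simplex[OF TC weak_grad_L2_domain[OF that]] cL]
        simplex_L2_integrable[OF TC H10_L2_domain[OF that]] by simp
    have "(\<integral>x. ?f ?w x \<partial>?L) = (\<integral>x. \<alpha> * ?f u x + \<beta> * ?f v x \<partial>?L)"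
    proof (rule integral_cong_AE)
      show "?f ?w \<in> borel_measurable ?L" using fi[OF w] by (rule borel_measurable_integrable)
      have "integrable ?L (\<lambda>x. \<alpha> * ?f u x + \<beta> * ?f v x)"
        by (intro Bochner_Integration.integrable_add integrable_mult_right fi u v)
      then show "(\<lambda>x. \<alpha> * ?f u x + \<beta> * ?f v x) \<in> borel_measurable ?L" by (rule borel_measurable_integrable)
      show "AE x in ?L. ?f ?w x = \<alpha> * ?f u x + \<beta> * ?f v x"
        using AE_simplex[OF TC weak_grad_lin[OF open_domain bounded_domain u v, of \<alpha> \<beta>]]
        by eventually_elim (simp add: inner_add_left algebra_simps)
    qed
    also have "\<dots> = \<alpha> * (\<integral>x. ?f u x \<partial>?L) + \<beta> * (\<integral>x. ?f v x \<partial>?L)"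
      using fi[OF u] fi[OF v] by (subst Bochner_Integration.integral_add) (auto intro!: integrable_mult_right simp del: distrib_left_numeral)
    finally show ?thesis
      unfolding c(2) face_mean_formula[OF w C(1) TC c(1)] face_mean_formula[OF u C(1) TC c(1)] face_mean_formula[OF v C(1) TC c(1)]
      by (simp add: add_divide_distrib)
  qed
  then show ?thesis
    unfolding I_CR_eq by (simp add: sum_distrib_left sum.distrib[symmetric] algebra_simps cong: sum.cong)
qed

end

section \<open>Norms of the mesh size\<close>

text \<open>\<open>real_of_ereal\<close> sends infinity to 0, which would falsify the bound;
  \<open>B\<close> excludes this case.\<close>

lemma Linf_norm_AE:
  assumes f: "f \<in> borel_measurable M" and B: "AE x in M. \<bar>f x\<bar> \<le> B"
  shows "AE x in M. \<bar>f x\<bar> \<le> Linf_norm M f"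
proof -
  let ?E = "esssup M (\<lambda>x. ereal \<bar>f x\<bar>)"
  have ae: "AE x in M. ereal \<bar>f x\<bar> \<le> ?E" by (rule esssup_AE)
  have "?E \<le> ereal B" using f B by (intro esssup_I) auto
  then show ?thesis
  proof (cases ?E)
    case (real r)
    then show ?thesis using ae by (simp add: Linf_norm_def)
  next
    \<comment> \<open>An essential supremum of minus infinity means that the whole space is null,
      where everything holds almost everywhere.\<close>
    case MInf
    with ae have "AE x in M. False" by simp
    then show ?thesis by eventually_elim simp
  qed simp
qed

lemma Linf_bounded:
  assumes "V \<in> Linf M"
  obtains B where "AE x in M. \<bar>V x\<bar> \<le> B"
proof -
  let ?E = "esssup M (\<lambda>x. ereal \<bar>V x\<bar>)"
  have ae: "AE x in M. ereal \<bar>V x\<bar> \<le> ?E" by (rule esssup_AE)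
  show ?thesis
  proof (cases ?E)
    case (real r)
    then show ?thesis using ae that by simp
  next
    case PInf
    then show ?thesis using assms by (simp add: Linf_def)
  next
    case MInf
    with ae have "AE x in M. False" by simp
    then have "AE x in M. \<bar>V x\<bar> \<le> 0" by eventually_elim simp
    then show ?thesis by (rule that)
  qed
qed

lemma essinf_zero_AE_nonneg:
  assumes "V \<in> borel_measurable M" "essinf M V = 0"
  shows "AE x in M. 0 \<le> V x"
proof -
  have "esssup M (\<lambda>x. - ereal (V x)) = 0" using assms(2) by (simp add: essinf_def ereal_uminus_eq_reorder)
  then have "AE x in M. - ereal (V x) \<le> 0" using esssup_AE[of "\<lambda>x. - ereal (V x)" M] by simp
  then show ?thesis by eventually_elim simp
qed

lemma bounded_mult_L2:
  fixes f :: "'a \<Rightarrow> real"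
  assumes "h \<in> borel_measurable M" "AE x in M. \<bar>h x\<bar> \<le> B" "f \<in> L2 M"
  shows "(\<lambda>x. h x * f x) \<in> L2 M"
proof -
  note [measurable] = assms(1) L2_measurable[OF assms(3)]
  have "integrable M (\<lambda>x. (norm (h x * f x))\<^sup>2)"
  proof (rule Bochner_Integration.integrable_bound)
    show "integrable M (\<lambda>x. B\<^sup>2 * (norm (f x))\<^sup>2)" using L2_square_integrable[OF assms(3)] by simp
    show "AE x in M. norm ((norm (h x * f x))\<^sup>2) \<le> norm (B\<^sup>2 * (norm (f x))\<^sup>2)"
      using assms(2)
    proof eventually_elim
      case (elim x)
      then have "(h x)\<^sup>2 \<le> B\<^sup>2" using power_mono[OF elim, of 2] by simp
      then show ?case by (simp add: power_mult_distrib mult_right_mono)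
    qed
  qed measurable
  then show ?thesis by (simp add: L2_def)
qed

text \<open>Here \<open>g\<close> and \<open>e\<close> are the energy norms of \<open>v\<close> and of \<open>v - I v\<close>, \<open>p\<close>, \<open>q\<close> are the norms of \<open>v\<close>, \<open>I v\<close> weighted
  by \<open>V\<close>, and \<open>a\<close>, \<open>b\<close> their \<open>L\<^sup>2\<close> norms. The last step is the Cauchy--Schwarz inequality in the plane.\<close>

lemma scalar_lower_bound:
  fixes t A D g e p q a b :: real
  assumes t: "0 \<le> t" and nn: "0 \<le> A" "0 \<le> D" "0 \<le> g" "0 \<le> e" "0 \<le> p" "0 \<le> q" "0 \<le> a" "0 \<le> b"
    and ray: "t * b\<^sup>2 \<le> (g\<^sup>2 - e\<^sup>2) + q\<^sup>2" and ab: "a \<le> b + A * e" and pq: "q \<le> p + D * e" and eg: "e\<^sup>2 \<le> g\<^sup>2"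
  shows "t * a\<^sup>2 \<le> (1 + (sqrt t * A + D)\<^sup>2) * (g\<^sup>2 + p\<^sup>2)"
proof -
  define s where "s = sqrt t"
  have s: "0 \<le> s" "s\<^sup>2 = t" using t by (simp_all add: s_def)
  define h where "h = sqrt (g\<^sup>2 - e\<^sup>2)"
  have h: "0 \<le> h" "h\<^sup>2 = g\<^sup>2 - e\<^sup>2" using eg by (simp_all add: h_def)
  \<comment> \<open>The energy left after removing the defect: \<open>e^2 + f^2\<close> is the full
    exact energy, and \<open>(e, f)\<close> is the vector of the final inequality.\<close>
  define f where "f = sqrt (h\<^sup>2 + p\<^sup>2)"
  have f: "0 \<le> f" "f\<^sup>2 = g\<^sup>2 - e\<^sup>2 + p\<^sup>2" using eg by (simp_all add: f_def h(2))
  have pf: "p \<le> f" unfolding f_def by (rule real_le_rsqrt) simp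
  have "(s * b)\<^sup>2 \<le> (f + D * e)\<^sup>2"
  proof -
    have "(s * b)\<^sup>2 \<le> h\<^sup>2 + q\<^sup>2" using ray by (simp add: power_mult_distrib s h)
    also have "\<dots> \<le> h\<^sup>2 + (p + D * e)\<^sup>2" using pq nn by (intro add_left_mono power_mono) auto
    also have "\<dots> = f\<^sup>2 + 2 * (p * (D * e)) + (D * e)\<^sup>2" by (simp add: f(2) h(2) power2_sum)
    \<comment> \<open>Enlarging \<open>p\<close> to \<open>f\<close> completes the square.\<close>
    also have "\<dots> \<le> f\<^sup>2 + 2 * (f * (D * e)) + (D * e)\<^sup>2"
      using pf nn by (intro add_mono mult_left_mono mult_right_mono order.refl) auto
    also have "\<dots> = (f + D * e)\<^sup>2" by (simp add: power2_sum)
    finally show ?thesis .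
  qed
  then have sb: "s * b \<le> f + D * e" using f nn by (intro power2_le_imp_le[of "s * b" "f + D * e"]) auto
  define c where "c = s * A + D"
  have "s * a \<le> s * b + s * (A * e)" using mult_left_mono[OF ab s(1)] by (simp add: distrib_left)
  with sb have sa: "s * a \<le> c * e + f" by (simp add: c_def algebra_simps)
  have "t * a\<^sup>2 = (s * a)\<^sup>2" by (simp add: power_mult_distrib s)
  also have "\<dots> \<le> (c * e + f)\<^sup>2" using sa s nn by (intro power_mono) auto
  \<comment> \<open>The difference of the two sides is \<open>(e - c f)^2\<close>.\<close>
  also have "\<dots> \<le> (1 + c\<^sup>2) * (e\<^sup>2 + f\<^sup>2)"
    using zero_le_power2[of "e - c * f"] by (simp add: power2_eq_square algebra_simps)
  also have "e\<^sup>2 + f\<^sup>2 = g\<^sup>2 + p\<^sup>2" by (simp add: f)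
  finally show ?thesis by (simp add: c_def s_def)
qed

section \<open>Piecewise affine functions up to null sets, and the mesh constants\<close>

context triangulated_domain
begin

text \<open>Representatives of piecewise affine functions are free on the skeleton, so information
  comes from the interiors; the frontiers of simplices are null sets.\<close>

lemma
  fixes f g :: "real^'n \<Rightarrow> 'b::euclidean_space"
  assumes T: "T \<in> \<T>" and g: "continuous_on UNIV g" and eq: "\<And>x. x \<in> interior T \<Longrightarrow> f x = g x"
  shows L2_simplex_if_interior: "f \<in> L2 (lebesgue_on T)"
    and AE_simplex_if_interior: "AE x in lebesgue_on T. f x = g x"
proof -
  have neg: "negligible (T - interior T)"
    by (rule negligible_subset[OF negligible_simplex_frontier[OF T]])
      (auto simp: frontier_def closure_subset[THEN subsetD])
  have "g \<in> borel_measurable (lebesgue_on (interior T))"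
    using g by (intro measurable_restrict_space1 measurable_completion) (simp add: borel_measurable_continuous_onI)
  moreover have "f \<in> borel_measurable (lebesgue_on (interior T)) \<longleftrightarrow> g \<in> borel_measurable (lebesgue_on (interior T))"
    by (rule measurable_cong) (simp add: space_restrict_space eq)
  ultimately have "f \<in> borel_measurable (lebesgue_on (interior T))" by simp
  then have fm: "f \<in> borel_measurable (lebesgue_on T)"
    by (rule borel_measurable_lebesgue_on_almost_subset[OF _ _ simplex_sets[OF T] neg]) (simp add: borel_open lborelD)
  show ae: "AE x in lebesgue_on T. f x = g x"
    using AE_interior[OF T] by eventually_elim (rule eq)
  have gL: "g \<in> L2 (lebesgue_on T)" by (rule continuous_L2_compact[OF g simplex_compact[OF T]])
  have "integrable (lebesgue_on T) (\<lambda>x. (norm (f x))\<^sup>2) \<longleftrightarrow> integrable (lebesgue_on T) (\<lambda>x. (norm (g x))\<^sup>2)"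
    using ae fm L2_measurable[OF gL] by (intro integrable_cong_AE) (auto elim: eventually_mono)
  then show "f \<in> L2 (lebesgue_on T)" using fm L2_square_integrable[OF gL] by (simp add: L2_def)
qed

lemma AE_domain_if_simplices:
  assumes "\<And>T. T \<in> \<T> \<Longrightarrow> AE x in lebesgue_on T. P x"
  shows "AE x in M. P x"
proof -
  have "AE x in lebesgue. x \<in> T \<longrightarrow> P x" if "T \<in> \<T>" for T
    using assms[OF that] simplex_sets[OF that] by (subst (asm) AE_restrict_space_iff) auto
  then have "AE x in lebesgue. \<forall>T\<in>\<T>. x \<in> T \<longrightarrow> P x"
    using finite_triangulation by (subst AE_ball_countable) (auto simp: countable_finite)
  then have "AE x in lebesgue. x \<in> \<Omega> \<longrightarrow> P x"
  proof eventually_elim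
    case (elim x)
    show ?case
    proof
      assume "x \<in> \<Omega>"
      then have "x \<in> \<Union>\<T>" using closure_subset[of \<Omega>] unfolding closure_domain by blast
      with elim show "P x" by blast
    qed
  qed
  then show ?thesis using domain_sets by (subst AE_restrict_space_iff) auto
qed

text \<open>A simplex has positive measure, so inequalities between constants can be read off from
  almost everywhere statements.\<close>

lemma AE_simplex_const:
  assumes T: "T \<in> \<T>" and "AE x in lebesgue_on T. P"
  shows P
proof (rule ccontr)
  assume "\<not> P"
  then have "AE x in lebesgue_on T. False" using assms(2) by simp
  then have "AE x in lebesgue. x \<notin> T"
    using simplex_sets[OF T] by (subst (asm) AE_restrict_space_iff) auto
  then have "T \<in> null_sets lebesgue"
    using simplex_sets[OF T] by (subst (asm) AE_iff_null_sets[symmetric]) auto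
  then show False using simplex_measure_pos[OF T] by (simp add: null_sets_def measure_def)
qed

lemma P1_L2:
  assumes v: "v \<in> P1 \<T>"
  shows "v \<in> L2 M"
proof (rule L2_domain_if_simplices)
  fix T assume T: "T \<in> \<T>"
  obtain a b where ab: "\<And>y. y \<in> interior T \<Longrightarrow> v y = a \<bullet> y + b" using P1_affine[OF v T] by blast
  have "continuous_on UNIV (\<lambda>y. a \<bullet> y + b)" by (intro continuous_intros)
  then show "v \<in> L2 (lebesgue_on T)" using ab by (rule L2_simplex_if_interior[OF T])
qed

lemma grad_P1_L2:
  assumes v: "v \<in> P1 \<T>" and T: "T \<in> \<T>"
  shows "grad v \<in> L2 (lebesgue_on T)"
proof -
  obtain a b where ab: "\<And>y. y \<in> interior T \<Longrightarrow> v y = a \<bullet> y + b" using P1_affine[OF v T] by blast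
  show ?thesis using grad_affine[of T v a b, OF ab] by (rule L2_simplex_if_interior[OF T continuous_on_const])
qed

lemma grad_P1_lin:
  assumes u: "u \<in> P1 \<T>" and v: "v \<in> P1 \<T>" and T: "T \<in> \<T>" and x: "x \<in> interior T"
  shows "grad (\<lambda>x. \<alpha> * u x + \<beta> * v x) x = \<alpha> *\<^sub>R grad u x + \<beta> *\<^sub>R grad v x"
proof -
  obtain a b where a: "\<And>y. y \<in> interior T \<Longrightarrow> u y = a \<bullet> y + b" using P1_affine[OF u T] by blast
  obtain c d where c: "\<And>y. y \<in> interior T \<Longrightarrow> v y = c \<bullet> y + d" using P1_affine[OF v T] by blast
  have "grad (\<lambda>x. \<alpha> * u x + \<beta> * v x) x = \<alpha> *\<^sub>R a + \<beta> *\<^sub>R c"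
    by (rule grad_affine[OF _ x, of _ _ "\<alpha> * b + \<beta> * d"]) (simp add: a c inner_add_left algebra_simps)
  then show ?thesis using grad_affine[OF a x] grad_affine[OF c x] by simp
qed

lemma a_pw_lin:
  assumes u: "u \<in> P1 \<T>" and v: "v \<in> P1 \<T>" and w: "w \<in> P1 \<T>"
  shows "a_pw \<T> (\<lambda>x. \<alpha> * u x + \<beta> * v x) w = \<alpha> * a_pw \<T> u w + \<beta> * a_pw \<T> v w"
proof -
  have "(\<integral>x. grad (\<lambda>x. \<alpha> * u x + \<beta> * v x) x \<bullet> grad w x \<partial>lebesgue_on T)
    = \<alpha> * (\<integral>x. grad u x \<bullet> grad w x \<partial>lebesgue_on T) + \<beta> * (\<integral>x. grad v x \<bullet> grad w x \<partial>lebesgue_on T)" if T: "T \<in> \<T>" for T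
  proof -
    note L = grad_P1_L2[OF _ T]
    have "(\<integral>x. grad (\<lambda>x. \<alpha> * u x + \<beta> * v x) x \<bullet> grad w x \<partial>lebesgue_on T)
      = (\<integral>x. \<alpha> * (grad u x \<bullet> grad w x) + \<beta> * (grad v x \<bullet> grad w x) \<partial>lebesgue_on T)"
    proof (rule integral_cong_AE)
      show "(\<lambda>x. grad (\<lambda>x. \<alpha> * u x + \<beta> * v x) x \<bullet> grad w x) \<in> borel_measurable (lebesgue_on T)"
        by (intro borel_measurable_integrable L2_inner_integrable L P1_lin u v w)
      show "(\<lambda>x. \<alpha> * (grad u x \<bullet> grad w x) + \<beta> * (grad v x \<bullet> grad w x)) \<in> borel_measurable (lebesgue_on T)"
        by (intro borel_measurable_integrable Bochner_Integration.integrable_add integrable_mult_right L2_inner_integrable L u v w)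
      show "AE x in lebesgue_on T. grad (\<lambda>x. \<alpha> * u x + \<beta> * v x) x \<bullet> grad w x = \<alpha> * (grad u x \<bullet> grad w x) + \<beta> * (grad v x \<bullet> grad w x)"
        using AE_interior[OF T] by eventually_elim (simp add: grad_P1_lin[OF u v T] inner_add_left)
    qed
    then show ?thesis
      using L2_inner_integrable[OF L[OF u] L[OF w]] L2_inner_integrable[OF L[OF v] L[OF w]] by simp
  qed
  then show ?thesis by (simp add: a_pw_def sum.distrib sum_distrib_left)
qed

lemma a_pw_sym: "a_pw \<T> u v = a_pw \<T> v u"
  by (simp add: a_pw_def inner_commute)

text \<open>An affine function that is zero almost everywhere on an open set is zero there, and so
  is its gradient. Thus the discrete form respects equality almost everywhere, modulo which
  dimensions are counted.\<close>

lemma a_pw_AE_zero: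
  assumes u: "u \<in> P1 \<T>" and "AE x in M. u x = 0"
  shows "a_pw \<T> u v = 0"
  unfolding a_pw_def
proof (rule sum.neutral, rule ballI)
  fix T assume T: "T \<in> \<T>"
  obtain a b where ab: "\<And>y. y \<in> interior T \<Longrightarrow> u y = a \<bullet> y + b" using P1_affine[OF u T] by blast
  let ?U = "interior T \<inter> {y. a \<bullet> y + b \<noteq> 0}"
  have "open ?U" by (intro open_Int open_interior open_Collect_neq continuous_intros)
  have "AE x in lebesgue. x \<in> T \<longrightarrow> u x = 0"
    using AE_simplex[OF T assms(2)] simplex_sets[OF T] by (subst (asm) AE_restrict_space_iff) auto
  then have "AE x in lebesgue. x \<notin> ?U"
    by eventually_elim (use ab interior_subset[of T] in auto)
  then have "?U \<in> null_sets lebesgue"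
    using \<open>open ?U\<close> by (subst (asm) AE_iff_null_sets[symmetric]) (auto simp: borel_open lborelD)
  then have "negligible ?U" by (simp only: negligible_iff_null_sets)
  then have "?U = {}" using open_not_negligible[OF \<open>open ?U\<close>] by blast
  then have "u y = 0 \<bullet> y + 0" if "y \<in> interior T" for y using ab that by auto
  then have "grad u x = 0" if "x \<in> interior T" for x using grad_affine[of T u 0 0 x] that by blast
  then show "(\<integral>x. grad u x \<bullet> grad v x \<partial>lebesgue_on T) = 0"
    using AE_interior[OF T] by (intro integral_eq_zero_AE) (auto elim: eventually_mono)
qed

lemma mesh_size_interior: "T \<in> \<T> \<Longrightarrow> x \<in> interior T \<Longrightarrow> mesh_size \<T> x = diameter T"
proof -
  assume T: "T \<in> \<T>" "x \<in> interior T"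
  have "(THE T. T \<in> \<T> \<and> x \<in> interior T) = T"
    using T interior_disjoint_simplex interior_subset by (intro the_equality) blast+
  then show ?thesis by (simp add: mesh_size_def)
qed

lemma mesh_measurable: "(\<lambda>x. c * (mesh_size \<T> x)\<^sup>2) \<in> borel_measurable M"
proof -
  have "(\<lambda>x. c * (mesh_size \<T> x)\<^sup>2) \<in> L2 M"
    by (intro L2_domain_if_simplices L2_simplex_if_interior[OF _ continuous_on_const]) (simp_all add: mesh_size_interior)
  then show ?thesis by (rule L2_measurable)
qed

text \<open>A crude sum over all simplices suffices, as only finiteness of the essential supremum is
  at stake.\<close>

lemma mesh_AE_bounded: "AE x in M. \<bar>c * (mesh_size \<T> x)\<^sup>2\<bar> \<le> (\<Sum>T\<in>\<T>. \<bar>c * (diameter T)\<^sup>2\<bar>)"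
proof (rule AE_domain_if_simplices)
  fix T assume T: "T \<in> \<T>"
  show "AE x in lebesgue_on T. \<bar>c * (mesh_size \<T> x)\<^sup>2\<bar> \<le> (\<Sum>T\<in>\<T>. \<bar>c * (diameter T)\<^sup>2\<bar>)"
    using AE_interior[OF T]
  proof eventually_elim
    case (elim x)
    then show ?case
      using member_le_sum[of T \<T> "\<lambda>T. \<bar>c * (diameter T)\<^sup>2\<bar>"] T finite_triangulation by (simp add: mesh_size_interior)
  qed
qed

lemma mesh_epsilon_bound:
  assumes T: "T \<in> \<T>"
  shows "\<kappa>\<^sup>2 * (diameter T)\<^sup>2 \<le> mesh_epsilon \<Omega> \<T> \<kappa>"
proof (rule AE_simplex_const[OF T])
  show "AE x in lebesgue_on T. \<kappa>\<^sup>2 * (diameter T)\<^sup>2 \<le> mesh_epsilon \<Omega> \<T> \<kappa>"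
    using AE_simplex[OF T Linf_norm_AE[OF mesh_measurable mesh_AE_bounded, of "\<kappa>\<^sup>2"]] AE_interior[OF T]
    by eventually_elim (simp add: mesh_size_interior[OF T] mesh_epsilon_def)
qed

text \<open>The product with \<open>V\<close> is essentially bounded because both factors are, as
  \<open>Linf_norm_AE\<close> requires.\<close>

lemma mesh_delta_bound:
  assumes V: "V \<in> Linf M" and T: "T \<in> \<T>"
  shows "AE x in lebesgue_on T. \<kappa>\<^sup>2 * (diameter T)\<^sup>2 * \<bar>V x\<bar> \<le> mesh_delta \<Omega> \<T> V \<kappa>"
proof -
  obtain B where B: "AE x in M. \<bar>V x\<bar> \<le> B" using Linf_bounded[OF V] by blast
  have Vm: "V \<in> borel_measurable M" using V by (simp add: Linf_def)
  define S where "S = (\<Sum>T\<in>\<T>. \<bar>\<kappa>\<^sup>2 * (diameter T)\<^sup>2\<bar>)"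
  have m: "(\<lambda>x. \<kappa>\<^sup>2 * (mesh_size \<T> x)\<^sup>2 * V x) \<in> borel_measurable M"
    by (intro borel_measurable_times mesh_measurable Vm)
  have "AE x in M. \<bar>\<kappa>\<^sup>2 * (mesh_size \<T> x)\<^sup>2 * V x\<bar> \<le> S * B"
    using mesh_AE_bounded[of "\<kappa>\<^sup>2"] B unfolding S_def[symmetric]
  proof eventually_elim
    case (elim x)
    have "\<bar>\<kappa>\<^sup>2 * (mesh_size \<T> x)\<^sup>2\<bar> * \<bar>V x\<bar> \<le> S * B"
      using elim by (intro mult_mono) (auto simp: S_def intro: sum_nonneg)
    then show ?case by (simp only: abs_mult)
  qed
  from AE_simplex[OF T Linf_norm_AE[OF m this]] AE_interior[OF T] show ?thesis
    by eventually_elim (simp add: mesh_size_interior[OF T] mesh_delta_def abs_mult)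
qed

text \<open>Makes \<open>\<epsilon>\<close> positive and permits division by the local factor
  \<open>\<kappa>^2 h^2\<close>.\<close>

lemma diameter_simplex_pos:
  assumes T: "T \<in> \<T>"
  shows "0 < diameter T"
proof -
  obtain x r where r: "r > 0" "ball x r \<subseteq> T"
    using simplex_interior_nonempty[OF T] by (auto simp: mem_interior)
  obtain i :: 'n where True by blast
  let ?y = "x + (r / 2) *\<^sub>R axis i 1"
  have "x \<in> T" "?y \<in> T" using r by (auto intro!: subsetD[OF r(2)] simp: dist_norm)
  then have "dist x ?y \<le> diameter T"
    using compact_imp_bounded[OF simplex_compact[OF T]] by (intro diameter_bounded_bound)
  moreover have "dist x ?y = r / 2" using r by (simp add: dist_norm)
  ultimately show ?thesis using r by simp
qed

end

section \<open>Guaranteed lower bounds\<close>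

locale CR_problem = triangulated_domain \<Omega> \<T>
  for \<Omega> :: "(real^'n) set" and \<T> +
  fixes V :: "real^'n \<Rightarrow> real" and \<kappa> :: real
  assumes V: "V \<in> Linf M" and V_nonneg: "essinf M V = 0" and \<kappa>: "CR_interpolation_constant \<Omega> \<T> \<kappa>"
begin

lemma V_measurable: "V \<in> borel_measurable M"
  using V by (simp add: Linf_def)

lemma AE_V_nonneg: "AE x in M. 0 \<le> V x"
  by (rule essinf_zero_AE_nonneg[OF V_measurable V_nonneg])

lemma sqrt_V_L2:
  assumes f: "f \<in> L2 M"
  shows "(\<lambda>x. sqrt (V x) * f x) \<in> L2 M"
proof -
  obtain B where B: "AE x in M. \<bar>V x\<bar> \<le> B" using Linf_bounded[OF V] by blast
  have "(\<lambda>x. sqrt (V x)) \<in> borel_measurable M" using V_measurable by measurable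
  moreover have "AE x in M. \<bar>sqrt (V x)\<bar> \<le> sqrt B" using B AE_V_nonneg by eventually_elim simp
  ultimately show ?thesis using f by (rule bounded_mult_L2)
qed

lemma V_L2:
  assumes f: "f \<in> L2 M"
  shows "(\<lambda>x. V x * f x) \<in> L2 M"
proof -
  obtain B where "AE x in M. \<bar>V x\<bar> \<le> B" using Linf_bounded[OF V] by blast
  then show ?thesis using V_measurable f by (intro bounded_mult_L2)
qed

lemma V_integrable: "f \<in> L2 M \<Longrightarrow> g \<in> L2 M \<Longrightarrow> integrable M (\<lambda>x. V x * f x * g x)"
  using L2_mult_integrable[OF V_L2] by blast

lemma V_integral_lin:
  assumes "f \<in> L2 M" "g \<in> L2 M" "h \<in> L2 M"
  shows "(\<integral>x. V x * (\<alpha> * f x + \<beta> * g x) * h x \<partial>M) = \<alpha> * (\<integral>x. V x * f x * h x \<partial>M) + \<beta> * (\<integral>x. V x * g x * h x \<partial>M)"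
proof -
  have "(\<lambda>x. V x * (\<alpha> * f x + \<beta> * g x) * h x) = (\<lambda>x. \<alpha> * (V x * f x * h x) + \<beta> * (V x * g x * h x))"
    by (simp add: fun_eq_iff algebra_simps)
  then show ?thesis using V_integrable[OF assms(1,3)] V_integrable[OF assms(2,3)] by simp
qed

lemma V_integral_sym: "(\<integral>x. V x * f x * g x \<partial>M) = (\<integral>x. V x * g x * f x \<partial>M)"
  by (simp add: mult_ac)

text \<open>Writing the potential term as the \<open>L2\<close> norm of \<open>sqrt V * f\<close>
  makes the triangle inequality available; \<open>V\<close> is nonnegative only almost
  everywhere.\<close>

lemma V_norm: 
  assumes "f \<in> L2 M"
  shows "(\<integral>x. V x * f x * f x \<partial>M) = (L2_norm M (\<lambda>x. sqrt (V x) * f x))\<^sup>2"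
  unfolding L2_norm_power2
proof (rule integral_cong_AE)
  show "(\<lambda>x. V x * f x * f x) \<in> borel_measurable M" by (intro borel_measurable_integrable V_integrable assms)
  show "(\<lambda>x. (norm (sqrt (V x) * f x))\<^sup>2) \<in> borel_measurable M"
    by (intro borel_measurable_integrable L2_square_integrable sqrt_V_L2 assms)
  show "AE x in M. V x * f x * f x = (norm (sqrt (V x) * f x))\<^sup>2"
    using AE_V_nonneg by eventually_elim (simp add: power_mult_distrib power2_eq_square[of "f _"])
qed

definition exact_form :: "(real^'n \<Rightarrow> real) \<Rightarrow> (real^'n \<Rightarrow> real) \<Rightarrow> real" where
  "exact_form u v = (\<integral>x. weak_grad \<Omega> u x \<bullet> weak_grad \<Omega> v x \<partial>M) + (\<integral>x. V x * u x * v x \<partial>M)"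

definition CR_form :: "(real^'n \<Rightarrow> real) \<Rightarrow> (real^'n \<Rightarrow> real) \<Rightarrow> real" where
  "CR_form u v = a_pw \<T> u v + (\<integral>x. V x * u x * v x \<partial>M)"

sublocale exact: symmetric_form M "H10 \<Omega>" exact_form
proof
  show "(\<lambda>x. 0) \<in> H10 \<Omega>" by (rule H10_zero[OF open_domain bounded_domain])
  fix u v assume u: "u \<in> H10 \<Omega>" and v: "v \<in> H10 \<Omega>"
  show "(\<lambda>x. \<alpha> * u x + \<beta> * v x) \<in> H10 \<Omega>" for \<alpha> \<beta> by (rule H10_lin[OF open_domain bounded_domain u v])
  show "integrable M (\<lambda>x. u x * v x)" by (intro L2_mult_integrable H10_L2_domain u v)
  show "exact_form u v = exact_form v u"
    using V_integral_sym[of u v] by (simp add: exact_form_def inner_commute)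
  fix w and \<alpha> \<beta> :: real assume w: "w \<in> H10 \<Omega>"
  let ?z = "\<lambda>x. \<alpha> * u x + \<beta> * v x"
  have z: "?z \<in> H10 \<Omega>" by (rule H10_lin[OF open_domain bounded_domain u v])
  note i = L2_inner_integrable[OF weak_grad_L2_domain weak_grad_L2_domain[OF w]]
  have "(\<integral>x. weak_grad \<Omega> ?z x \<bullet> weak_grad \<Omega> w x \<partial>M)
    = (\<integral>x. \<alpha> * (weak_grad \<Omega> u x \<bullet> weak_grad \<Omega> w x) + \<beta> * (weak_grad \<Omega> v x \<bullet> weak_grad \<Omega> w x) \<partial>M)"
  proof (rule integral_cong_AE)
    show "(\<lambda>x. weak_grad \<Omega> ?z x \<bullet> weak_grad \<Omega> w x) \<in> borel_measurable M"
      by (rule borel_measurable_integrable[OF i[OF z]])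
    show "(\<lambda>x. \<alpha> * (weak_grad \<Omega> u x \<bullet> weak_grad \<Omega> w x) + \<beta> * (weak_grad \<Omega> v x \<bullet> weak_grad \<Omega> w x)) \<in> borel_measurable M"
      by (intro borel_measurable_integrable Bochner_Integration.integrable_add integrable_mult_right i u v)
    show "AE x in M. weak_grad \<Omega> ?z x \<bullet> weak_grad \<Omega> w x
      = \<alpha> * (weak_grad \<Omega> u x \<bullet> weak_grad \<Omega> w x) + \<beta> * (weak_grad \<Omega> v x \<bullet> weak_grad \<Omega> w x)"
      using weak_grad_lin[OF open_domain bounded_domain u v, of \<alpha> \<beta>] by eventually_elim (simp add: inner_add_left)
  qed
  also have "\<dots> = \<alpha> * (\<integral>x. weak_grad \<Omega> u x \<bullet> weak_grad \<Omega> w x \<partial>M) + \<beta> * (\<integral>x. weak_grad \<Omega> v x \<bullet> weak_grad \<Omega> w x \<partial>M)"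
    using i[OF u] i[OF v] by simp
  finally show "exact_form ?z w = \<alpha> * exact_form u w + \<beta> * exact_form v w"
    using V_integral_lin[OF H10_L2_domain[OF u] H10_L2_domain[OF v] H10_L2_domain[OF w], of \<alpha> \<beta>]
    by (simp add: exact_form_def algebra_simps)
qed

lemma CR10_L2: "v \<in> CR10 \<Omega> \<T> \<Longrightarrow> v \<in> L2 M"
  by (intro P1_L2 CR10_P1)

sublocale CR: symmetric_form M "CR10 \<Omega> \<T>" CR_form
proof
  show "(\<lambda>x. 0) \<in> CR10 \<Omega> \<T>" by (rule CR10_zero)
  fix u v assume u: "u \<in> CR10 \<Omega> \<T>" and v: "v \<in> CR10 \<Omega> \<T>"
  show "(\<lambda>x. \<alpha> * u x + \<beta> * v x) \<in> CR10 \<Omega> \<T>" for \<alpha> \<beta> by (rule CR10_lin[OF u v])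
  show "integrable M (\<lambda>x. u x * v x)" by (intro L2_mult_integrable CR10_L2 u v)
  show "CR_form u v = CR_form v u"
    using V_integral_sym[of u v] a_pw_sym[of u v] by (simp add: CR_form_def)
  fix w and \<alpha> \<beta> :: real assume w: "w \<in> CR10 \<Omega> \<T>"
  show "CR_form (\<lambda>x. \<alpha> * u x + \<beta> * v x) w = \<alpha> * CR_form u w + \<beta> * CR_form v w"
    using V_integral_lin[OF CR10_L2[OF u] CR10_L2[OF v] CR10_L2[OF w], of \<alpha> \<beta>]
      a_pw_lin[OF CR10_P1[OF u] CR10_P1[OF v] CR10_P1[OF w], of \<alpha> \<beta>]
    by (simp add: CR_form_def algebra_simps)
qed

lemma CR_form_AE_zero:
  assumes "u \<in> CR10 \<Omega> \<T>" "AE x in M. u x = 0"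
  shows "CR_form u v = 0"
proof -
  have "(\<integral>x. V x * u x * v x \<partial>M) = 0"
    using assms(2) by (intro integral_eq_zero_AE) (auto elim: eventually_mono)
  then show ?thesis using a_pw_AE_zero[OF CR10_P1[OF assms(1)] assms(2)] by (simp add: CR_form_def)
qed

lemma exact_eigs: "exact.eigs = eigenspace \<Omega> V"
  by (simp add: fun_eq_iff exact.eigs_def eigenspace_def exact_form_def)

lemma CR_eigs: "CR.eigs = CR_eigenspace \<Omega> \<T> V"
  by (simp add: fun_eq_iff CR.eigs_def CR_eigenspace_def CR_form_def)

text \<open>The \<open>e\<close> of the overview. It is assembled from the simplices because
  \<open>grad\<close> of a piecewise affine function is meaningful only in their interiors.\<close>

definition defect :: "(real^'n \<Rightarrow> real) \<Rightarrow> real" where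
  "defect v = sqrt (\<Sum>T\<in>\<T>. (L2_norm (lebesgue_on T) (\<lambda>x. weak_grad \<Omega> v x - grad (I_CR \<Omega> \<T> v) x))\<^sup>2)"

lemma defect_nonneg: "0 \<le> defect v"
  by (simp add: defect_def sum_nonneg)

lemma defect_power2: "(defect v)\<^sup>2 = (\<Sum>T\<in>\<T>. (L2_norm (lebesgue_on T) (\<lambda>x. weak_grad \<Omega> v x - grad (I_CR \<Omega> \<T> v) x))\<^sup>2)"
  by (simp add: defect_def sum_nonneg)

text \<open>Pythagoras on each simplex: the gradient of the interpolant is the mean of
  \<open>weak_grad\<close>, and subtracting the mean leaves a field orthogonal to constants.\<close>

lemma energy_split:
  assumes v: "v \<in> H10 \<Omega>"
  shows "(L2_norm M (weak_grad \<Omega> v))\<^sup>2 = a_pw \<T> (I_CR \<Omega> \<T> v) (I_CR \<Omega> \<T> v) + (defect v)\<^sup>2"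
proof -
  let ?w = "I_CR \<Omega> \<T> v" and ?g = "weak_grad \<Omega> v"
  have "(L2_norm (lebesgue_on T) ?g)\<^sup>2 = (\<integral>x. grad ?w x \<bullet> grad ?w x \<partial>lebesgue_on T) + (L2_norm (lebesgue_on T) (\<lambda>x. ?g x - grad ?w x))\<^sup>2"
    if T: "T \<in> \<T>" for T
  proof -
    let ?L = "lebesgue_on T"
    obtain a b where ab: "\<And>x. x \<in> interior T \<Longrightarrow> ?w x = a \<bullet> x + b"
      and a: "measure lebesgue T *\<^sub>R a = (\<integral>x. ?g x \<partial>?L)" using I_CR_mean_gradient[OF v T] by blast
    note gL = L2_simplex[OF T weak_grad_L2_domain[OF v]] and wL = grad_P1_L2[OF CR10_P1[OF I_CR_CR10] T, of v]
    have gr: "AE x in ?L. grad ?w x = a"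
      using AE_interior[OF T] by eventually_elim (rule grad_affine[OF ab])
    have fin: "finite_measure ?L" by (rule finite_measure_simplex[OF T])
    have gi: "integrable ?L ?g" by (rule L2_integrable[OF fin gL])
    have cross: "(\<integral>x. (?g x - grad ?w x) \<bullet> grad ?w x \<partial>?L) = 0"
    proof -
      have "(\<integral>x. (?g x - grad ?w x) \<bullet> grad ?w x \<partial>?L) = (\<integral>x. ?g x \<bullet> a - a \<bullet> a \<partial>?L)"
      proof (rule integral_cong_AE)
        show "(\<lambda>x. (?g x - grad ?w x) \<bullet> grad ?w x) \<in> borel_measurable ?L"
          by (intro borel_measurable_integrable L2_inner_integrable L2_diff gL wL)
        show "(\<lambda>x. ?g x \<bullet> a - a \<bullet> a) \<in> borel_measurable ?L" using gi by (auto intro!: borel_measurable_integrable)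
        show "AE x in ?L. (?g x - grad ?w x) \<bullet> grad ?w x = ?g x \<bullet> a - a \<bullet> a"
          using gr by eventually_elim (simp add: inner_diff_left)
      qed
      also have "\<dots> = (\<integral>x. ?g x \<partial>?L) \<bullet> a - measure lebesgue T * (a \<bullet> a)"
        using gi finite_measure.integrable_const[OF fin, of "a \<bullet> a"] simplex_sets[OF T]
        by (simp add: measure_restrict_space)
      also have "\<dots> = 0" by (simp add: a[symmetric])
      finally show ?thesis .
    qed
    have "(L2_norm ?L (\<lambda>x. (?g x - grad ?w x) + grad ?w x))\<^sup>2 = (L2_norm ?L (\<lambda>x. ?g x - grad ?w x))\<^sup>2 + (L2_norm ?L (grad ?w))\<^sup>2"
      unfolding L2_norm_add_power2[OF L2_diff[OF gL wL] wL] cross by simp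
    then show ?thesis by (simp add: L2_norm_power2 power2_norm_eq_inner)
  qed
  then show ?thesis
    unfolding L2_norm_domain_split[OF weak_grad_L2_domain[OF v]] defect_power2 a_pw_def
    by (simp add: sum.distrib)
qed

lemma defect_le:
  assumes v: "v \<in> H10 \<Omega>"
  shows "(defect v)\<^sup>2 \<le> (L2_norm M (weak_grad \<Omega> v))\<^sup>2"
proof -
  have "0 \<le> a_pw \<T> (I_CR \<Omega> \<T> v) (I_CR \<Omega> \<T> v)"
    unfolding a_pw_def by (intro sum_nonneg Bochner_Integration.integral_nonneg) simp
  then show ?thesis using energy_split[OF v] by simp
qed

section \<open>Interpolation error in the plain and the weighted norm\<close>

lemma residual_L2: "v \<in> H10 \<Omega> \<Longrightarrow> (\<lambda>x. v x - I_CR \<Omega> \<T> v x) \<in> L2 M"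
  by (intro L2_diff H10_L2_domain CR10_L2 I_CR_CR10)

lemma local_interpolation:
  assumes v: "v \<in> H10 \<Omega>" and T: "T \<in> \<T>"
  shows "(L2_norm (lebesgue_on T) (\<lambda>x. v x - I_CR \<Omega> \<T> v x))\<^sup>2
    \<le> \<kappa>\<^sup>2 * (diameter T)\<^sup>2 * (L2_norm (lebesgue_on T) (\<lambda>x. weak_grad \<Omega> v x - grad (I_CR \<Omega> \<T> v) x))\<^sup>2"
proof -
  have "L2_norm (lebesgue_on T) (\<lambda>x. v x - I_CR \<Omega> \<T> v x)
    \<le> \<kappa> * diameter T * L2_norm (lebesgue_on T) (\<lambda>x. weak_grad \<Omega> v x - grad (I_CR \<Omega> \<T> v) x)"
    using \<kappa> v T by (simp add: CR_interpolation_constant_def)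
  from power_mono[OF this L2_norm_nonneg, of 2] show ?thesis by (simp add: power_mult_distrib)
qed

abbreviation "\<epsilon> \<equiv> mesh_epsilon \<Omega> \<T> \<kappa>"
abbreviation "\<delta> \<equiv> mesh_delta \<Omega> \<T> V \<kappa>"

lemma \<kappa>_pos: "0 < \<kappa>"
  using \<kappa> by (simp add: CR_interpolation_constant_def)

lemma triangulation_nonempty: "\<T> \<noteq> {}"
  using closure_domain domain_nonempty closure_subset by fastforce

lemma \<epsilon>_pos: "0 < \<epsilon>"
proof -
  obtain T where T: "T \<in> \<T>" using triangulation_nonempty by blast
  have "0 < \<kappa>\<^sup>2 * (diameter T)\<^sup>2" using diameter_simplex_pos[OF T] \<kappa>_pos by simp
  then show ?thesis using mesh_epsilon_bound[OF T, of \<kappa>] by linarith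
qed

lemma \<delta>_nonneg: "0 \<le> \<delta>"
proof -
  obtain T where T: "T \<in> \<T>" using triangulation_nonempty by blast
  show ?thesis
  proof (rule AE_simplex_const[OF T])
    show "AE x in lebesgue_on T. 0 \<le> \<delta>"
      using mesh_delta_bound[OF V T, of \<kappa>]
      by eventually_elim (meson abs_ge_zero mult_nonneg_nonneg order.trans zero_le_power2)
  qed
qed

lemma residual_norm:
  assumes v: "v \<in> H10 \<Omega>"
  shows "L2_norm M (\<lambda>x. v x - I_CR \<Omega> \<T> v x) \<le> sqrt \<epsilon> * defect v"
proof (rule power2_le_imp_le)
  have "(L2_norm M (\<lambda>x. v x - I_CR \<Omega> \<T> v x))\<^sup>2 \<le> (\<Sum>T\<in>\<T>. \<epsilon> * (L2_norm (lebesgue_on T) (\<lambda>x. weak_grad \<Omega> v x - grad (I_CR \<Omega> \<T> v) x))\<^sup>2)"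
    unfolding L2_norm_domain_split[OF residual_L2[OF v]]
    by (intro sum_mono order.trans[OF local_interpolation[OF v]] mult_right_mono mesh_epsilon_bound) auto
  then show "(L2_norm M (\<lambda>x. v x - I_CR \<Omega> \<T> v x))\<^sup>2 \<le> (sqrt \<epsilon> * defect v)\<^sup>2"
    using \<epsilon>_pos by (simp add: power_mult_distrib defect_power2 sum_distrib_left)
  show "0 \<le> sqrt \<epsilon> * defect v" using \<epsilon>_pos defect_nonneg by simp
qed

text \<open>\<open>\<delta>\<close> bounds the product \<open>q V\<close> with
  \<open>q = \<kappa>^2 h^2\<close>, not \<open>V\<close> itself. Multiplying the local integral by
  \<open>q\<close> brings in \<open>\<delta>\<close>, the interpolation estimate returns another
  \<open>q\<close>, and the two cancel.\<close>

lemma residual_V_norm: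
  assumes v: "v \<in> H10 \<Omega>"
  shows "L2_norm M (\<lambda>x. sqrt (V x) * (v x - I_CR \<Omega> \<T> v x)) \<le> sqrt \<delta> * defect v"
proof (rule power2_le_imp_le)
  let ?r = "\<lambda>x. v x - I_CR \<Omega> \<T> v x"
  have rL: "?r \<in> L2 M" by (rule residual_L2[OF v])
  have "(\<integral>x. V x * ?r x * ?r x \<partial>lebesgue_on T) \<le> \<delta> * (L2_norm (lebesgue_on T) (\<lambda>x. weak_grad \<Omega> v x - grad (I_CR \<Omega> \<T> v) x))\<^sup>2"
    if T: "T \<in> \<T>" for T
  proof -
    let ?L = "lebesgue_on T"
    define q where "q = \<kappa>\<^sup>2 * (diameter T)\<^sup>2"
    have q: "q > 0" using diameter_simplex_pos[OF T] \<kappa>_pos by (simp add: q_def)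
    have "q * (\<integral>x. V x * ?r x * ?r x \<partial>?L) = (\<integral>x. q * (V x * ?r x * ?r x) \<partial>?L)" by simp
    also have "\<dots> \<le> (\<integral>x. \<delta> * (norm (?r x))\<^sup>2 \<partial>?L)"
    proof (rule integral_mono_AE)
      show "integrable ?L (\<lambda>x. q * (V x * ?r x * ?r x))"
        by (intro integrable_mult_right integrable_simplex[OF T] V_integrable rL)
      show "integrable ?L (\<lambda>x. \<delta> * (norm (?r x))\<^sup>2)"
        by (intro integrable_mult_right L2_square_integrable L2_simplex[OF T rL])
      show "AE x in ?L. q * (V x * ?r x * ?r x) \<le> \<delta> * (norm (?r x))\<^sup>2"
        using mesh_delta_bound[OF V T, of \<kappa>]
      proof eventually_elim
        case (elim x)
        have "q * V x \<le> q * \<bar>V x\<bar>" using q by simp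
        also have "\<dots> \<le> \<delta>" using elim by (simp add: q_def)
        finally have "q * V x * (?r x)\<^sup>2 \<le> \<delta> * (?r x)\<^sup>2" by (rule mult_right_mono) simp
        then show ?case by (simp add: power2_eq_square mult.assoc)
      qed
    qed
    also have "\<dots> = \<delta> * (L2_norm ?L ?r)\<^sup>2" by (simp add: L2_norm_power2)
    also have "\<dots> \<le> \<delta> * (q * (L2_norm ?L (\<lambda>x. weak_grad \<Omega> v x - grad (I_CR \<Omega> \<T> v) x))\<^sup>2)"
      using local_interpolation[OF v T] \<delta>_nonneg unfolding q_def by (rule mult_left_mono)
    finally have "q * (\<integral>x. V x * ?r x * ?r x \<partial>?L) \<le> q * (\<delta> * (L2_norm ?L (\<lambda>x. weak_grad \<Omega> v x - grad (I_CR \<Omega> \<T> v) x))\<^sup>2)"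
      by (simp only: mult.left_commute)
    then show ?thesis using q by (rule mult_left_le_imp_le)
  qed
  then have "(\<integral>x. V x * ?r x * ?r x \<partial>M) \<le> (\<Sum>T\<in>\<T>. \<delta> * (L2_norm (lebesgue_on T) (\<lambda>x. weak_grad \<Omega> v x - grad (I_CR \<Omega> \<T> v) x))\<^sup>2)"
    unfolding integral_domain_split[OF V_integrable[OF rL rL]] by (rule sum_mono)
  then show "(L2_norm M (\<lambda>x. sqrt (V x) * ?r x))\<^sup>2 \<le> (sqrt \<delta> * defect v)\<^sup>2"
    using \<delta>_nonneg unfolding V_norm[OF rL] by (simp add: power_mult_distrib defect_power2 sum_distrib_left)
  show "0 \<le> sqrt \<delta> * defect v" using \<delta>_nonneg defect_nonneg by simp
qed

lemma exact_form_self: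
  assumes "v \<in> H10 \<Omega>"
  shows "exact_form v v = (L2_norm M (weak_grad \<Omega> v))\<^sup>2 + (L2_norm M (\<lambda>x. sqrt (V x) * v x))\<^sup>2"
  unfolding exact_form_def V_norm[OF H10_L2_domain[OF assms]] by (simp add: L2_norm_power2 power2_norm_eq_inner)

lemma norm_le_interpolant:
  assumes v: "v \<in> H10 \<Omega>"
  shows "L2_norm M v \<le> L2_norm M (I_CR \<Omega> \<T> v) + sqrt \<epsilon> * defect v"
  using L2_norm_triangle[OF CR10_L2[OF I_CR_CR10] residual_L2[OF v], of v] residual_norm[OF v] by simp

lemma V_norm_interpolant_le:
  assumes v: "v \<in> H10 \<Omega>"
  shows "L2_norm M (\<lambda>x. sqrt (V x) * I_CR \<Omega> \<T> v x) \<le> L2_norm M (\<lambda>x. sqrt (V x) * v x) + sqrt \<delta> * defect v"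
proof -
  let ?f = "\<lambda>x. sqrt (V x) * v x" and ?h = "\<lambda>x. sqrt (V x) * I_CR \<Omega> \<T> v x"
  have L: "?f \<in> L2 M" "?h \<in> L2 M" by (intro sqrt_V_L2 H10_L2_domain[OF v] CR10_L2 I_CR_CR10)+
  have "L2_norm M ?h \<le> L2_norm M ?f + L2_norm M (\<lambda>x. ?h x - ?f x)"
    using L2_norm_triangle[OF L(1) L2_diff[OF L(2,1)]] by simp
  also have "L2_norm M (\<lambda>x. ?h x - ?f x) = L2_norm M (\<lambda>x. sqrt (V x) * (v x - I_CR \<Omega> \<T> v x))"
    unfolding L2_norm_minus_commute[of M ?h ?f] by (simp add: right_diff_distrib)
  finally show ?thesis using residual_V_norm[OF v] by simp
qed

section \<open>Test vectors and the two lower bounds\<close>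

lemma I_CR_sum:
  assumes "finite K" "\<And>i. i \<in> K \<Longrightarrow> e i \<in> H10 \<Omega>"
  shows "I_CR \<Omega> \<T> (\<lambda>x. \<Sum>i\<in>K. c i * e i x) x = (\<Sum>i\<in>K. c i * I_CR \<Omega> \<T> (e i) x)"
  using assms
proof (induction K rule: finite_induct)
  case empty
  then show ?case using I_CR_lin[OF exact.zero_mem exact.zero_mem, of 0 0 x] by simp
next
  case (insert i K)
  then show ?case
    using I_CR_lin[of "e i" "\<lambda>x. \<Sum>i\<in>K. c i * e i x" "c i" 1 x] exact.sum_mem[of K e c] by simp
qed

text \<open>There are \<open>k\<close> coefficients and \<open>m < k\<close> orthogonality
  conditions, linear in them because \<open>I_CR\<close> is. The case \<open>m = k - 1\<close>
  serves a finite discrete eigenvalue, \<open>m = N\<close> an index beyond the dimension.\<close>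

lemma test_vector:
  fixes f :: "nat \<Rightarrow> real^'n \<Rightarrow> real"
  assumes ev: "exact_eigenvalues \<Omega> V lam" and k: "m < k" and f: "\<And>j. j < m \<Longrightarrow> f j \<in> CR10 \<Omega> \<T>"
  obtains v where "v \<in> H10 \<Omega>" "0 < L2_norm M v" "exact_form v v \<le> lam k * (L2_norm M v)\<^sup>2"
    "\<And>j. j < m \<Longrightarrow> (\<integral>x. f j x * I_CR \<Omega> \<T> v x \<partial>M) = 0"
proof -
  have ev': "lists_eigenvalues M exact.eigs {1..} lam" using ev by (simp add: exact_eigenvalues_def exact_eigs)
  obtain e where e: "\<And>j. j \<in> {1..} \<Longrightarrow> e j \<in> exact.eigs (lam j)"
    and ind: "\<And>K c. finite K \<Longrightarrow> K \<subseteq> {1..} \<Longrightarrow> AE x in M. (\<Sum>j\<in>K. c j * e j x) = 0 \<Longrightarrow> \<forall>j\<in>K. c j = 0"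
    using exact.eigenbasis[OF ev'] by blast
  have eH: "e j \<in> H10 \<Omega>" if "1 \<le> j" for j using exact.eigs_mem[OF e] that by simp
  obtain y where y: "\<exists>i<k. y i \<noteq> 0" "\<forall>j<m. (\<Sum>i<k. (\<integral>x. f j x * I_CR \<Omega> \<T> (e (Suc i)) x \<partial>M) * y i) = 0"
    using homogeneous_system_nontrivial_solution[OF k, of "\<lambda>j i. \<integral>x. f j x * I_CR \<Omega> \<T> (e (Suc i)) x \<partial>M"] by blast
  \<comment> \<open>Eigenfunctions are numbered from 1, the unknowns of the linear system from
    0.\<close>
  define c where "c j = y (j - 1)" for j
  define v where "v = (\<lambda>x. \<Sum>j\<in>{1..k}. c j * e j x)"
  have re: "(\<Sum>j\<in>{1..k}. c j * g j) = (\<Sum>i<k. y i * g (Suc i))" for g :: "nat \<Rightarrow> real"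
    by (simp add: sum.atLeast1_atMost_eq c_def)
  have v: "v \<in> H10 \<Omega>" unfolding v_def using eH by (intro exact.sum_mem) auto
  have "\<not> (AE x in M. v x = 0)"
  proof
    assume "AE x in M. v x = 0"
    then have *: "\<forall>j\<in>{1..k}. c j = 0" unfolding v_def by (intro ind) auto
    obtain i where "i < k" "y i \<noteq> 0" using y(1) by blast
    then show False using *[rule_format, of "Suc i"] by (simp add: c_def)
  qed
  then have "(\<integral>x. v x * v x \<partial>M) \<noteq> 0" using exact.ip_self_0[OF v] by blast
  moreover have ip: "(\<integral>x. v x * v x \<partial>M) = (L2_norm M v)\<^sup>2"
    unfolding L2_norm_power2 by (simp add: power2_eq_square)
  ultimately have pos: "0 < L2_norm M v" using L2_norm_nonneg[of M v] by (cases "L2_norm M v = 0") auto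
  have mono: "mono_on {1..} lam" using ev' by (simp add: lists_eigenvalues_def)
  have "exact_form v v \<le> lam k * (\<integral>x. v x * v x \<partial>M)"
    unfolding v_def
  proof (rule exact.eigenspan_upper)
    fix j assume "j \<in> {1..k}"
    then show "e j \<in> exact.eigs (lam j)" "lam j \<le> lam k" using e mono by (auto simp: mono_on_def)
  qed simp
  then have ray: "exact_form v v \<le> lam k * (L2_norm M v)\<^sup>2" by (simp add: ip)
  have "(\<integral>x. f j x * I_CR \<Omega> \<T> v x \<partial>M) = 0" if j: "j < m" for j
  proof -
    have "(\<integral>x. I_CR \<Omega> \<T> v x * f j x \<partial>M) = (\<integral>x. (\<Sum>i\<in>{1..k}. c i * I_CR \<Omega> \<T> (e i) x) * f j x \<partial>M)"
      unfolding v_def using eH by (subst I_CR_sum) auto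
    also have "\<dots> = (\<Sum>i\<in>{1..k}. c i * (\<integral>x. I_CR \<Omega> \<T> (e i) x * f j x \<partial>M))"
      using f[OF j] by (intro CR.ip_sum I_CR_CR10) auto
    also have "\<dots> = (\<Sum>i<k. (\<integral>x. f j x * I_CR \<Omega> \<T> (e (Suc i)) x \<partial>M) * y i)"
      unfolding re by (simp add: mult.commute)
    finally show ?thesis using y(2) j by (simp add: mult.commute)
  qed
  with v pos ray that show ?thesis by blast
qed

lemma lower_bound_finite:
  assumes ev: "exact_eigenvalues \<Omega> V lam" and dim: "has_dim_ae M (CR10 \<Omega> \<T>) N"
    and CRev: "lists_eigenvalues M (CR_eigenspace \<Omega> \<T> V) {1..N} \<mu>" and k: "1 \<le> k" "k \<le> N"
  shows "glb \<epsilon> \<delta> (\<mu> k) \<le> lam k"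
proof -
  define t where "t = \<mu> k"
  have t: "0 < t" using CRev k by (simp add: lists_eigenvalues_def t_def)
  have CRev': "lists_eigenvalues M CR.eigs {1..N} \<mu>" using CRev by (simp add: CR_eigs)
  obtain f where f: "\<And>j. j \<in> {1..N} \<Longrightarrow> f j \<in> CR.eigs (\<mu> j)"
    and ind: "\<And>K c. finite K \<Longrightarrow> K \<subseteq> {1..N} \<Longrightarrow> AE x in M. (\<Sum>j\<in>K. c j * f j x) = 0 \<Longrightarrow> \<forall>j\<in>K. c j = 0"
    using CR.eigenbasis[OF CRev'] by blast
  have fC: "f (Suc j) \<in> CR10 \<Omega> \<T>" if "j < k - 1" for j using CR.eigs_mem[OF f] that k by simp
  obtain v where v: "v \<in> H10 \<Omega>" "0 < L2_norm M v" "exact_form v v \<le> lam k * (L2_norm M v)\<^sup>2"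
    and orth: "\<And>j. j < k - 1 \<Longrightarrow> (\<integral>x. f (Suc j) x * I_CR \<Omega> \<T> v x \<partial>M) = 0"
    using test_vector[OF ev, of "k - 1" k "\<lambda>j. f (Suc j)"] fC k by auto
  let ?w = "I_CR \<Omega> \<T> v"
  have orth': "(\<integral>x. f j x * ?w x \<partial>M) = 0" if "1 \<le> j" "j < k" for j
    using orth[of "j - 1"] that by simp
  have "t * (\<integral>x. ?w x * ?w x \<partial>M) \<le> CR_form ?w ?w"
    unfolding t_def using CR_form_AE_zero
    by (intro CR.eigenvalue_lower_bound[OF dim k CRev' f ind _ I_CR_CR10 orth']) auto
  \<comment> \<open>\<open>energy_split\<close> trades the discrete gradient energy for the exact
    one minus the squared defect.\<close>
  then have ray: "t * (L2_norm M ?w)\<^sup>2 \<le> ((L2_norm M (weak_grad \<Omega> v))\<^sup>2 - (defect v)\<^sup>2) + (L2_norm M (\<lambda>x. sqrt (V x) * ?w x))\<^sup>2"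
    unfolding CR_form_def V_norm[OF CR10_L2[OF I_CR_CR10]] energy_split[OF v(1)]
    by (simp add: L2_norm_power2[of M ?w] power2_eq_square[of "?w _"])
  \<comment> \<open>The denominator of the bound, with \<open>sqrt t\<close> moved into the
    bracket.\<close>
  define q where "q = 1 + (sqrt t * sqrt \<epsilon> + sqrt \<delta>)\<^sup>2"
  have q: "0 < q" by (simp add: q_def add_pos_nonneg)
  have "t * (L2_norm M v)\<^sup>2 \<le> q * exact_form v v"
    unfolding exact_form_self[OF v(1)] q_def
    using t \<epsilon>_pos \<delta>_nonneg
    by (intro scalar_lower_bound[OF _ _ _ _ _ _ _ _ _ ray norm_le_interpolant[OF v(1)] V_norm_interpolant_le[OF v(1)] defect_le[OF v(1)]])
      (simp_all add: L2_norm_nonneg defect_nonneg)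
  also have "\<dots> \<le> q * (lam k * (L2_norm M v)\<^sup>2)" using v(3) q by (simp add: mult_left_mono)
  finally have "t * (L2_norm M v)\<^sup>2 \<le> (q * lam k) * (L2_norm M v)\<^sup>2" by (simp only: mult.assoc)
  then have "t \<le> q * lam k" using v(2) by (simp add: mult_le_cancel_right)
  then have "t / q \<le> lam k" using q by (simp add: pos_divide_le_eq mult.commute)
  moreover have "(sqrt \<epsilon> + sqrt (\<delta> / t))\<^sup>2 * t = (sqrt t * sqrt \<epsilon> + sqrt \<delta>)\<^sup>2"
  proof -
    have "(sqrt \<epsilon> + sqrt (\<delta> / t))\<^sup>2 * t = ((sqrt \<epsilon> + sqrt (\<delta> / t)) * sqrt t)\<^sup>2"
      using t by (simp add: power_mult_distrib)
    also have "(sqrt \<epsilon> + sqrt (\<delta> / t)) * sqrt t = sqrt t * sqrt \<epsilon> + sqrt \<delta>"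
      using t by (simp add: distrib_right distrib_left real_sqrt_divide mult.commute)
    finally show ?thesis .
  qed
  ultimately show ?thesis by (simp add: glb_def t_def q_def)
qed

text \<open>The interpolant is orthogonal to a basis of \<open>CR10\<close> and therefore null, so
  \<open>v\<close> is its own residual and \<open>residual_norm\<close> bounds it. By
  \<open>GLB_CR_infinity\<close>, \<open>1 / \<epsilon>\<close> is the limit meant by the
  convention.\<close>

lemma lower_bound_infinite:
  assumes ev: "exact_eigenvalues \<Omega> V lam" and dim: "has_dim_ae M (CR10 \<Omega> \<T>) N" and k: "N < k"
  shows "1 / \<epsilon> \<le> lam k"
proof -
  obtain b where b: "\<And>i. i < N \<Longrightarrow> b i \<in> CR10 \<Omega> \<T>"
    and span: "\<forall>u\<in>CR10 \<Omega> \<T>. \<exists>c. AE x in M. u x = (\<Sum>i<N. c i * b i x)"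
    using dim unfolding has_dim_ae_def by auto
  obtain v where v: "v \<in> H10 \<Omega>" "0 < L2_norm M v" "exact_form v v \<le> lam k * (L2_norm M v)\<^sup>2"
    and orth: "\<And>j. j < N \<Longrightarrow> (\<integral>x. b j x * I_CR \<Omega> \<T> v x \<partial>M) = 0"
    using test_vector[OF ev k, of b] b by blast
  let ?w = "I_CR \<Omega> \<T> v"
  obtain c where c: "AE x in M. ?w x = (\<Sum>i<N. c i * b i x)" using span I_CR_CR10 by blast
  have "(\<integral>x. ?w x * ?w x \<partial>M) = (\<integral>x. (\<Sum>i<N. c i * b i x) * ?w x \<partial>M)"
  proof (rule integral_cong_AE)
    show "(\<lambda>x. ?w x * ?w x) \<in> borel_measurable M" "(\<lambda>x. (\<Sum>i<N. c i * b i x) * ?w x) \<in> borel_measurable M"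
      using b by (intro borel_measurable_integrable CR.integrable_prod I_CR_CR10 CR.sum_mem; auto)+
    show "AE x in M. ?w x * ?w x = (\<Sum>i<N. c i * b i x) * ?w x" using c by eventually_elim simp
  qed
  also have "\<dots> = (\<Sum>i<N. c i * (\<integral>x. b i x * ?w x \<partial>M))"
    using b by (intro CR.ip_sum I_CR_CR10) auto
  also have "\<dots> = 0" using orth by simp
  finally have "(L2_norm M ?w)\<^sup>2 = 0"
    unfolding L2_norm_power2 by (simp add: power2_eq_square)
  then have "L2_norm M v \<le> sqrt \<epsilon> * defect v" using norm_le_interpolant[OF v(1)] by simp
  then have "(L2_norm M v)\<^sup>2 \<le> (sqrt \<epsilon> * defect v)\<^sup>2" by (rule power_mono) (rule L2_norm_nonneg)
  also have "\<dots> = \<epsilon> * (defect v)\<^sup>2" using \<epsilon>_pos by (simp add: power_mult_distrib)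
  also have "\<dots> \<le> \<epsilon> * exact_form v v"
    using defect_le[OF v(1)] \<epsilon>_pos unfolding exact_form_self[OF v(1)] by (intro mult_left_mono) (auto intro: add_increasing2)
  also have "\<dots> \<le> \<epsilon> * (lam k * (L2_norm M v)\<^sup>2)" using v(3) \<epsilon>_pos by (intro mult_left_mono) auto
  finally have "1 * (L2_norm M v)\<^sup>2 \<le> (\<epsilon> * lam k) * (L2_norm M v)\<^sup>2" by (simp add: mult.assoc)
  then have "1 \<le> \<epsilon> * lam k" using v(2) by (subst (asm) mult_le_cancel_right) auto
  then show ?thesis using \<epsilon>_pos by (simp add: pos_divide_le_eq mult.commute)
qed

end

theorem theorem3p1:
  fixes \<Omega> :: "(real^'n) set" and \<T> :: "(real^'n) set set" and V :: "real^'n \<Rightarrow> real"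
    and \<kappa> :: real and lam :: "nat \<Rightarrow> real" and lamCR :: "nat \<Rightarrow> ereal" and k :: nat
  assumes "2 \<le> CARD('n)"
    and "polyhedral_lipschitz_domain \<Omega>"
    and "V \<in> Linf (lebesgue_on \<Omega>)" and "essinf (lebesgue_on \<Omega>) V = 0"
    and "regular_triangulation \<Omega> \<T>"
    and "CR_interpolation_constant \<Omega> \<T> \<kappa>"
    and "exact_eigenvalues \<Omega> V lam"
    and "CR_eigenvalues \<Omega> \<T> V lamCR"
    and "1 \<le> k"
  shows "GLB_CR (mesh_epsilon \<Omega> \<T> \<kappa>) (mesh_delta \<Omega> \<T> V \<kappa>) (lamCR k) \<le> lam k"
proof -
  interpret CR_problem \<Omega> \<T> V \<kappa>
    by unfold_locales (use assms in auto)
  obtain N \<mu> where dim: "has_dim_ae (lebesgue_on \<Omega>) (CR10 \<Omega> \<T>) N"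
    and ev: "lists_eigenvalues (lebesgue_on \<Omega>) (CR_eigenspace \<Omega> \<T> V) {1..N} \<mu>"
    and lamCR: "lamCR k = (if k \<le> N then ereal (\<mu> k) else \<infinity>)"
    using assms(8,9) unfolding CR_eigenvalues_def by blast
  show ?thesis
  proof (cases "k \<le> N")
    case True
    then show ?thesis
      using lower_bound_finite[OF assms(7) dim ev assms(9)] lamCR by (simp add: GLB_CR_def)
  next
    case False
    then show ?thesis
      using lower_bound_infinite[OF assms(7) dim, of k] lamCR by (simp add: GLB_CR_infinity[OF \<epsilon>_pos])
  qed
qed

end
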